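(* Let $n \geq 2$ be an integer. Up to isomorphism, the tournaments of the class $\mathcal{T}_{\delta}^{4n}$ (the $4n$-vertex tournaments $T$ with $\delta(T)=\delta(4n)$) are exactly the tournaments $$\underline{3}(\underline{1},\,T_{2n-1}.\underline{2},\,\underline{1}),$$ where $T_{2n-1}$ is an arbitrary $(2n-1)$-vertex tournament.
   Context: A tournament $T$ consists of a finite vertex set $V(T)$ and a set $A(T)$ of ordered pairs of distinct vertices (arcs) such that for all $x\neq y\in V(T)$, $(x,y)\in A(T)$ if and only if $(y,x)\notin A(T)$; $v(T)=|V(T)|$. A module of $T$ is a subset $M\subseteq V(T)$ such that for all $x,y\in M$ and $v\in V(T)\setminus M$, $(v,x)\in A(T)$ if and only if $(v,y)\in A(T)$. The trivial modules are $\emptyset$, the singletons and $V(T)$. $T$ is indecomposable if all its modules are trivial, and decomposable otherwise. For $B\subseteq A(T)$, ${\rm Inv}(T,B)$ is the tournament obtained from $T$ by reversing all arcs of $B$. For a tournament $T$ with $v(T)\ge 5$, the decomposability index $\delta(T)$ is the smallest integer $m$ for which there is $B\subseteq A(T)$ with $|B|=m$ and ${\rm Inv}(T,B)$ indecomposable (it is well-defined since for every $n\geq 5$ there exist indecomposable $n$-vertex tournaments). For an integer $m\ge 5$, $\delta(m)$ is the maximum of $\delta(T)$ over the $m$-vertex tournaments $T$, and $\mathcal{T}_{\delta}^{m}$ is the class of $m$-vertex tournaments $T$ with $\delta(T)=\delta(m)$ (tournaments with $\delta$-maximal decomposability). For $k\geq 1$, $\underline{k}$ is the transitive tournament on $\{0,\ldots,k-1\}$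 whose arcs are the pairs $(i,j)$ with $0\le i<j\le k-1$. Given a tournament $T$ with $V(T)=\{0,\ldots,k-1\}$ and tournaments $H_0,\ldots,H_{k-1}$ (replaced by isomorphic copies on pairwise disjoint vertex sets if necessary), the lexicographic sum $T(H_0,\ldots,H_{k-1})$ is the tournament on $\bigcup_i V(H_i)$ in which, for $x\in V(H_i)$ and $y\in V(H_j)$, $(x,y)$ is an arc if either $i=j$ and $(x,y)\in A(H_i)$, or $i\ne j$ and $(i,j)\in A(T)$. When all $H_i$ are isomorphic to one tournament $H$, this sum is denoted $T.H$. *)

theory Defs
  imports "Graph_Theory.Graph_Theory" "HOL-Library.Nat_Bijection"
begin

locale tournament = pair_digraph T for T :: "'a pair_pre_digraph" +
  assumes arc_iff: "\<lbrakk>x \<in> pverts T; y \<in> pverts T; x \<noteq> y\<rbrakk>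
    \<Longrightarrow> (x, y) \<in> parcs T \<longleftrightarrow> (y, x) \<notin> parcs T"

definition module_of :: "'a pair_pre_digraph \<Rightarrow> 'a set \<Rightarrow> bool" where
  "module_of T M \<longleftrightarrow> M \<subseteq> pverts T \<and>
     (\<forall>x\<in>M. \<forall>y\<in>M. \<forall>v\<in>pverts T - M. (v, x) \<in> parcs T \<longleftrightarrow> (v, y) \<in> parcs T)"

definition trivial_module :: "'a pair_pre_digraph \<Rightarrow> 'a set \<Rightarrow> bool" where
  "trivial_module T M \<longleftrightarrow> M = {} \<or> (\<exists>x\<in>pverts T. M = {x}) \<or> M = pverts T"

definition indecomposable :: "'a pair_pre_digraph \<Rightarrow> bool" where
  "indecomposable T \<longleftrightarrow> (\<forall>M. module_of T M \<longrightarrow> trivial_module T M)"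

definition Inv :: "'a pair_pre_digraph \<Rightarrow> 'a rel \<Rightarrow> 'a pair_pre_digraph" where
  "Inv T B = \<lparr>pverts = pverts T, parcs = (parcs T - B) \<union> B\<inverse>\<rparr>"

text \<open>The minimum below exists, and \<open>decomp_index\<close> is meaningful, only for tournaments with
  at least five vertices.\<close>

definition decomp_index :: "'a pair_pre_digraph \<Rightarrow> nat" where
  "decomp_index T = (LEAST m. \<exists>B\<subseteq>parcs T. card B = m \<and> indecomposable (Inv T B))"

text \<open>Every finite tournament has an isomorphic copy with vertices in \<^typ>\<open>nat\<close>, so the
  maximum may be taken over these. The set of tournaments is infinite, but the set of their
  indices is finite: for \<open>m \<ge> 5\<close> an index is at most the number \<open>m choose 2\<close> of arcs.\<close>

definition max_decomp_index :: "nat \<Rightarrow> nat" where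
  "max_decomp_index m =
     Max {decomp_index T | T :: nat pair_pre_digraph. tournament T \<and> card (pverts T) = m}"

definition max_decomp_class :: "nat \<Rightarrow> 'a pair_pre_digraph set" where
  "max_decomp_class m =
     {T. tournament T \<and> card (pverts T) = m \<and> decomp_index T = max_decomp_index m}"

definition transitive_tournament :: "nat \<Rightarrow> nat pair_pre_digraph" where
  "transitive_tournament k = \<lparr>pverts = {..<k}, parcs = {(i, j). i < j \<and> j < k}\<rparr>"

text \<open>The summands are made disjoint by encoding vertex \<open>x\<close> of the summand \<open>H i\<close> as the natural
  number \<open>prod_encode (i, x)\<close>, so that a sum can again be a summand. The index tournament may
  have any set of natural numbers as its vertex set.\<close>

definition lex_sum :: "nat pair_pre_digraph \<Rightarrow> (nat \<Rightarrow> nat pair_pre_digraph) \<Rightarrow> nat pair_pre_digraph"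
where
  "lex_sum T H =
    \<lparr>pverts = {prod_encode (i, x) | i x. i \<in> pverts T \<and> x \<in> pverts (H i)},
     parcs = {(prod_encode (i, x), prod_encode (j, y)) | i x j y.
       i \<in> pverts T \<and> x \<in> pverts (H i) \<and> j \<in> pverts T \<and> y \<in> pverts (H j) \<and>
       (i = j \<and> (x, y) \<in> parcs (H i) \<or> i \<noteq> j \<and> (i, j) \<in> parcs T)}\<rparr>"

definition lex_product :: "nat pair_pre_digraph \<Rightarrow> nat pair_pre_digraph \<Rightarrow> nat pair_pre_digraph" where
  "lex_product T H = lex_sum T (\<lambda>_. H)"

end

theory Submission
  imports Defs
begin

text \<open>
  For tournaments, call a set a co-module if it or its complement is a nontrivial module. If
  \<open>Inv(T, B)\<close> is indecomposable, then every co-module contains an end of an arc of \<open>B\<close>, so twice the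
  size of \<open>B\<close> is at least the number of disjoint co-modules. On \<open>4n\<close> vertices, \<open>2n + 1\<close> disjoint
  co-modules force a source, a sink and \<open>2n - 1\<close> modules with two elements, which is the tournament
  in question.

  For the upper bound, choose disjoint minimal nontrivial modules \<open>K w\<close> with representatives \<open>w\<close> that
  hit all nontrivial modules, where \<open>w\<close> is the sink of \<open>K w\<close> whenever \<open>K w\<close> has two elements. Join
  the representatives, together with the source, the sink or a vertex outside the modules that
  contain all of them, by edges such that every module is crossed by an edge, and reverse the arcs
  along the edges. Let \<open>M\<close> be a nontrivial module afterwards and \<open>ab\<close> an edge with \<open>a \<in> M\<close> and
  \<open>b \<notin> M\<close>. Since \<open>b\<close> splits \<open>K a\<close>, the set \<open>K a\<close> is a pair \<open>{a', a}\<close>, and \<open>a'\<close> forces \<open>a\<close> to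
  dominate \<open>M - {a}\<close>; the vertices of \<open>K b\<close> then lead to a contradiction, because \<open>K b\<close> does not
  distinguish \<open>a\<close> from the rest of \<open>M\<close> in the way \<open>b\<close> does. To cross every module with few edges,
  list the representatives in an order in which modules are intervals and join the \<open>i\<close>-th to the
  \<open>(i + k)\<close>-th, where \<open>k\<close> is half their number.
\<close>

section \<open>Modules of tournament relations\<close>

text \<open>The contradiction at \<open>K b\<close> leaves one gap: \<open>M\<close> may consist of
  \<open>a\<close> and a part of \<open>K b\<close>. In that case \<open>insert a (K b)\<close> is a
  module of the original tournament, \<open>b\<close> is the only neighbour of \<open>a\<close>, and
  \<open>b\<close> is not the sink of \<open>K b\<close>. The edges are chosen to rule this out. In
  the half-shift order \<open>a\<close> and \<open>b\<close> are \<open>k\<close> \<ge> 2 places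
  apart, while a module meets the joined vertices in an interval, so \<open>{a, b}\<close> is not a
  trace. This needs four joined vertices; fewer are handled separately, by a single edge or a path
  whose middle vertex is chosen with care. A second obstacle are the joined vertices that represent
  no \<open>K w\<close>. They have no minimal module to argue with, so it has to be shown in another
  way that no module separates them from their neighbours. A source and a sink succeed unless a
  short list of sets are modules. A vertex outside a module containing all representatives succeeds
  once that module is taken of maximum size, because the quotient by it is prime. In the few failing
  configurations the neighbour or the outer vertex is not prescribed; a counting argument finds a
  suitable one.\<close>

definition rmodule :: "'a set \<Rightarrow> ('a \<Rightarrow> 'a \<Rightarrow> bool) \<Rightarrow> 'a set \<Rightarrow> bool" where
  "rmodule V R M \<longleftrightarrow> M \<subseteq> V \<and> (\<forall>x\<in>M. \<forall>y\<in>M. \<forall>v\<in>V - M. R v x \<longleftrightarrow> R v y)"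

definition ntmodule :: "'a set \<Rightarrow> ('a \<Rightarrow> 'a \<Rightarrow> bool) \<Rightarrow> 'a set \<Rightarrow> bool" where
  "ntmodule V R M \<longleftrightarrow> rmodule V R M \<and> 2 \<le> card M \<and> M \<noteq> V"

text \<open>Edges are unordered, so the same set serves a tournament and its converse, and two
  successive reversals combine to the symmetric difference.\<close>

definition flip :: "'a set set \<Rightarrow> ('a \<Rightarrow> 'a \<Rightarrow> bool) \<Rightarrow> 'a \<Rightarrow> 'a \<Rightarrow> bool" where
  "flip ES R x y \<longleftrightarrow> R x y \<noteq> ({x, y} \<in> ES)"

lemma rmoduleI:
  assumes "M \<subseteq> V" "\<And>x y v. x \<in> M \<Longrightarrow> y \<in> M \<Longrightarrow> v \<in> V \<Longrightarrow> v \<notin> M \<Longrightarrow> R v x \<Longrightarrow> R v y"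
  shows "rmodule V R M"
  using assms unfolding rmodule_def by blast

lemma card_ge2_obtain:
  assumes "2 \<le> card M"
  obtains y where "y \<in> M" "y \<noteq> x"
proof -
  have "\<not> M \<subseteq> {x}" using assms card_mono[of "{x}" M] by auto
  then show ?thesis using that by blast
qed

locale rel_tournament =
  fixes V :: "'a set" and R :: "'a \<Rightarrow> 'a \<Rightarrow> bool"
  assumes fin: "finite V"
    and irrefl: "x \<in> V \<Longrightarrow> \<not> R x x"
    and arc: "x \<in> V \<Longrightarrow> y \<in> V \<Longrightarrow> x \<noteq> y \<Longrightarrow> R x y \<longleftrightarrow> \<not> R y x"
begin

lemma rmodule_in: "rmodule V R M \<Longrightarrow> x \<in> M \<Longrightarrow> y \<in> M \<Longrightarrow> v \<in> V \<Longrightarrow> v \<notin> M \<Longrightarrow> R v x = R v y"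
  unfolding rmodule_def by blast

lemma rmodule_sub: "rmodule V R M \<Longrightarrow> M \<subseteq> V"
  unfolding rmodule_def by blast

lemma rmodule_out:
  assumes "rmodule V R M" "x \<in> M" "y \<in> M" "v \<in> V" "v \<notin> M"
  shows "R x v = R y v"
  using rmodule_in[OF assms] rmodule_sub[OF assms(1)] arc assms by (metis subsetD)

lemma rmodule_Int:
  assumes "rmodule V R M" "rmodule V R L" shows "rmodule V R (M \<inter> L)"
  using assms unfolding rmodule_def by blast

lemma rmodule_Un:
  assumes "rmodule V R M" "rmodule V R L" "M \<inter> L \<noteq> {}" shows "rmodule V R (M \<union> L)"
proof -
  obtain z where z: "z \<in> M" "z \<in> L" using assms by blast
  show ?thesis
  proof (rule rmoduleI)
    show "M \<union> L \<subseteq> V" using assms rmodule_sub by blast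
    fix x y v assume *: "x \<in> M \<union> L" "y \<in> M \<union> L" "v \<in> V" "v \<notin> M \<union> L" "R v x"
    have "R v x = R v z" "R v y = R v z"
      using * z rmodule_in[OF assms(1)] rmodule_in[OF assms(2)] by blast+
    then show "R v y" using * by blast
  qed
qed

text \<open>Only a vertex \<open>v\<close> in both sets needs an argument. Some \<open>l\<close> in
  \<open>L\<close> but not in \<open>M\<close> can replace it: vertices outside \<open>L\<close> do
  not tell \<open>v\<close> from \<open>l\<close>, and \<open>l\<close> does not tell vertices of
  \<open>M\<close> apart.\<close>

lemma rmodule_Diff:
  assumes "rmodule V R M" "rmodule V R L" "\<not> L \<subseteq> M" shows "rmodule V R (M - L)"
proof (rule rmoduleI)
  show "M - L \<subseteq> V" using assms rmodule_sub by blast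
  obtain l where l: "l \<in> L" "l \<notin> M" using assms by blast
  fix x y v assume *: "x \<in> M - L" "y \<in> M - L" "v \<in> V" "v \<notin> M - L" "R v x"
  show "R v y"
  proof (cases "v \<in> M")
    case False then show ?thesis using * rmodule_in[OF assms(1)] by blast
  next
    case True
    then have "v \<in> L" using * by blast
    have xy: "x \<in> V" "y \<in> V" "l \<in> V" using * l assms rmodule_sub by blast+
    have "R v x = R l x" "R v y = R l y" using rmodule_out[OF assms(2)] \<open>v \<in> L\<close> l * xy by blast+
    moreover have "R l x = R l y" using rmodule_in[OF assms(1)] l * xy by blast
    ultimately show ?thesis using * by blast
  qed
qed

lemma rmodule_trans:
  assumes "rmodule V R K" "rmodule K R L" shows "rmodule V R L"
proof (rule rmoduleI)
  show "L \<subseteq> V" using assms unfolding rmodule_def by blast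
  fix x y v assume *: "x \<in> L" "y \<in> L" "v \<in> V" "v \<notin> L" "R v x"
  show "R v y"
  proof (cases "v \<in> K")
    case True then show ?thesis using * assms(2) unfolding rmodule_def by blast
  next
    case False
    have "x \<in> K" "y \<in> K" using * assms(2) unfolding rmodule_def by blast+
    then show ?thesis using False * assms(1) unfolding rmodule_def by blast
  qed
qed

lemma rmodule_restrict: "rmodule V R M \<Longrightarrow> X \<subseteq> V \<Longrightarrow> rmodule X R (M \<inter> X)"
  unfolding rmodule_def by blast

lemma ntmoduleD:
  assumes "ntmodule V R M"
  shows "rmodule V R M" "2 \<le> card M" "M \<noteq> V" "M \<subseteq> V" "finite M"
  using assms rmodule_sub fin unfolding ntmodule_def by (auto intro: finite_subset)

lemma flip_tournament:
  assumes "\<And>e x. e \<in> ES \<Longrightarrow> e \<noteq> {x}"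
  shows "rel_tournament V (flip ES R)"
proof
  show "finite V" by (rule fin)
  show "\<not> flip ES R x x" if "x \<in> V" for x using irrefl[OF that] assms[of "{x}" x] by (auto simp: flip_def)
  show "flip ES R x y = (\<not> flip ES R y x)" if "x \<in> V" "y \<in> V" "x \<noteq> y" for x y
    using arc[OF that] by (auto simp: flip_def insert_commute)
qed

lemma source_compl_module:
  assumes "s \<in> V" "\<And>v. v \<in> V \<Longrightarrow> v \<noteq> s \<Longrightarrow> R s v" shows "rmodule V R (V - {s})"
  using assms unfolding rmodule_def by auto

lemma sink_compl_module:
  assumes "s \<in> V" "\<And>v. v \<in> V \<Longrightarrow> v \<noteq> s \<Longrightarrow> R v s" shows "rmodule V R (V - {s})"
proof (rule rmoduleI)
  fix x y v assume "x \<in> V - {s}" "y \<in> V - {s}" "v \<in> V" "v \<notin> V - {s}" "R v x"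
  then show "R v y" using arc[of x v] assms by blast
qed blast

lemma compl_module_source_sink:
  assumes "s \<in> V" "rmodule V R (V - {s})"
  shows "(\<forall>v\<in>V-{s}. R s v) \<or> (\<forall>v\<in>V-{s}. R v s)"
proof (cases "\<exists>u\<in>V - {s}. R s u")
  case True
  then obtain u where u: "u \<in> V - {s}" "R s u" by blast
  then have "\<forall>v\<in>V - {s}. R s v" using rmodule_in[OF assms(2) u(1), of _ s] assms(1) by blast
  then show ?thesis ..
next
  case False
  then have "\<forall>v\<in>V - {s}. R v s" using arc assms(1) by blast
  then show ?thesis ..
qed

end

lemma rel_tournament_converse:
  assumes "rel_tournament V R" shows "rel_tournament V (\<lambda>x y. R y x)"
proof -
  interpret rel_tournament V R by fact
  show ?thesis using fin irrefl arc by unfold_locales blast+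
qed

lemma rmodule_converse:
  assumes arc: "\<And>x y. x \<in> V \<Longrightarrow> y \<in> V \<Longrightarrow> x \<noteq> y \<Longrightarrow> R x y \<longleftrightarrow> \<not> R y x"
  shows "rmodule V (\<lambda>x y. R y x) M \<longleftrightarrow> rmodule V R M"
proof (cases "M \<subseteq> V")
  case True
  then have "R x v \<longleftrightarrow> \<not> R v x" if "x \<in> M" "v \<in> V - M" for x v using arc[of x v] that by blast
  then show ?thesis unfolding rmodule_def by blast
qed (simp add: rmodule_def)

lemma flip_converse: "flip ES (\<lambda>x y. R y x) = (\<lambda>x y. flip ES R y x)"
  by (auto simp: flip_def fun_eq_iff insert_commute)

section \<open>Linear orders in which every module is an interval\<close>

function pivot_sort :: "('a \<Rightarrow> 'a \<Rightarrow> bool) \<Rightarrow> 'a list \<Rightarrow> 'a list" where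
  "pivot_sort R [] = []"
| "pivot_sort R (p # xs) =
     pivot_sort R (filter (\<lambda>x. R x p) xs) @ p # pivot_sort R (filter (\<lambda>x. \<not> R x p) xs)"
  by pat_completeness auto
termination
  by (relation "measure (length \<circ> snd)") (auto simp: less_Suc_eq_le)

lemma set_pivot_sort [simp]: "set (pivot_sort R xs) = set xs"
  by (induction R xs rule: pivot_sort.induct) auto

lemma distinct_pivot_sort: "distinct xs \<Longrightarrow> distinct (pivot_sort R xs)"
  by (induction R xs rule: pivot_sort.induct) auto

lemma rel_tournament_subset: "rel_tournament V R \<Longrightarrow> X \<subseteq> V \<Longrightarrow> rel_tournament X R"
  unfolding rel_tournament_def by (meson finite_subset subsetD)

text \<open>If the pivot lies in \<open>Z\<close>, all vertices outside \<open>Z\<close> dominate it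
  and are sorted before it, so everything after the pivot belongs to \<open>Z\<close>. Otherwise the
  pivot dominates \<open>Z\<close>, and \<open>Z\<close> lies in the part after it.\<close>

lemma pivot_sort_terminal:
  assumes "rel_tournament (set xs) R" "distinct xs" "Z \<subseteq> set xs"
    and "\<And>a z. a \<in> set xs \<Longrightarrow> a \<notin> Z \<Longrightarrow> z \<in> Z \<Longrightarrow> R a z"
  shows "\<exists>A B. pivot_sort R xs = A @ B \<and> set B = Z"
  using assms
proof (induction R xs arbitrary: Z rule: pivot_sort.induct)
  case (1 R)
  then show ?case by auto
next
  case (2 R p xs)
  let ?N = "filter (\<lambda>x. R x p) xs" and ?P = "filter (\<lambda>x. \<not> R x p) xs"
  interpret rel_tournament "set (p # xs)" R by (rule 2)
  have N: "rel_tournament (set ?N) R" and P: "rel_tournament (set ?P) R"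
    by (rule rel_tournament_subset[OF 2(3)], auto)+
  show ?case
  proof (cases "p \<in> Z")
    case True
    have "\<exists>A B. pivot_sort R ?N = A @ B \<and> set B = Z \<inter> set ?N"
      by (rule 2(1)[OF N]) (use 2(4-6) in auto)
    then obtain A B where AB: "pivot_sort R ?N = A @ B" "set B = Z \<inter> set ?N" by blast
    have "set ?P \<subseteq> Z" using 2(6) True by auto
    then have "set (B @ p # pivot_sort R ?P) = Z" using AB True 2(5) by auto
    moreover have "pivot_sort R (p # xs) = A @ (B @ p # pivot_sort R ?P)" using AB by simp
    ultimately show ?thesis by blast
  next
    case False
    have "Z \<subseteq> set ?P"
    proof
      fix z assume z: "z \<in> Z"
      then have "R p z" using 2(6) False by simp
      then show "z \<in> set ?P" using arc[of p z] z False 2(5) by auto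
    qed
    then have "\<exists>A B. pivot_sort R ?P = A @ B \<and> set B = Z"
      by (intro 2(2)[OF P]) (use 2(4-6) in auto)
    then obtain A B where AB: "pivot_sort R ?P = A @ B" "set B = Z" by blast
    then have "pivot_sort R (p # xs) = (pivot_sort R ?N @ p # A) @ B" by simp
    then show ?thesis using AB by blast
  qed
qed

lemma pivot_sort_initial:
  assumes "rel_tournament (set xs) R" "distinct xs" "Z \<subseteq> set xs"
    and "\<And>a z. a \<in> set xs \<Longrightarrow> a \<notin> Z \<Longrightarrow> z \<in> Z \<Longrightarrow> R z a"
  shows "\<exists>A B. pivot_sort R xs = A @ B \<and> set A = Z"
proof -
  have "\<exists>A B. pivot_sort R xs = A @ B \<and> set B = set xs - Z"
    by (rule pivot_sort_terminal) (use assms in auto)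
  then obtain A B where AB: "pivot_sort R xs = A @ B" "set B = set xs - Z" by blast
  have "distinct (A @ B)" "set (A @ B) = set xs"
    using AB(1) distinct_pivot_sort[OF assms(2)] set_pivot_sort by metis+
  then have "set A = Z" using AB assms by auto
  then show ?thesis using AB by blast
qed

text \<open>Sorting with pivots, as in quicksort, produces from any list an order in which all modules are
  intervals: a module containing the pivot meets the in-neighbours of the pivot in a terminal
  part and the out-neighbours in an initial part.\<close>

lemma pivot_sort_module:
  assumes "rel_tournament (set xs) R" "distinct xs" "rmodule (set xs) R M"
  shows "\<exists>A B C. pivot_sort R xs = A @ B @ C \<and> set B = M"
  using assms
proof (induction R xs arbitrary: M rule: pivot_sort.induct)
  case (1 R)
  then show ?case by (auto simp: rmodule_def)
next
  case (2 R p xs)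
  let ?N = "filter (\<lambda>x. R x p) xs" and ?P = "filter (\<lambda>x. \<not> R x p) xs"
  interpret rel_tournament "set (p # xs)" R by (rule 2)
  have N: "rel_tournament (set ?N) R" and P: "rel_tournament (set ?P) R"
    by (rule rel_tournament_subset[OF 2(3)], auto)+
  have M: "M \<subseteq> set (p # xs)" using rmodule_sub[OF 2(5)] .
  have p: "p \<notin> set xs" using 2(4) by simp
  show ?case
  proof (cases "p \<in> M")
    case True
    have "\<exists>A B. pivot_sort R ?N = A @ B \<and> set B = M \<inter> set ?N"
    proof (rule pivot_sort_terminal[OF N])
      fix a z assume *: "a \<in> set ?N" "a \<notin> M \<inter> set ?N" "z \<in> M \<inter> set ?N"
      then have "R a p = R a z" using rmodule_in[OF 2(5) True, of z a] by auto
      then show "R a z" using * by auto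
    qed (use 2(4) in auto)
    then obtain A B where AB: "pivot_sort R ?N = A @ B" "set B = M \<inter> set ?N" by blast
    have "\<exists>A B. pivot_sort R ?P = A @ B \<and> set A = M \<inter> set ?P"
    proof (rule pivot_sort_initial[OF P])
      fix a z assume *: "a \<in> set ?P" "a \<notin> M \<inter> set ?P" "z \<in> M \<inter> set ?P"
      then have "R a p = R a z" using rmodule_in[OF 2(5) True, of z a] by auto
      then show "R z a" using * arc[of a z] by auto
    qed (use 2(4) in auto)
    then obtain B' C where C: "pivot_sort R ?P = B' @ C" "set B' = M \<inter> set ?P" by blast
    have "pivot_sort R (p # xs) = A @ (B @ p # B') @ C" using AB C by simp
    moreover have "set (B @ p # B') = M" using AB C True M by auto
    ultimately show ?thesis by blast
  next
    case False
    \<comment> \<open>A module that avoids the pivot lies entirely on one side of it.\<close>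
    have "R x p = R y p" if "x \<in> M" "y \<in> M" for x y
      using rmodule_out[OF 2(5) that, of p] False by auto
    then have "M \<subseteq> set ?N \<or> M \<subseteq> set ?P" using M False by auto
    then show ?thesis
    proof
      assume *: "M \<subseteq> set ?N"
      have "\<exists>A B C. pivot_sort R ?N = A @ B @ C \<and> set B = M"
        by (rule 2(1)[OF N]) (use 2(4) rmodule_restrict[OF 2(5), of "set ?N"] * in \<open>auto simp: Int_absorb2\<close>)
      then obtain A B C where "pivot_sort R ?N = A @ B @ C" "set B = M" by blast
      then have "pivot_sort R (p # xs) = A @ B @ (C @ p # pivot_sort R ?P)" "set B = M" by simp_all
      then show ?thesis by blast
    next
      assume *: "M \<subseteq> set ?P"
      have "\<exists>A B C. pivot_sort R ?P = A @ B @ C \<and> set B = M"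
        by (rule 2(2)[OF P]) (use 2(4) rmodule_restrict[OF 2(5), of "set ?P"] * in \<open>auto simp: Int_absorb2\<close>)
      then obtain A B C where "pivot_sort R ?P = A @ B @ C" "set B = M" by blast
      then have "pivot_sort R (p # xs) = (pivot_sort R ?N @ p # A) @ B @ C" "set B = M" by simp_all
      then show ?thesis by blast
    qed
  qed
qed

lemma (in rel_tournament) module_order:
  obtains xs where "distinct xs" "set xs = V"
    and "\<And>M. rmodule V R M \<Longrightarrow> \<exists>A B C. xs = A @ B @ C \<and> set B = M"
proof -
  obtain ys where ys: "set ys = V" "distinct ys" using fin finite_distinct_list by blast
  show ?thesis
    by (rule that[of "pivot_sort R ys"])
      (use ys pivot_sort_module[of ys R] rel_tournament_axioms in \<open>auto intro: distinct_pivot_sort\<close>)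
qed

section \<open>Disjoint minimal modules and representatives\<close>

text \<open>\<open>K_pred\<close> makes \<open>w\<close> the sink of \<open>K w\<close> when
  \<open>K w\<close> is a pair. For larger \<open>K w\<close> it is true of every vertex, because
  removing a source of \<open>K w\<close> would leave a smaller module with at least two
  elements.\<close>

locale module_family = rel_tournament V R for V :: "'a set" and R +
  fixes W :: "'a set" and K :: "'a \<Rightarrow> 'a set"
  assumes K_ntmodule: "w \<in> W \<Longrightarrow> ntmodule V R (K w)"
    and K_min: "w \<in> W \<Longrightarrow> rmodule V R L \<Longrightarrow> L \<subseteq> K w \<Longrightarrow> L \<noteq> K w \<Longrightarrow> card L \<le> 1"
    and K_self: "w \<in> W \<Longrightarrow> w \<in> K w"
    and K_disj: "w \<in> W \<Longrightarrow> w' \<in> W \<Longrightarrow> x \<in> K w \<Longrightarrow> x \<in> K w' \<Longrightarrow> w = w'"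
    and K_pred: "w \<in> W \<Longrightarrow> \<exists>c\<in>K w. c \<noteq> w \<and> R c w"

section \<open>Minimal nontrivial modules and twin pairs\<close>

context rel_tournament
begin

definition min_ntmodule :: "'a set \<Rightarrow> bool" where
  "min_ntmodule M \<longleftrightarrow> ntmodule V R M \<and> (\<forall>L. rmodule V R L \<longrightarrow> L \<subseteq> M \<longrightarrow> L \<noteq> M \<longrightarrow> card L \<le> 1)"

lemma min_ntmoduleD:
  assumes "min_ntmodule M"
  shows "ntmodule V R M" "rmodule V R M" "2 \<le> card M" "M \<noteq> V" "M \<subseteq> V" "finite M"
  using assms ntmoduleD[of M] unfolding min_ntmodule_def by auto

lemma min_ntmodule_card:
  "min_ntmodule M \<Longrightarrow> rmodule V R L \<Longrightarrow> L \<subseteq> M \<Longrightarrow> L \<noteq> M \<Longrightarrow> card L \<le> 1"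
  unfolding min_ntmodule_def by blast

lemma min_ntmodule_ex:
  "ntmodule V R L \<Longrightarrow> \<exists>M. min_ntmodule M \<and> M \<subseteq> L"
proof (induction "card L" arbitrary: L rule: less_induct)
  case less
  show ?case
  proof (cases "min_ntmodule L")
    case False
    then obtain L' where L': "rmodule V R L'" "L' \<subseteq> L" "L' \<noteq> L" "\<not> card L' \<le> 1"
      using less.prems unfolding min_ntmodule_def by blast
    have L: "finite L" "L \<subseteq> V" using ntmoduleD[OF less.prems] by blast+
    have "card L' < card L" using L' L by (meson psubsetI psubset_card_mono)
    moreover have "ntmodule V R L'" using L' L ntmoduleD(3)[OF less.prems]
      unfolding ntmodule_def by auto
    ultimately show ?thesis using less.hyps[of L'] L' by blast
  qed blast
qed

text \<open>Both \<open>A \<inter> B\<close> and \<open>A - B\<close> are modules properly inside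
  \<open>A\<close> and thus have at most one element. Conflicts between minimal modules therefore
  arise only among pairs.\<close>

lemma min_ntmodule_overlap:
  assumes A: "min_ntmodule A" and B: "min_ntmodule B" and "A \<noteq> B" "A \<inter> B \<noteq> {}"
  shows "card A = 2"
proof -
  note mA = min_ntmoduleD(2,3)[OF A] and mB = min_ntmoduleD(2,3)[OF B]
  have nAB: "\<not> A \<subseteq> B"
  proof
    assume "A \<subseteq> B"
    then have "card A \<le> 1" using min_ntmodule_card[OF B mA(1)] assms(3) by blast
    then show False using mA(2) by linarith
  qed
  have nBA: "\<not> B \<subseteq> A"
  proof
    assume "B \<subseteq> A"
    then have "card B \<le> 1" using min_ntmodule_card[OF A mB(1)] assms(3) by blast
    then show False using mB(2) by linarith
  qed
  have "card (A \<inter> B) \<le> 1"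
    using min_ntmodule_card[OF A rmodule_Int[OF mA(1) mB(1)]] nAB by blast
  moreover have "card (A - B) \<le> 1"
    using min_ntmodule_card[OF A rmodule_Diff[OF mA(1) mB(1) nBA]] assms(4) by blast
  moreover have "card A = card (A \<inter> B) + card (A - B)"
    using min_ntmoduleD(6)[OF A] by (metis card_Int_Diff)
  ultimately show ?thesis using mA by linarith
qed

text \<open>\<open>z\<close> does not tell \<open>x\<close> from \<open>y\<close>, and
  \<open>y\<close> does not tell \<open>x\<close> from \<open>z\<close>, so distinct
  \<open>y\<close> and \<open>z\<close> would dominate each other.\<close>

lemma twins_source_unique:
  assumes "x \<in> V" "y \<in> V" "z \<in> V" "R x y" "R x z" "rmodule V R {x, y}" "rmodule V R {x, z}"
  shows "y = z"
proof (rule ccontr)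
  assume "y \<noteq> z"
  have "x \<noteq> y" "x \<noteq> z" using assms irrefl by blast+
  have "R x z = R y z" using rmodule_out[OF assms(6), of x y z] assms \<open>x \<noteq> z\<close> \<open>y \<noteq> z\<close> by blast
  moreover have "R x y = R z y" using rmodule_out[OF assms(7), of x z y] assms \<open>x \<noteq> y\<close> \<open>y \<noteq> z\<close> by blast
  ultimately show False using assms arc[of y z] \<open>y \<noteq> z\<close> by blast
qed

definition twins :: "('a \<times> 'a) set" where
  "twins = {(x, y). x \<in> V \<and> y \<in> V \<and> R x y \<and> ntmodule V R {x, y}}"

text \<open>From the source to the sink of a twin pair the set of in-neighbours grows strictly: the
  sink inherits those of the source and gains the source itself.\<close>

lemma wf_twins: "wf twins"
proof (rule wf_subset[OF wf_measure[of "\<lambda>x. card {v \<in> V. R v x}"]], clarify)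
  fix x y assume xy: "(x, y) \<in> twins"
  then have *: "x \<in> V" "y \<in> V" "R x y" "rmodule V R {x, y}"
    using ntmoduleD(1)[of "{x, y}"] unfolding twins_def by auto
  have "{v \<in> V. R v x} \<subset> {v \<in> V. R v y}"
  proof
    show "{v \<in> V. R v x} \<subseteq> {v \<in> V. R v y}"
    proof safe
      fix v assume v: "v \<in> V" "R v x"
      have "x \<noteq> y" using * irrefl by blast
      then have "v \<noteq> x" "v \<noteq> y" using v irrefl[of x] arc[of x y] * by blast+
      then show "R v y" using rmodule_in[OF *(4), of x y v] v by blast
    qed
    have "x \<in> {v \<in> V. R v y}" "x \<notin> {v \<in> V. R v x}" using * irrefl by blast+
    then show "{v \<in> V. R v x} \<noteq> {v \<in> V. R v y}" by blast
  qed
  then show "(x, y) \<in> measure (\<lambda>x. card {v \<in> V. R v x})"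
    using fin by (simp add: psubset_card_mono)
qed

end

text \<open>The vertices without \<open>P\<close> form a kernel of the digraph \<open>D\<close>. On
  a chain of overlapping twin pairs this selects every second vertex, so the pairs that end in a
  selected vertex are disjoint, and still every pair of the chain contains a selected
  vertex.\<close>

lemma kernel_ex:
  assumes "wf D" shows "\<exists>P. \<forall>w. P w \<longleftrightarrow> (\<exists>v. (v, w) \<in> D \<and> \<not> P v)"
proof -
  let ?H = "\<lambda>f w. \<exists>v. (v, w) \<in> D \<and> \<not> f v"
  have "wfrec D ?H w = (\<exists>v. (v, w) \<in> D \<and> \<not> wfrec D ?H v)" for w
    by (subst wfrec[OF assms]) (auto simp: cut_def)
  then show ?thesis by blast
qed

lemma (in rel_tournament) module_family_ex:
  assumes S: "\<And>s v. s \<in> S \<Longrightarrow> v \<in> V \<Longrightarrow> v \<noteq> s \<Longrightarrow> R s v" and "S \<subseteq> V"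
  shows "\<exists>W K. module_family V R W K \<and> (\<forall>w\<in>W. K w \<inter> S = {}) \<and>
    (\<forall>L. ntmodule V R L \<longrightarrow> L \<inter> (W \<union> S) \<noteq> {})"
proof -
  \<comment> \<open>Pairs with source in \<open>S\<close> are left out: \<open>S\<close> hits them
    anyway, and the sets \<open>K w\<close> have to avoid \<open>S\<close>.\<close>
  define D where "D = {(x, y). (x, y) \<in> twins \<and> x \<notin> S}"
  have "wf D" by (rule wf_subset[OF wf_twins]) (auto simp: D_def)
  then obtain P where P: "\<And>w. P w \<longleftrightarrow> (\<exists>v. (v, w) \<in> D \<and> \<not> P v)" using kernel_ex by blast
  define g where "g A = (SOME x. x \<in> A)" for A :: "'a set"
  have g: "g A \<in> A" if "min_ntmodule A" for A
  proof -
    have "A \<noteq> {}" using min_ntmoduleD(3)[OF that] by auto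
    then show ?thesis unfolding g_def by (simp add: some_in_eq)
  qed
  define big where "big A \<longleftrightarrow> min_ntmodule A \<and> 3 \<le> card A" for A
  \<comment> \<open>Large minimal modules are disjoint from all others and take any representative.
    A pair is used only if \<open>P\<close> holds at its sink and fails at its source, so that no
    vertex is the sink of one chosen pair and the source of another.\<close>
  define Q where "Q w A \<longleftrightarrow> (big A \<and> w = g A) \<or> (P w \<and> (\<exists>x. (x, w) \<in> D \<and> \<not> P x \<and> A = {x, w}))" for w A
  define W where "W = {w. \<exists>A. Q w A}"
  have "\<forall>w\<in>W. \<exists>A. Q w A" unfolding W_def by blast
  then obtain K where K: "\<And>w. w \<in> W \<Longrightarrow> Q w (K w)" using bchoice[of W Q] by blast
  have D: "x \<in> V" "y \<in> V" "R x y" "x \<noteq> y" "ntmodule V R {x, y}" "x \<notin> S" if "(x, y) \<in> D" for x y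
    using that irrefl[of x] unfolding D_def twins_def by auto
  have min2: "min_ntmodule {x, y}" if "(x, y) \<in> D" for x y
  proof -
    have "card L \<le> 1" if "L \<subseteq> {x, y}" "L \<noteq> {x, y}" for L
    proof -
      have "L \<subset> {x, y}" using that by blast
      from psubset_card_mono[OF _ this] show ?thesis using D(4)[OF \<open>(x, y) \<in> D\<close>] by simp
    qed
    then show ?thesis using D(5)[OF that] unfolding min_ntmodule_def by blast
  qed
  have Qmin: "min_ntmodule A" if "Q w A" for w A using that min2 unfolding Q_def big_def by blast
  have "w \<in> A" if "Q w A" for w A using that g unfolding Q_def big_def by blast
  note Qin = this
  have no_source: "s \<notin> A" if "min_ntmodule A" "3 \<le> card A" "s \<in> S" for s A
  proof
    assume "s \<in> A"
    note A = min_ntmoduleD(2,5,6)[OF that(1)]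
    have "rmodule V R (A - {s})"
    proof (rule rmoduleI)
      fix x y v assume "x \<in> A - {s}" "y \<in> A - {s}" "v \<in> V" "v \<notin> A - {s}" "R v x"
      then show "R v y" using S[OF \<open>s \<in> S\<close>, of y] rmodule_in[OF A(1), of x y v] A(2) by blast
    qed (use A in blast)
    then have "card (A - {s}) \<le> 1" using min_ntmodule_card[OF that(1)] \<open>s \<in> A\<close> by blast
    then show False using that \<open>s \<in> A\<close> A by simp
  qed
  have "module_family V R W K"
  proof (unfold_locales, goal_cases)
    case (1 w) then show ?case using min_ntmoduleD(1)[OF Qmin[OF K]] by blast
  next
    case (2 w L) then show ?case using min_ntmodule_card[OF Qmin[OF K]] by blast
  next
    case (3 w) then show ?case using K Qin by blast
  next
    case (4 w w' x)
    have q: "Q w (K w)" "Q w' (K w')" using K 4 by blast+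
    show ?case
    proof (cases "big (K w) \<or> big (K w')")
      case True
      then have "card (K w) \<noteq> 2 \<or> card (K w') \<noteq> 2" unfolding big_def by linarith
      then have eq: "K w = K w'"
        using min_ntmodule_overlap[OF Qmin[OF q(1)] Qmin[OF q(2)]]
          min_ntmodule_overlap[OF Qmin[OF q(2)] Qmin[OF q(1)]] 4 by blast
      have nb: "\<not> big {x, y}" for x y :: 'a unfolding big_def
        using card_insert_le_m1[of 2 "{y}" x] by (simp add: card_insert_if)
      have "w = g (K w)" "w' = g (K w')" using q eq True nb unfolding Q_def by auto
      then show ?thesis using eq by simp
    next
      case False
      then obtain y y' where y: "P w" "(y, w) \<in> D" "\<not> P y" "K w = {y, w}" "P w'" "(y', w') \<in> D" "\<not> P y'" "K w' = {y', w'}"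
        using q unfolding Q_def by blast
      have "w = w'" if "y = y'"
        using twins_source_unique[of y w w'] D(1-3)[OF y(2)] D(2,3)[OF y(6)] ntmoduleD(1)[OF D(5)[OF y(2)]]
          ntmoduleD(1)[OF D(5)[OF y(6)]] that by simp
      moreover have "x = y \<or> x = w" "x = y' \<or> x = w'" using 4 y by simp_all
      moreover have "y \<noteq> w'" "y' \<noteq> w" using y(1,3,5,7) by auto
      ultimately show ?thesis by metis
    qed
  next
    case (5 w)
    have q: "Q w (K w)" using K 5 by blast
    then show ?case unfolding Q_def
    proof
      assume b: "big (K w) \<and> w = g (K w)"
      have mK: "min_ntmodule (K w)" by (rule Qmin[OF q])
      have A: "rmodule V R (K w)" "K w \<subseteq> V" "finite (K w)" "3 \<le> card (K w)" "w \<in> K w"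
        using min_ntmoduleD[OF mK] Qin[OF q] b unfolding big_def by auto
      show ?thesis
      proof (rule ccontr)
        assume n: "\<not> ?thesis"
        have "rmodule V R (K w - {w})"
        proof (rule rmoduleI)
          fix x y v assume *: "x \<in> K w - {w}" "y \<in> K w - {w}" "v \<in> V" "v \<notin> K w - {w}" "R v x"
          show "R v y"
          proof (cases "v = w")
            case True
            then show ?thesis using n * arc[of y w] A(2) by blast
          next
            case False
            then show ?thesis using * rmodule_in[OF A(1), of x y v] by blast
          qed
        qed (use A in blast)
        then have "card (K w - {w}) \<le> 1" using min_ntmodule_card[OF mK] A by blast
        then show False using A by simp
      qed
    qed (use D in blast)
  qed
  moreover have "K w \<inter> S = {}" if "w \<in> W" for w
  proof -
    have q: "Q w (K w)" using K that by blast
    have "w \<notin> S" if "(x, w) \<in> D" for x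
      using S[of w x] D(1-4)[OF that] arc[of x w] by blast
    moreover have "K w \<inter> S = {}" if "big (K w)" using no_source that unfolding big_def by blast
    moreover have "K w \<inter> S = {}" if "(x, w) \<in> D" "K w = {x, w}" for x
      using that D(6)[OF that(1)] \<open>(x, w) \<in> D \<Longrightarrow> w \<notin> S\<close> by simp
    ultimately show ?thesis using q unfolding Q_def by blast
  qed
  moreover have "L \<inter> (W \<union> S) \<noteq> {}" if L: "ntmodule V R L" for L
  proof -
    obtain A where A: "min_ntmodule A" "A \<subseteq> L" using min_ntmodule_ex[OF L] by blast
    note A' = min_ntmoduleD(1)[OF A(1)]
    show ?thesis
    proof (cases "3 \<le> card A")
      case True
      then have "Q (g A) A" using A unfolding Q_def big_def by blast
      then show ?thesis using g[OF A(1)] A(2) unfolding W_def by blast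
    next
      case False
      then have "card A = 2" using ntmoduleD(2)[OF A'] by linarith
      then obtain a b where ab: "A = {a, b}" "a \<noteq> b" unfolding card_2_iff by blast
      have V: "a \<in> V" "b \<in> V" using ntmoduleD(4)[OF A'] ab by blast+
      obtain x y where xy: "A = {x, y}" "x \<in> V" "y \<in> V" "R x y"
        using arc[OF V ab(2)] ab V by (cases "R a b") auto
      show ?thesis
      proof (cases "x \<in> S")
        case True then show ?thesis using xy A by blast
      next
        case False
        then have d: "(x, y) \<in> D" using xy A' unfolding D_def twins_def by simp
        have "x \<in> W" if "P x" using that P[of x] unfolding W_def Q_def by blast
        moreover have "y \<in> W" if "\<not> P x" using that P[of y] d unfolding W_def Q_def by blast
        ultimately show ?thesis using xy A by blast
      qed
    qed
  qed
  ultimately show ?thesis by blast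
qed

section \<open>Crossing edges between representatives\<close>

context module_family
begin

lemma K_module: "w \<in> W \<Longrightarrow> rmodule V R (K w)"
  and K_card: "w \<in> W \<Longrightarrow> 2 \<le> card (K w)"
  and K_neq: "w \<in> W \<Longrightarrow> K w \<noteq> V"
  and K_sub: "w \<in> W \<Longrightarrow> K w \<subseteq> V"
  and K_finite: "w \<in> W \<Longrightarrow> finite (K w)"
  using ntmoduleD[OF K_ntmodule] by auto

lemma W_sub: "W \<subseteq> V"
  using K_self K_sub by blast

lemma K_out:
  "w \<in> W \<Longrightarrow> x \<in> K w \<Longrightarrow> y \<in> K w \<Longrightarrow> v \<in> V \<Longrightarrow> v \<notin> K w \<Longrightarrow> R x v \<longleftrightarrow> R y v"
  by (rule rmodule_out[OF K_module])

lemma K_in: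
  "w \<in> W \<Longrightarrow> x \<in> K w \<Longrightarrow> y \<in> K w \<Longrightarrow> v \<in> V \<Longrightarrow> v \<notin> K w \<Longrightarrow> R v x \<longleftrightarrow> R v y"
  by (rule rmodule_in[OF K_module])

lemma K_small:
  assumes "w \<in> W" "rmodule V R L" "L \<subseteq> K w" "L \<noteq> K w" "x \<in> L" "y \<in> L"
  shows "x = y"
  using K_min[OF assms(1-4)] finite_subset[OF assms(3) K_finite[OF assms(1)]] assms(5,6)
  by (simp add: card_le_Suc0_iff_eq)

text \<open>If \<open>w\<close> is the sink of \<open>K w\<close>, then \<open>K w - {w}\<close> is
  a module as well, and minimality leaves it a single vertex.\<close>

lemma K_pair:
  assumes "w \<in> W" "\<And>c. c \<in> K w \<Longrightarrow> c \<noteq> w \<Longrightarrow> R c w"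
  obtains c where "K w = {c, w}" "c \<noteq> w" "R c w"
proof -
  obtain c where c: "c \<in> K w" "c \<noteq> w" "R c w" using K_pred[OF assms(1)] by blast
  have "rmodule V R (K w - {w})"
  proof (rule rmoduleI)
    fix x y v assume *: "x \<in> K w - {w}" "y \<in> K w - {w}" "v \<in> V" "v \<notin> K w - {w}" "R v x"
    show "R v y"
    proof (cases "v = w")
      case True
      then show ?thesis using assms(2)[of x] arc[of x w] * K_sub[OF assms(1)] by blast
    next
      case False
      then show ?thesis using * K_in[OF assms(1), of x y v] by blast
    qed
  qed (use K_sub[OF assms(1)] in blast)
  then have "K w - {w} = {c}" using K_small[OF assms(1)] c K_self[OF assms(1)] by blast
  then show ?thesis using that c K_self[OF assms(1)] by blast
qed

end

text \<open>\<open>X\<close> holds the joined vertices that represent no \<open>K w\<close>. Edges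
  meet \<open>K w\<close> at most in \<open>w\<close>, so the other vertices of \<open>K w\<close>
  keep all their arcs and still testify how \<open>w\<close> behaved before the reversal.\<close>

locale flipped_family = module_family V R W K for V :: "'a set" and R W K +
  fixes X :: "'a set" and ES :: "'a set set"
  assumes edge: "{x, y} \<in> ES \<Longrightarrow> x \<noteq> y \<and> x \<in> W \<union> X \<and> y \<in> W \<union> X"
    and X_sub: "X \<subseteq> V"
    and X_K: "x \<in> X \<Longrightarrow> w \<in> W \<Longrightarrow> x \<notin> K w"
begin

abbreviation E :: "'a \<Rightarrow> 'a \<Rightarrow> bool" where "E x y \<equiv> {x, y} \<in> ES"
abbreviation R' :: "'a \<Rightarrow> 'a \<Rightarrow> bool" where "R' \<equiv> flip ES R"

lemma E_sym: "E x y \<Longrightarrow> E y x"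
  by (simp add: insert_commute)

lemma flip_edge: "E x y \<Longrightarrow> R' x y \<longleftrightarrow> \<not> R x y"
  and flip_no_edge: "\<not> E x y \<Longrightarrow> R' x y \<longleftrightarrow> R x y"
  by (auto simp: flip_def)

sublocale F: rel_tournament V "flip ES R"
  by (rule flip_tournament) (use edge in force)

lemma edge_V: "E x y \<Longrightarrow> x \<in> V" "E x y \<Longrightarrow> y \<in> V"
  using edge W_sub X_sub by blast+

lemma K_touched: "w \<in> W \<Longrightarrow> c \<in> K w \<Longrightarrow> c \<in> W \<union> X \<Longrightarrow> c = w"
  using K_disj[OF _ _ _ K_self, of w c] X_K by blast

lemma K_no_edge:
  assumes "w \<in> W" "c \<in> K w" "c \<noteq> w" shows "\<not> E c y" "\<not> E y c"
  using edge K_touched assms by blast+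

lemma K_flip:
  assumes "w \<in> W" "c \<in> K w" "c \<noteq> w" shows "R' c y \<longleftrightarrow> R c y" "R' y c \<longleftrightarrow> R y c"
  using K_no_edge[OF assms] flip_no_edge by blast+

text \<open>Arcs inside \<open>K w\<close> are unchanged, so \<open>M \<inter> K w\<close> is a
  module of the original tournament. Being a proper part of \<open>K w\<close>, it has at most one
  element.\<close>

lemma K_Int_small:
  assumes "w \<in> W" "rmodule V R' M" "v \<in> K w" "v \<notin> M" "x \<in> M \<inter> K w" "y \<in> M \<inter> K w"
  shows "x = y"
proof -
  have "rmodule V R (M \<inter> K w)"
  proof (rule rmodule_trans[OF K_module[OF assms(1)]], rule rmoduleI)
    fix x y v assume *: "x \<in> M \<inter> K w" "y \<in> M \<inter> K w" "v \<in> K w" "v \<notin> M \<inter> K w" "R v x"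
    have eq: "R' v u = R v u" if "u \<in> K w" for u
      using K_flip[OF assms(1)] *(3) that flip_no_edge[of v u] edge[of v u] by (metis edge)
    show "R v y" using eq F.rmodule_in[OF assms(2), of x y v] * K_sub[OF assms(1)] by blast
  qed blast
  then show ?thesis using K_small[OF assms(1) _ _ _ assms(5,6)] assms(3,4) by blast
qed

context
  fixes M
  assumes M: "ntmodule V R' M"
begin

lemma M_module: "rmodule V R' M" and M_sub: "M \<subseteq> V"
  using F.ntmoduleD[OF M] by blast+

lemma M_other: obtains y where "y \<in> M" "y \<noteq> x"
  using card_ge2_obtain F.ntmoduleD(2)[OF M] by metis

lemma M_in: "x \<in> M \<Longrightarrow> y \<in> M \<Longrightarrow> v \<in> V \<Longrightarrow> v \<notin> M \<Longrightarrow> R' v x \<longleftrightarrow> R' v y"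
  by (rule F.rmodule_in[OF M_module])

lemma M_out: "x \<in> M \<Longrightarrow> y \<in> M \<Longrightarrow> v \<in> V \<Longrightarrow> v \<notin> M \<Longrightarrow> R' x v \<longleftrightarrow> R' y v"
  by (rule F.rmodule_out[OF M_module])

lemma cross_inner:
  assumes a: "a \<in> W" "a \<in> M" and b: "b \<notin> M" "E a b"
  obtains c where "K a = {c, a}" "c \<noteq> a" "R c a" "c \<notin> M"
    "\<And>x. x \<in> M \<Longrightarrow> R c x" "\<And>x. x \<in> M \<Longrightarrow> x \<noteq> a \<Longrightarrow> R a x"
proof -
  have bV: "b \<in> V" "b \<notin> K a" "b \<noteq> a" using edge_V[OF b(2)] edge[OF b(2)] K_touched[OF a(1)] by blast+
  have nM: "c \<notin> M" if c: "c \<in> K a" "c \<noteq> a" for c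
  proof
    assume "c \<in> M"
    have "\<not> K a \<subseteq> M"
    proof
      assume "K a \<subseteq> M"
      have "R' b c = R' b a" using M_in[of c a b] \<open>c \<in> M\<close> a b bV by blast
      moreover have "R' b c = R b c" using K_flip(2)[OF a(1) c] .
      moreover have "R' b a = (\<not> R b a)" using flip_edge E_sym[OF b(2)] by blast
      moreover have "R b c = R b a" using K_in[OF a(1) c(1) K_self[OF a(1)] bV(1,2)] .
      ultimately show False by blast
    qed
    then obtain v where "v \<in> K a" "v \<notin> M" by blast
    from K_Int_small[OF a(1) M_module this, of c a] show False
      using \<open>c \<in> M\<close> c a K_self by blast
  qed
  have eq: "R c x = R c a" "R a x = R c a" if c: "c \<in> K a" "c \<noteq> a" and x: "x \<in> M" "x \<noteq> a" for c x
  proof -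
    have cV: "c \<in> V" "x \<in> V" using K_sub[OF a(1)] c x M_sub by blast+
    have xK: "x \<notin> K a" using nM x by blast
    have "R' c x = R' c a" using M_in[of x a c] nM[OF c] x a cV by blast
    then show *: "R c x = R c a" using K_flip(1)[OF a(1) c] by blast
    have "R a x = R c x" using K_out[OF a(1) K_self[OF a(1)] c(1) cV(2) xK] .
    then show "R a x = R c a" using * by blast
  qed
  obtain x where x: "x \<in> M" "x \<noteq> a" using M_other by blast
  obtain d where d: "d \<in> K a" "d \<noteq> a" "R d a" using K_pred[OF a(1)] by blast
  \<comment> \<open>Towards a fixed \<open>x\<close> in \<open>M - {a}\<close> all vertices of
    \<open>K a\<close> agree with \<open>a\<close>, and each of them other than \<open>a\<close>
    treats \<open>a\<close> as it treats \<open>x\<close>. As one of them dominates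
    \<open>a\<close>, all do, and \<open>a\<close> is the sink of \<open>K a\<close>.\<close>
  have "R c a" if c: "c \<in> K a" "c \<noteq> a" for c
    using eq[OF c x] eq[OF d(1,2) x] d(3) by blast
  then obtain c where c: "K a = {c, a}" "c \<noteq> a" "R c a" using K_pair[OF a(1)] by blast
  show ?thesis
  proof (rule that[OF c])
    show "c \<notin> M" using nM c by blast
    show "R c x" if "x \<in> M" for x using eq(1)[of c x] c that by (cases "x = a") auto
    show "R a x" if "x \<in> M" "x \<noteq> a" for x using eq(2)[of c x] c that by auto
  qed
qed

lemma cross_dominates:
  assumes "a \<in> W" "a \<in> M" "b \<notin> M" "E a b" "x \<in> M" "x \<noteq> a"
  shows "R a x"
  using cross_inner[OF assms(1-4)] assms(5,6) by metis

text \<open>A vertex of \<open>K b - {b}\<close> outside \<open>M\<close> treats \<open>a\<close>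
  and \<open>x\<close> alike, hence so did \<open>b\<close> originally; reversing only the arc to
  \<open>a\<close> makes \<open>b\<close> separate them. So all of \<open>K b\<close> except
  \<open>b\<close> lies in \<open>M\<close>, which by minimality is one vertex.\<close>

lemma cross_outer:
  assumes b: "b \<in> W" "b \<notin> M" and a: "a \<in> M" "E a b"
    and x: "x \<in> M" "x \<noteq> a" "\<not> E b x" "x \<notin> K b"
  obtains c where "K b = {c, b}" "c \<noteq> b" "R c b" "c \<in> M"
proof -
  have aV: "a \<in> V" "a \<notin> K b" "a \<noteq> b" using edge_V[OF a(2)] edge[OF a(2)] K_touched[OF b(1)] by blast+
  have bV: "b \<in> V" "x \<in> V" using b W_sub x M_sub by blast+
  have inM: "c \<in> M" if c: "c \<in> K b" "c \<noteq> b" for c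
  proof (rule ccontr)
    assume "c \<notin> M"
    have cV: "c \<in> V" using K_sub[OF b(1)] c by blast
    have "R' c a = R' c x" using M_in a(1) x(1) cV \<open>c \<notin> M\<close> by blast
    then have "R c a = R c x" using K_flip(1)[OF b(1) c] by blast
    moreover have "R c a = R b a" using K_out[OF b(1) c(1) K_self[OF b(1)] aV(1,2)] .
    moreover have "R c x = R b x" using K_out[OF b(1) c(1) K_self[OF b(1)] bV(2) x(4)] .
    moreover have "R' b a = R' b x" using M_in a(1) x(1) bV(1) b(2) by blast
    ultimately show False using flip_edge[OF E_sym[OF a(2)]] flip_no_edge[OF x(3)] by blast
  qed
  obtain c where c: "c \<in> K b" "c \<noteq> b" "R c b" using K_pred[OF b(1)] by blast
  have "K b \<subseteq> {c, b}"
    using K_Int_small[OF b(1) M_module K_self[OF b(1)] b(2), of c] inM c by blast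
  then have "K b = {c, b}" using c K_self[OF b(1)] by blast
  then show ?thesis using that c inM by blast
qed

text \<open>\<open>a\<close> dominates \<open>c\<close> and hence originally also \<open>b\<close>.
  After the reversal \<open>b\<close> dominates \<open>a\<close> while \<open>c\<close> still
  dominates \<open>b\<close>, so \<open>b\<close> would separate two vertices of
  \<open>M\<close>.\<close>

lemma cross_outer_not:
  assumes a: "a \<in> W" "a \<in> M" and b: "b \<in> W" "b \<notin> M" "E a b" and "c \<in> K b" "c \<noteq> b" "R c b"
  shows "c \<notin> M"
proof
  assume "c \<in> M"
  have V: "a \<in> V" "a \<notin> K b" "c \<in> V" "b \<in> V"
    using K_touched[OF b(1)] edge[OF b(3)] a W_sub K_sub[OF b(1)] K_self[OF b(1)] assms(6) by blast+
  have "R a c" using cross_dominates[OF a b(2,3)] \<open>c \<in> M\<close> V assms(6) by blast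
  then have "R a b" using K_in[OF b(1) assms(6) K_self[OF b(1)] V(1,2)] by blast
  then have "\<not> R' a b" using flip_edge[OF b(3)] by blast
  moreover have "R' c b" using K_flip(1)[OF b(1) assms(6,7)] assms(8) by blast
  ultimately show False using M_out[OF \<open>c \<in> M\<close> a(2) V(4) b(2)] by blast
qed

lemma cross_inside_K:
  assumes a: "a \<in> W" "a \<in> M" and b: "b \<in> W" "b \<notin> M" "E a b"
    and X: "\<And>x y. x \<in> X \<Longrightarrow> E x y \<Longrightarrow> x \<in> M \<longleftrightarrow> y \<in> M"
  shows "M - {a} \<subseteq> K b"
proof
  fix x assume x: "x \<in> M - {a}"
  \<comment> \<open>Two neighbours of \<open>b\<close> in \<open>M\<close> would dominate each other
    by \<open>cross_dominates\<close>.\<close>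
  have "\<not> E b x"
  proof
    assume e: "E b x"
    then have "x \<in> W" using edge[OF e] X[of x b] E_sym[OF e] x b by blast
    then have "R x a" using cross_dominates[of x b a] E_sym[OF e] x b a by blast
    moreover have "R a x" using cross_dominates[OF a b(2,3)] x by blast
    ultimately show False using arc[of a x] x a M_sub by blast
  qed
  show "x \<in> K b"
  proof (rule ccontr)
    assume "x \<notin> K b"
    with x \<open>\<not> E b x\<close> obtain c where "K b = {c, b}" "c \<noteq> b" "R c b" "c \<in> M"
      using cross_outer[OF b(1,2) a(2) b(3), of x] by blast
    then show False using cross_outer_not[OF a b, of c] by blast
  qed
qed

text \<open>The crossings that survive, with \<open>M\<close> inside \<open>insert a (K b)\<close>.
  A second neighbour of \<open>a\<close> would confine \<open>M - {a}\<close> to another of the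
  disjoint sets \<open>K y\<close>, and a vertex of \<open>M\<close> in \<open>K b\<close> cannot
  dominate \<open>b\<close>. Each of the three conclusions can be contradicted by a suitable choice
  of edges.\<close>

lemma normal_crossing:
  assumes a: "a \<in> W" "a \<in> M" and b: "b \<in> W" "b \<notin> M" "E a b"
    and X: "\<And>x y. x \<in> X \<Longrightarrow> E x y \<Longrightarrow> x \<in> M \<longleftrightarrow> y \<in> M"
  shows "rmodule V R (insert a (K b))" "\<And>y. E a y \<Longrightarrow> y = b" "\<exists>c\<in>K b. c \<noteq> b \<and> \<not> R c b"
proof -
  note sub = cross_inside_K[OF a b X]
  obtain x where x: "x \<in> M" "x \<noteq> a" using M_other by blast
  have xK: "x \<in> K b" "x \<noteq> b" using sub x b by blast+
  show nb: "y = b" if e: "E a y" for y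
  proof -
    have "y \<noteq> x" using K_touched[OF b(1) xK(1)] edge[OF e] xK(2) by blast
    have "y \<noteq> a" using edge[OF e] by blast
    have yM: "y \<notin> M"
    proof
      assume "y \<in> M"
      then have "y \<in> K b" using sub \<open>y \<noteq> a\<close> by blast
      then show False using K_touched[OF b(1)] edge[OF e] \<open>y \<in> M\<close> b(2) by blast
    qed
    then have "y \<in> W" using edge[OF e] X[of y a] E_sym[OF e] a by blast
    then have "M - {a} \<subseteq> K y" using cross_inside_K[OF a _ yM e X] by blast
    then show ?thesis using K_disj[OF \<open>y \<in> W\<close> b(1), of x] x xK by blast
  qed
  show "rmodule V R (insert a (K b))"
  proof (rule rmoduleI)
    show "insert a (K b) \<subseteq> V" using a M_sub K_sub[OF b(1)] by blast
    fix y z v assume *: "y \<in> insert a (K b)" "z \<in> insert a (K b)" "v \<in> V" "v \<notin> insert a (K b)" "R v y"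
    have "v \<notin> M" using sub * by blast
    have "R v a = R v x"
      using M_in[OF a(2) x(1) *(3) \<open>v \<notin> M\<close>] flip_no_edge[of v a] nb[of v] E_sym[of v a]
        K_flip(2)[OF b(1) xK] * K_self[OF b(1)] by blast
    then have "R v u = R v x" if "u \<in> insert a (K b)" for u
      using that K_in[OF b(1) _ xK(1) *(3)] * by blast
    then show "R v z" using * by blast
  qed
  show "\<exists>c\<in>K b. c \<noteq> b \<and> \<not> R c b"
    using cross_outer_not[OF a b xK] x(1) xK by blast
qed

lemma crossing_ex:
  assumes irr: "\<And>L. ntmodule V R L \<Longrightarrow> \<exists>x y. E x y \<and> x \<in> L \<and> y \<notin> L"
  shows "\<exists>x y. E x y \<and> x \<in> M \<and> y \<notin> M"
proof (rule ccontr)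
  assume n: "\<not> ?thesis"
  have "rmodule V R M"
  proof (rule rmoduleI[OF M_sub])
    fix x y v assume *: "x \<in> M" "y \<in> M" "v \<in> V" "v \<notin> M" "R v x"
    have "\<not> E v x" "\<not> E v y" using n E_sym * by blast+
    then show "R v y" using M_in[OF *(1-4)] flip_no_edge[of v] * by blast
  qed
  then have "ntmodule V R M" using M unfolding ntmodule_def by blast
  then show False using irr n by blast
qed

text \<open>The configuration in \<open>leaf\<close> cannot be excluded for arbitrary edges, so its
  absence becomes a condition on them; the vertices of \<open>X\<close> are dealt with by separate
  lemmas.\<close>

theorem no_module_if_extras_uncrossed:
  assumes irr: "\<And>L. ntmodule V R L \<Longrightarrow> \<exists>x y. E x y \<and> x \<in> L \<and> y \<notin> L"
    and leaf: "\<And>a b. \<lbrakk>a \<in> W; b \<in> W; E a b; \<And>y. E a y \<Longrightarrow> y = b; \<exists>c\<in>K b. c \<noteq> b \<and> \<not> R c b;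
      rmodule V R (insert a (K b))\<rbrakk> \<Longrightarrow> False"
    and X: "\<And>x y. x \<in> X \<Longrightarrow> E x y \<Longrightarrow> x \<in> M \<longleftrightarrow> y \<in> M"
  shows False
proof -
  obtain a b where e: "E a b" "a \<in> M" "b \<notin> M" using crossing_ex[OF irr] by blast
  have "a \<in> W" "b \<in> W" using edge[OF e(1)] X[of a b] X[of b a] E_sym[OF e(1)] e by blast+
  then show False using leaf[of a b] normal_crossing[OF _ e(2) _ e(3,1) X] e by blast
qed

end

end

section \<open>Crossing edges at sources and sinks\<close>

context flipped_family
begin

text \<open>After the reversal \<open>b\<close> is the only in-neighbour of \<open>s\<close>. If
  \<open>M\<close> contains \<open>s\<close> but not \<open>b\<close>, then \<open>b\<close>
  dominates \<open>M\<close> and \<open>M\<close> dominates all other vertices outside it. This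
  forces \<open>M - {s}\<close> into \<open>K b\<close>, so \<open>insert s (K b)\<close> dominates
  the rest and is a module. If \<open>M\<close> contains \<open>b\<close> but not \<open>s\<close>,
  then \<open>s\<close> separates \<open>b\<close> from the rest of \<open>M\<close>.\<close>

lemma source_uncrossed:
  assumes M: "ntmodule V R' M"
    and s: "s \<in> X" "\<And>v. v \<in> V \<Longrightarrow> v \<noteq> s \<Longrightarrow> R s v"
    and sinks: "\<And>t v. t \<in> X \<Longrightarrow> t \<noteq> s \<Longrightarrow> v \<in> V \<Longrightarrow> v \<noteq> t \<Longrightarrow> R v t"
    and b: "b \<in> W" "E s b" "\<And>y. E s y \<Longrightarrow> y = b"
    and J: "\<not> rmodule V R (insert s (K b))"
  shows "s \<in> M \<longleftrightarrow> b \<in> M"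
proof (rule ccontr)
  assume n: "\<not> ?thesis"
  have V: "s \<in> V" "b \<in> V" "s \<noteq> b" using edge_V[OF b(2)] edge[OF b(2)] by blast+
  have Rsb: "\<not> R' s b" using flip_edge[OF b(2)] s(2) V by blast
  have Rs: "R' s v" if "v \<in> V" "v \<noteq> s" "v \<noteq> b" for v
    using that s(2)[of v] flip_no_edge[of s v] b(3)[of v] by blast
  note sub = M_sub[OF M]
  show False
  proof (cases "s \<in> M")
    case False
    then have "b \<in> M" using n by blast
    obtain x where "x \<in> M" "x \<noteq> b" using M_other[OF M] by blast
    then show False using M_in[OF M \<open>b \<in> M\<close> \<open>x \<in> M\<close> V(1) False] Rs[of x] Rsb False sub by blast
  next
    case True
    then have bM: "b \<notin> M" using n by blast
    have Rb: "R' b x" if "x \<in> M" for x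
      using M_in[OF M True that V(2) bM] Rsb F.arc[OF V] by blast
    have out: "R' x v" if "x \<in> M" "v \<in> V" "v \<notin> M" "v \<noteq> b" for x v
      using M_out[OF M True that(1-3)] Rs[of v] that True by blast
    obtain c where c: "c \<in> K b" "c \<noteq> b" "R c b" using K_pred[OF b(1)] by blast
    have cV: "c \<in> V" using K_sub[OF b(1)] c by blast
    have cM: "c \<notin> M"
      using Rb[of c] K_flip(2)[OF b(1) c(1,2)] c(3) F.arc[OF cV V(2) c(2)] K_flip(1)[OF b(1) c(1,2), of b]
      by blast
    have sub2: "M - {s} \<subseteq> K b"
    proof
      fix x assume x: "x \<in> M - {s}"
      then have xV: "x \<in> V" "x \<noteq> b" "x \<noteq> c" using sub bM cM by blast+
      have xc: "R x c" using out[of x c] x cV cM c K_flip(2)[OF b(1) c(1,2)] by blast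
      have "\<not> E b x"
      proof
        assume e: "E b x"
        show False
        proof (cases "x \<in> X")
          case True
          then show ?thesis using sinks[of x c] x cV xV xc arc[of x c] by blast
        next
          case False
          then have "x \<in> W" using edge[OF e] by blast
          then have "R x s" using cross_dominates[OF M _ _ bM E_sym[OF e] True] x by blast
          then show ?thesis using s(2)[of x] arc[of x s] xV V x by blast
        qed
      qed
      show "x \<in> K b"
      proof (rule ccontr)
        assume xK: "x \<notin> K b"
        have "R b x" using Rb[of x] x flip_no_edge[OF \<open>\<not> E b x\<close>] by blast
        then have "R c x" using K_out[OF b(1) c(1) K_self[OF b(1)] xV(1) xK] by blast
        then show False using xc arc[of x c] xV cV by blast
      qed
    qed
    obtain x where x: "x \<in> M" "x \<noteq> s" using M_other[OF M] by blast
    have xK: "x \<in> K b" "x \<noteq> b" using sub2 x bM by blast+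
    have "R u v" if u: "u \<in> insert s (K b)" and v: "v \<in> V" "v \<notin> insert s (K b)" for u v
    proof (cases "u = s")
      case True then show ?thesis using s(2) v by blast
    next
      case False
      have "v \<notin> M" "v \<noteq> b" using sub2 v K_self[OF b(1)] by blast+
      then have "R x v" using out[OF x(1) v(1)] K_flip(1)[OF b(1) xK] by blast
      then show ?thesis using K_out[OF b(1) xK(1) _ v(1)] u False v(2) by blast
    qed
    moreover have "insert s (K b) \<subseteq> V" using V K_sub[OF b(1)] by blast
    ultimately have "rmodule V R (insert s (K b))"
      using arc by (intro rmoduleI) (metis subsetD)+
    then show False using J by blast
  qed
qed

text \<open>Dual to \<open>source_uncrossed\<close> except that representatives of pairs are sinks.
  This leaves two further shapes: \<open>K b = {b', b}\<close> with \<open>b'\<close> in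
  \<open>M\<close>, and \<open>M = {x, t}\<close> with \<open>x\<close> a neighbour of
  \<open>b\<close>. They make \<open>{b, t}\<close> or \<open>{x, t}\<close> a module, which
  explains the additional hypotheses.\<close>

lemma sink_uncrossed:
  assumes M: "ntmodule V R' M"
    and t: "t \<in> X" "\<And>v. v \<in> V \<Longrightarrow> v \<noteq> t \<Longrightarrow> R v t"
    and sources: "\<And>s v. s \<in> X \<Longrightarrow> s \<noteq> t \<Longrightarrow> v \<in> V \<Longrightarrow> v \<noteq> s \<Longrightarrow> R s v"
    and b: "b \<in> W" "E t b" "\<And>y. E t y \<Longrightarrow> y = b"
    and J: "\<not> rmodule V R (insert t (K b))" "\<not> rmodule V R {b, t}"
      "\<And>x. x \<in> W \<Longrightarrow> E x b \<Longrightarrow> \<not> rmodule V R {x, t}"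
  shows "t \<in> M \<longleftrightarrow> b \<in> M"
proof (rule ccontr)
  assume n: "\<not> ?thesis"
  have V: "t \<in> V" "b \<in> V" "t \<noteq> b" using edge_V[OF b(2)] edge[OF b(2)] by blast+
  have Rtb: "R' t b" using flip_edge[OF b(2)] t(2)[of b] arc[of b t] V by blast
  have Rt: "R' v t" if "v \<in> V" "v \<noteq> t" "v \<noteq> b" for v
    using that t(2)[of v] flip_no_edge[of v t] b(3)[of v] E_sym[of v t] by blast
  note sub = M_sub[OF M]
  have bK: "b \<in> K b" using K_self[OF b(1)] .
  have moduleI: "rmodule V R A" if "A \<subseteq> V" "\<And>u v. u \<in> A \<Longrightarrow> v \<in> V \<Longrightarrow> v \<notin> A \<Longrightarrow> R v u" for A
    using that by (intro rmoduleI) blast+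
  show False
  proof (cases "t \<in> M")
    case False
    then have "b \<in> M" using n by blast
    obtain x where x: "x \<in> M" "x \<noteq> b" using M_other[OF M] by blast
    have xV: "x \<in> V" "x \<noteq> t" using x sub False by blast+
    have "R' x t" using Rt[of x] x xV by blast
    then have "R' b t" using M_out[OF M \<open>b \<in> M\<close> \<open>x \<in> M\<close> V(1) False] by blast
    then show False using Rtb F.arc[OF V] by blast
  next
    case True
    then have bM: "b \<notin> M" using n by blast
    have Rb: "R' x b" if "x \<in> M" for x
      using M_out[OF M True that V(2) bM] Rtb by blast
    have out: "R' v x" if "x \<in> M" "v \<in> V" "v \<notin> M" "v \<noteq> b" for x v
      using M_in[OF M True that(1-3)] Rt[of v] that True by blast
    \<comment> \<open>The original direction of a reversed arc at \<open>v\<close> is read off from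
      another vertex of \<open>K v\<close>, which has kept its arcs.\<close>
    have K_edge: "R v x" if e: "E v x" and v: "v \<in> W" and x: "x \<notin> K v" "x \<in> V"
      and *: "\<And>c. c \<in> K v \<Longrightarrow> c \<noteq> v \<Longrightarrow> R c x" for v x
    proof -
      obtain c where c: "c \<in> K v" "c \<noteq> v" using K_pred[OF v] by blast
      then show ?thesis using *[OF c] K_out[OF v K_self[OF v] c(1) x(2,1)] by blast
    qed
    have edge_K: "x \<notin> K v" if "E v x" "v \<in> W" for v x
      using K_touched[of v x] edge[OF that(1)] that by blast
    show False
    proof (cases "\<forall>c\<in>K b. c \<noteq> b \<longrightarrow> c \<in> M")
      case True
      have "R c b" if "c \<in> K b" "c \<noteq> b" for c
        using Rb[of c] True that K_flip(1)[OF b(1) that] by blast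
      then obtain b' where b': "K b = {b', b}" "b' \<noteq> b" "R b' b" using K_pair[OF b(1)] by blast
      have b'M: "b' \<in> M" using True b' by blast
      have b'K: "b' \<in> K b" using b' by blast
      have Rvb1: "R v b" if v: "v \<in> V" "v \<notin> M" "v \<noteq> b" for v
      proof -
        have "R v b'" using out[OF b'M v] K_flip(2)[OF b(1) b'K b'(2)] by blast
        moreover have "v \<notin> K b" using True v by blast
        ultimately show ?thesis using K_in[OF b(1) b'K bK v(1)] by blast
      qed
      have "R v b" if v: "v \<in> V" "v \<notin> {b, t}" for v
      proof (cases "E v b")
        case False
        then show ?thesis using Rb[of v] Rvb1[of v] v flip_no_edge[of v b] by blast
      next
        case e: True
        show ?thesis
        proof (cases "v \<in> W")
          case False
          then show ?thesis using sources[of v b] edge[OF e] v V by blast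
        next
          case vW: True
          show ?thesis
          proof (rule K_edge[OF e vW edge_K[OF e vW] V(2)])
            fix c assume c: "c \<in> K v" "c \<noteq> v"
            have "c \<noteq> b" using edge_K[OF e vW] c by blast
            moreover have "c \<in> V" using c K_sub[OF vW] by blast
            ultimately show "R c b" using Rvb1[of c] Rb[of c] K_flip(1)[OF vW c] by blast
          qed
        qed
      qed
      then have "rmodule V R {b, t}" using V t(2) by (intro moduleI) blast+
      then show False using J(2) by blast
    next
      case False
      then obtain c where c: "c \<in> K b" "c \<noteq> b" "c \<notin> M" by blast
      have cV: "c \<in> V" using K_sub[OF b(1)] c by blast
      have Rc: "R c x" if "x \<in> M" for x
        using out[OF that cV c(3,2)] K_flip(1)[OF b(1) c(1,2)] by blast
      \<comment> \<open>Otherwise \<open>b\<close> would dominate \<open>x\<close> because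
        \<open>c\<close> does, although \<open>x\<close> dominates \<open>b\<close>.\<close>
      have inner: "x \<in> K b \<or> E x b" if x: "x \<in> M" for x
      proof (rule ccontr)
        assume *: "\<not> ?thesis"
        have "x \<in> V" "x \<noteq> b" using x sub bM by blast+
        moreover have "R x b" using Rb[OF x] flip_no_edge * by blast
        moreover have "R b x" using Rc[OF x] K_out[OF b(1) c(1) bK, of x] * \<open>x \<in> V\<close> by blast
        ultimately show False using arc[of x b] V by blast
      qed
      have nbr: "x \<in> W" if "x \<in> M" "x \<noteq> t" "E x b" for x
      proof (rule ccontr)
        assume "x \<notin> W"
        then have "x \<in> X" using edge[OF that(3)] by blast
        moreover have "c \<noteq> x" using c that by blast
        ultimately have "R x c" using sources[of x c] that cV by blast
        then show False using Rc[OF that(1)] arc[of x c] \<open>c \<noteq> x\<close> cV sub that(1) by blast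
      qed
      show False
      proof (cases "\<exists>x\<in>M. x \<noteq> t \<and> E x b")
        case True
        then obtain x where x: "x \<in> M" "x \<noteq> t" "E x b" by blast
        have xW: "x \<in> W" using nbr[OF x] .
        have xV: "x \<in> V" "x \<noteq> b" using x sub bM by blast+
        have dom: "R x y" if "y \<in> M" "y \<noteq> x" for y
          using cross_dominates[OF M xW x(1) bM x(3)] that by blast
        have "\<not> R x b" using Rb[OF x(1)] flip_edge[OF x(3)] by blast
        then have Rbx: "R b x" using arc[OF V(2) xV(1)] xV(2) by blast
        have xK: "x \<notin> K b" using K_touched[OF b(1), of x] xW xV by blast
        have only: "y = t" if y: "y \<in> M" "y \<noteq> x" for y
        proof (rule ccontr)
          assume "y \<noteq> t"
          have yV: "y \<in> V" using y sub by blast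
          show False
          proof (cases "y \<in> K b")
            case True
            have "R y x" using Rbx K_out[OF b(1) bK True xV(1) xK] by blast
            then show False using dom[OF y] arc[OF yV xV(1) y(2)] by blast
          next
            case False
            then have e: "E y b" using inner y by blast
            have "R y x" using cross_dominates[OF M nbr[OF y(1) \<open>y \<noteq> t\<close> e] y(1) bM e x(1)] y by blast
            then show False using dom[OF y] arc[OF yV xV(1) y(2)] by blast
          qed
        qed
        have "R v x" if v: "v \<in> V" "v \<notin> {x, t}" for v
        proof (cases "v = b")
          case True then show ?thesis using Rbx by simp
        next
          case False
          have vM: "v \<notin> M" using only v by blast
          have Rv: "R' v x" using out[OF x(1) v(1) vM False] .
          show ?thesis
          proof (cases "E v x")
            case False then show ?thesis using Rv flip_no_edge by blast
          next
            case e: True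
            show ?thesis
            proof (cases "v \<in> W")
              case False
              then show ?thesis using sources[of v x] edge[OF e] v xV by blast
            next
              case vW: True
              show ?thesis
              proof (rule K_edge[OF e vW edge_K[OF e vW] xV(1)])
                fix d assume d: "d \<in> K v" "d \<noteq> v"
                have dV: "d \<in> V" using d K_sub[OF vW] by blast
                have "d \<noteq> x" using edge_K[OF e vW] d by blast
                moreover have "d \<noteq> t" using X_K[OF t(1) vW] d by blast
                moreover have "d \<noteq> b" using K_disj[OF vW b(1) d(1)] bK d b(1) K_touched[OF vW d(1)] by blast
                ultimately have "R' d x" using out[OF x(1) dV] only by blast
                then show "R d x" using K_flip(1)[OF vW d] by blast
              qed
            qed
          qed
        qed
        then have "rmodule V R {x, t}" using V xV t(2) by (intro moduleI) blast+
        then show False using J(3)[OF xW x(3)] by blast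
      next
        case False
        then have sub2: "M - {t} \<subseteq> K b" using inner by blast
        obtain x where x: "x \<in> M" "x \<noteq> t" using M_other[OF M] by blast
        have xK: "x \<in> K b" "x \<noteq> b" using sub2 x bM by blast+
        have "R v u" if u: "u \<in> insert t (K b)" and v: "v \<in> V" "v \<notin> insert t (K b)" for u v
        proof (cases "u = t")
          case True then show ?thesis using t(2) v by blast
        next
          case False
          have "v \<notin> M" "v \<noteq> b" using sub2 v bK by blast+
          then have "R v x" using out[OF x(1) v(1)] K_flip(2)[OF b(1) xK] by blast
          then show ?thesis using K_in[OF b(1) xK(1) _ v(1)] u False v(2) by blast
        qed
        then have "rmodule V R (insert t (K b))" using V K_sub[OF b(1)] by (intro moduleI) blast+
        then show False using J(1) by blast
      qed
    qed
  qed
qed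

text \<open>For three joined vertices \<open>s\<close> is the middle of a path, so
  \<open>source_uncrossed\<close> does not apply. After the reversal exactly \<open>b\<close> and
  \<open>d\<close> dominate \<open>s\<close>. Hence a module that avoids \<open>s\<close> and
  contains one of them equals \<open>{b, d}\<close>, and a module that contains \<open>s\<close> but
  misses a representative \<open>p\<close> among them lies in \<open>insert s (K p)\<close>.\<close>

lemma source_centre_uncrossed:
  assumes M: "ntmodule V R' M"
    and s: "s \<in> X" "\<And>v. v \<in> V \<Longrightarrow> v \<noteq> s \<Longrightarrow> R s v"
    and ES: "ES = {{s, b}, {s, d}}" and b: "b \<in> W" "b \<noteq> d"
    and d: "d \<in> W \<or> d \<in> X \<and> d \<noteq> s \<and> (\<forall>v\<in>V. v \<noteq> d \<longrightarrow> R v d) \<and> \<not> rmodule V R {b, d}"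
  shows "(s \<in> M \<longleftrightarrow> b \<in> M) \<and> (s \<in> M \<longleftrightarrow> d \<in> M)"
proof -
  have sub: "M \<subseteq> V" by (rule M_sub[OF M])
  have E: "E x y \<longleftrightarrow> (x = s \<and> (y = b \<or> y = d)) \<or> (y = s \<and> (x = b \<or> x = d))" for x y
    unfolding ES by (auto simp: doubleton_eq_iff)
  have sW: "s \<notin> W" using X_K[OF s(1)] K_self by blast
  have sb: "E s b" and sd: "E s d" using E by blast+
  have V: "s \<in> V" "b \<in> V" "d \<in> V" "s \<noteq> b" "s \<noteq> d" using edge_V[OF sb] edge_V[OF sd] edge[OF sb] edge[OF sd] by blast+
  have Rs: "R' s v \<longleftrightarrow> v \<noteq> b \<and> v \<noteq> d" if "v \<in> V" "v \<noteq> s" for v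
    using that s(2)[of v] flip_no_edge[of s v] flip_edge[of s v] E[of s v] V by blast
  have into: "M - {s} \<subseteq> K p" if p: "p \<in> {b, d}" "p \<in> W" "s \<in> M" "p \<notin> M" for p
  proof
    fix x assume x: "x \<in> M - {s}"
    have pV: "p \<in> V" "p \<noteq> s" using p V by blast+
    obtain c where c: "c \<in> K p" "c \<noteq> p" "R c p" using K_pred[OF p(2)] by blast
    have cV: "c \<in> V" using K_sub[OF p(2)] c by blast
    have Rp: "R' p y" if "y \<in> M" for y
      using M_in[OF M p(3) that pV(1) p(4)] Rs[OF pV] F.arc[OF V(1) pV(1)] pV(2) p(1) by blast
    have cM: "c \<notin> M"
      using Rp[of c] K_flip[OF p(2) c(1,2), of p] c(3) arc[OF cV pV(1) c(2)] by blast
    have "c \<notin> W \<union> X" using K_touched[OF p(2) c(1)] c(2) by blast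
    then have "c \<noteq> s" "c \<noteq> b" "c \<noteq> d" using s b d by blast+
    then have "R' s c" using Rs[OF cV] by blast
    then have "R' x c" using M_out[OF M p(3) _ cV cM] x by blast
    then have xc: "R x c" using K_flip(2)[OF p(2) c(1,2)] by blast
    have xV: "x \<in> V" "x \<noteq> c" using x sub cM by blast+
    have "\<not> E p x" using E x pV p by blast
    then have "R p x" using Rp[of x] x flip_no_edge by blast
    then show "x \<in> K p"
      using K_out[OF p(2) c(1) K_self[OF p(2)] xV(1)] xc arc[OF xV(1) cV xV(2)] by blast
  qed
  have bd_K: "b \<notin> K d" "d \<notin> K b" if "d \<in> W"
    using K_touched[OF that, of b] K_touched[OF b(1), of d] b that by blast+
  show ?thesis
  proof (cases "s \<in> M")
    case True
    have "b \<in> M"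
    proof (rule ccontr)
      assume bM: "b \<notin> M"
      note bsub = into[of b, OF _ b(1) True bM, simplified]
      obtain x where x: "x \<in> M" "x \<noteq> s" using M_other[OF M] by blast
      have xK: "x \<in> K b" "x \<noteq> b" using bsub x bM by blast+
      have xW: "x \<notin> W \<union> X" using K_touched[OF b(1) xK(1)] xK(2) by blast
      then have "x \<noteq> d" using d by blast
      have dM: "d \<notin> M" using bsub V(5) K_touched[OF b(1), of d] d b by blast
      show False
      proof (cases "d \<in> W")
        case dW: True
        then have "x \<in> K d" using into[of d, OF _ dW True dM] x by blast
        then show False using K_disj[OF dW b(1) _ xK(1)] b by blast
      next
        case False
        then have "R x d" using d xK x sub \<open>x \<noteq> d\<close> by blast
        then have "R' x d" using flip_no_edge[of x d] E[of x d] x V by blast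
        then have "R' s d" using M_out[OF M x(1) True V(3) dM] by blast
        then show False using Rs[OF V(3)] V by blast
      qed
    qed
    moreover have "d \<in> M"
    proof (rule ccontr)
      assume dM: "d \<notin> M"
      show False
      proof (cases "d \<in> W")
        case dW: True
        then show False using into[of d, OF _ dW True dM] \<open>b \<in> M\<close> V bd_K(1)[OF dW] by blast
      next
        case False
        then have "R b d" using d V b by blast
        then have "R' b d" using flip_no_edge[of b d] E[of b d] V by blast
        then have "R' s d" using M_out[OF M \<open>b \<in> M\<close> True V(3) dM] by blast
        then show False using Rs[OF V(3)] V by blast
      qed
    qed
    ultimately show ?thesis using True by blast
  next
    case False
    have "p \<notin> M" if p: "p \<in> {b, d}" for p
    proof
      assume pM: "p \<in> M"
      have pV: "p \<in> V" "p \<noteq> s" using p V by blast+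
      have "M \<subseteq> {b, d}"
      proof
        fix x assume x: "x \<in> M"
        then have "x \<in> V" "x \<noteq> s" using sub False by blast+
        then show "x \<in> {b, d}" using M_in[OF M pM x V(1) False] Rs[OF pV] Rs[of x] p by blast
      qed
      moreover obtain q where "q \<in> M" "q \<noteq> p" using M_other[OF M] by blast
      ultimately have Meq: "M = {b, d}" using p pM by blast
      then have bM: "b \<in> M" and dM: "d \<in> M" by blast+
      show False
      proof (cases "d \<in> W")
        case dW: True
        have "R b d" using cross_dominates[OF M b(1) bM False E_sym[OF sb] dM] b by blast
        moreover have "R d b" using cross_dominates[OF M dW dM False E_sym[OF sd] bM] b by blast
        ultimately show False using arc[OF V(2,3) b(2)] by blast
      next
        case nW: False
        have "rmodule V R {b, d}"
        proof (rule rmoduleI)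
          fix x y v assume *: "x \<in> {b, d}" "y \<in> {b, d}" "v \<in> V" "v \<notin> {b, d}" "R v x"
          show "R v y"
          proof (cases "v = s")
            case True then show ?thesis using s(2)[of y] * V by blast
          next
            case vs: False
            then have "\<not> E v x" "\<not> E v y" using E * V by blast+
            then show ?thesis using M_in[OF M, of x y v] Meq * flip_no_edge by blast
          qed
        qed (use V in blast)
        then show False using d nW by blast
      qed
    qed
    then show ?thesis using False by blast
  qed
qed

end

section \<open>Crossing edges at a vertex outside the representatives\<close>

context flipped_family
begin

text \<open>Crossing the arc between \<open>z\<close> and \<open>b\<close> forces \<open>b\<close> to be a sink of \<open>T[M\<^sub>1]\<close> and leaves two
  shapes for \<open>M\<close>, namely \<open>V - {b}\<close> and \<open>{u, b}\<close>; they give the two alternatives.\<close>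

lemma outside_crossed:
  assumes M: "ntmodule V R' M"
    and X: "X = {z}" and b: "b \<in> W" "E z b" "\<And>y. E z y \<Longrightarrow> y = b"
    and M1: "rmodule V R M1" "\<And>w. w \<in> W \<Longrightarrow> K w \<subseteq> M1" "z \<notin> M1" "2 \<le> card (V - M1)"
    and prime: "\<And>y L u u'. \<lbrakk>y \<in> M1; rmodule (insert y (V - M1)) R L; L \<noteq> insert y (V - M1); u \<in> L; u' \<in> L\<rbrakk> \<Longrightarrow> u = u'"
    and cross: "(z \<in> M) \<noteq> (b \<in> M)"
  shows "(\<forall>y. E b y \<longrightarrow> y = z) \<and> (\<forall>y\<in>M1 - {b}. R y b) \<and>
    ((R b z \<and> (\<forall>u\<in>V - M1 - {z}. R u b)) \<or>
     (\<exists>u\<in>V - M1 - {z}. R b u \<and> (R z u \<longleftrightarrow> \<not> R z b) \<and> (\<forall>v\<in>V - M1 - {u, z}. R v u \<longleftrightarrow> R v b)))"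
proof -
  define U where "U = V - M1"
  have sub: "M \<subseteq> V" by (rule M_sub[OF M])
  have WM1: "w \<in> M1" if "w \<in> W" for w using M1(2)[OF that] K_self[OF that] by blast
  have V: "z \<in> V" "b \<in> V" "b \<in> M1" using X_sub X b W_sub WM1 by blast+
  have zU: "z \<in> U" using V M1 unfolding U_def by blast
  have bK: "b \<in> K b" using K_self[OF b(1)] .
  have edgeW: "d \<in> W" if "E b d" "d \<noteq> z" for d using edge[OF that(1)] X that(2) by blast
  have U_free: "\<not> E u y" "\<not> E y u" if "u \<in> U" "u \<noteq> z" for u y
    using that edge[of u y] edge[of y u] X WM1 unfolding U_def by blast+
  have zE: "\<not> E z y" "\<not> E y z" if "y \<noteq> b" for y using b(3)[of y] E_sym[of y z] that by blast+
  \<comment> \<open>No edge has both ends in \<open>insert y U\<close>: within \<open>U\<close> only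
    \<open>z\<close> is joined, and only to \<open>b\<close>.\<close>
  have eq: "R' x v \<longleftrightarrow> R x v" if "y \<in> M1" "y \<noteq> b" "x \<in> insert y U" "v \<in> insert y U" for x v y
  proof -
    have "\<not> E x v"
      using that U_free zE edge[of x v] by (metis insert_iff)
    then show ?thesis by (rule flip_no_edge)
  qed
  \<comment> \<open>\<open>insert y U\<close> is a copy of the quotient by \<open>M1\<close>, so
    \<open>M\<close> meets it in at most one vertex or contains it.\<close>
  have trivial: "u = u'" if y: "y \<in> M1" "y \<noteq> b" and u: "u \<in> M \<inter> insert y U" "u' \<in> M \<inter> insert y U"
      and n: "\<not> insert y U \<subseteq> M" for y u u'
  proof -
    have sub: "insert y U \<subseteq> V" using y rmodule_sub[OF M1(1)] unfolding U_def by blast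
    have "rmodule (insert y U) R' (M \<inter> insert y U)" by (rule F.rmodule_restrict[OF M_module[OF M] sub])
    then have "rmodule (insert y U) R (M \<inter> insert y U)"
      using eq[OF y] unfolding rmodule_def by blast
    then show ?thesis using prime[of y "M \<inter> insert y U" u u'] y u n unfolding U_def by blast
  qed
  \<comment> \<open>A second neighbour \<open>d\<close> of \<open>b\<close> is a representative.
    Another vertex of \<open>K d\<close> dominates \<open>b\<close>, so \<open>d\<close> did too,
    and after the reversal \<open>d\<close> no longer does.\<close>
  have no_d: "\<forall>y. E b y \<longrightarrow> y = z" if "\<And>y. y \<in> M1 \<Longrightarrow> y \<noteq> b \<Longrightarrow> R' y b"
  proof (intro allI impI, rule ccontr)
    fix d assume e: "E b d" "d \<noteq> z"
    have d: "d \<in> W" "d \<noteq> b" using edgeW[OF e] edge[OF e(1)] by blast+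
    obtain c where c: "c \<in> K d" "c \<noteq> d" using K_pred[OF d(1)] by blast
    have bKd: "b \<notin> K d" using K_touched[OF d(1), of b] b d by blast
    have cb: "c \<noteq> b" "c \<in> M1" using bKd c M1(2)[OF d(1)] by blast+
    have dV: "d \<in> V" using WM1[OF d(1)] rmodule_sub[OF M1(1)] by blast
    have "R c b" using that[of c] cb K_flip(1)[OF d(1) c] by blast
    then have "R d b" using K_out[OF d(1) c(1) K_self[OF d(1)] V(2) bKd] by blast
    then have "\<not> R' d b" using flip_edge[OF E_sym[OF e(1)]] by blast
    then show False using that[of d] WM1[OF d(1)] d by blast
  qed
  have unflip: "R y b" if "\<forall>y. E b y \<longrightarrow> y = z" "R' y b" "y \<noteq> z" for y
    using that flip_no_edge[of y b] E_sym[of y b] by blast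
  show ?thesis
  proof (cases "\<exists>y. y \<in> M1 \<and> y \<noteq> b \<and> insert y U \<subseteq> M")
    case True
    then obtain y where y: "y \<in> M1" "y \<noteq> b" "insert y U \<subseteq> M" by blast
    have bM: "b \<notin> M" using cross y zU by blast
    have all: "v \<in> M" if "v \<in> V" "v \<noteq> b" for v
    proof (cases "v \<in> M1")
      case True
      obtain u where u: "u \<in> U" "u \<noteq> z" using card_ge2_obtain[OF M1(4)] unfolding U_def by metis
      show ?thesis
      proof (rule ccontr)
        assume "v \<notin> M"
        then show False using trivial[OF True that(2), of u z] u zU y by blast
      qed
    next
      case False then show ?thesis using that y unfolding U_def by blast
    qed
    obtain c where c: "c \<in> K b" "c \<noteq> b" "R c b" using K_pred[OF b(1)] by blast
    have cM: "c \<in> M" using all c K_sub[OF b(1)] by blast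
    have "R' c b" using K_flip(1)[OF b(1) c(1,2)] c(3) by blast
    then have Rb: "R' v b" if "v \<in> M" for v using M_out[OF M cM that V(2) bM] by blast
    have M1V: "v \<in> M" if "v \<in> M1" "v \<noteq> b" for v using all that rmodule_sub[OF M1(1)] by blast
    have nd: "\<forall>y. E b y \<longrightarrow> y = z" using no_d Rb M1V by blast
    have 1: "\<forall>y\<in>M1 - {b}. R y b"
    proof
      fix v assume "v \<in> M1 - {b}"
      then show "R v b" using unflip[OF nd Rb, of v] M1V[of v] M1(3) by blast
    qed
    have 2: "\<forall>u\<in>V - M1 - {z}. R u b"
    proof
      fix v assume v: "v \<in> V - M1 - {z}"
      then have "v \<in> M" using all V(3) by blast
      then show "R v b" using unflip[OF nd Rb, of v] v by blast
    qed
    have "z \<in> M" "z \<noteq> b" using cross bM by blast+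
    then have "R b z" using Rb[of z] flip_edge[OF b(2)] arc[OF V(1,2)] by blast
    then show ?thesis using nd 1 2 by blast
  next
    case False
    have nK: "\<exists>c. c \<in> K b \<and> c \<noteq> b \<and> c \<in> M1" using K_pred[OF b(1)] M1(2)[OF b(1)] by blast
    then obtain c0 where c0: "c0 \<in> M1" "c0 \<noteq> b" by blast
    have triv: "u = u'" if "y \<in> M1" "y \<noteq> b" "u \<in> M \<inter> insert y U" "u' \<in> M \<inter> insert y U" for y u u'
      using trivial[OF that] False that by blast
    have zM: "z \<notin> M"
    proof
      assume zM: "z \<in> M"
      then have bM: "b \<notin> M" using cross by blast
      obtain v where v: "v \<in> M" "v \<noteq> z" using M_other[OF M] by blast
      show False
      proof (cases "v \<in> M1")
        case True
        then show False using triv[of v v z] v zM zU bM by blast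
      next
        case False
        then have "v \<in> U" using v sub unfolding U_def by blast
        then show False using triv[OF c0, of v z] v zM zU by blast
      qed
    qed
    then have bM: "b \<in> M" using cross by blast
    have out1: "y \<notin> M" if y: "y \<in> M1" "y \<noteq> b" for y
    proof
      assume "y \<in> M"
      then have "R' z b = R' z y" using M_in[OF M bM _ V(1) zM] by blast
      moreover have "R z b = R z y" using rmodule_in[OF M1(1) V(3) y(1) V(1) M1(3)] .
      ultimately show False using flip_edge[OF b(2)] flip_no_edge[OF zE(1)[OF y(2)]] by blast
    qed
    obtain u where u: "u \<in> M" "u \<noteq> b" using M_other[OF M] by blast
    have uU: "u \<in> U" "u \<noteq> z" using out1 u sub zM unfolding U_def by blast+
    have only: "v = u \<or> v = b" if v: "v \<in> M" for v
    proof (cases "v \<in> M1")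
      case True then show ?thesis using out1 v by blast
    next
      case False
      then have "v \<in> U" using v sub unfolding U_def by blast
      then show ?thesis using triv[OF c0, of v u] v u uU by blast
    qed
    have uV: "u \<in> V" "u \<notin> M1" using uU unfolding U_def by blast+
    obtain c where c: "K b = {c, b}" "c \<noteq> b" "R c b" using cross_inner[OF M b(1) bM zM E_sym[OF b(2)]] by metis
    have cK: "c \<in> K b" using c by blast
    have cM1: "c \<in> M1" using M1(2)[OF b(1)] cK by blast
    have cM: "c \<notin> M" "c \<in> V" using out1[OF cM1 c(2)] cM1 rmodule_sub[OF M1(1)] by blast+
    have "R' c u = R' c b" using M_in[OF M u(1) bM cM(2,1)] .
    then have "R c u" using K_flip(1)[OF b(1) cK c(2)] c(3) by blast
    then have Ru: "R y u" if "y \<in> M1" for y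
      using rmodule_out[OF M1(1) that cM1 uV] by blast
    have Rb': "R' y b" if y: "y \<in> M1" "y \<noteq> b" for y
    proof -
      have "y \<notin> M" "y \<in> V" using out1[OF y] y rmodule_sub[OF M1(1)] by blast+
      then have "R' y u = R' y b" using M_in[OF M u(1) bM] by blast
      then show ?thesis using flip_no_edge[OF U_free(2)[OF uU]] Ru[OF y(1)] by blast
    qed
    have nd: "\<forall>y. E b y \<longrightarrow> y = z" using no_d Rb' by blast
    have 1: "\<forall>y\<in>M1 - {b}. R y b" using unflip[OF nd] Rb' M1(3) by blast
    have "R' z u = R' z b" using M_in[OF M u(1) bM V(1) zM] .
    then have 2: "R z u \<longleftrightarrow> \<not> R z b" using flip_edge[OF b(2)] flip_no_edge[OF zE(1)[OF u(2)]] by blast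
    have 3: "\<forall>v\<in>V - M1 - {u, z}. R v u \<longleftrightarrow> R v b"
    proof
      fix v assume v: "v \<in> V - M1 - {u, z}"
      then have "v \<in> U" "v \<noteq> z" "v \<notin> M" using only V(3) unfolding U_def by blast+
      then show "R v u \<longleftrightarrow> R v b"
        using M_in[OF M u(1) bM, of v] U_free(1)[of v] flip_no_edge[of v] v by blast
    qed
    show ?thesis using nd 1 2 3 Ru[OF V(3)] uU unfolding U_def by blast
  qed
qed

end

section \<open>Edges that cross all modules\<close>

text \<open>The partner of \<open>p\<close> cannot be \<open>p - k\<close>, which is below the
  interval, so it is \<open>p + k\<close>, and this puts position \<open>k\<close> inside. The
  partner of \<open>k\<close> is \<open>0\<close>, whence \<open>p = 0\<close>. The last position is
  the partner of \<open>k\<close> for odd \<open>m\<close> and of \<open>k - 1\<close> for even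
  \<open>m\<close>, whence \<open>q = m\<close>.\<close>

lemma interval_closed_under_half_shift:
  fixes p q k m :: nat
  assumes m: "m = 2 * k \<or> m = 2 * k + 1" and "1 \<le> k" and pq: "p < q" "q \<le> m"
    and closed: "\<And>i. i + k < m \<Longrightarrow> p \<le> i \<and> i < q \<longleftrightarrow> p \<le> i + k \<and> i + k < q"
  shows "p = 0 \<and> q = m"
proof -
  have "p + k < m"
  proof (rule ccontr)
    assume "\<not> p + k < m"
    then show False using closed[of "p - k"] m pq \<open>1 \<le> k\<close> by auto
  qed
  then have "p \<le> k \<and> k < q" using closed[of p] pq m by auto
  then have p: "p = 0" using closed[of 0] m \<open>1 \<le> k\<close> by auto
  have "q = m"
    using m
  proof
    assume "m = 2 * k"
    then have "k - 1 + k < m" using \<open>1 \<le> k\<close> by linarith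
    from closed[OF this] show ?thesis
      using \<open>m = 2 * k\<close> \<open>p \<le> k \<and> k < q\<close> p \<open>1 \<le> k\<close> pq by linarith
  next
    assume "m = 2 * k + 1"
    then show ?thesis using closed[of k] \<open>p \<le> k \<and> k < q\<close> p pq by auto
  qed
  with p show ?thesis ..
qed

lemma (in rel_tournament) module_trace_order:
  assumes "W \<subseteq> V"
  obtains ws where "distinct ws" "set ws = W"
    and "\<And>L. rmodule V R L \<Longrightarrow> \<exists>p q. p \<le> q \<and> q \<le> length ws \<and> (\<forall>i<length ws. ws ! i \<in> L \<longleftrightarrow> p \<le> i \<and> i < q)"
proof -
  obtain xs where xs: "distinct xs" "set xs = V"
    and ord: "\<And>M. rmodule V R M \<Longrightarrow> \<exists>A B C. xs = A @ B @ C \<and> set B = M"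
    using module_order by blast
  let ?f = "filter (\<lambda>x. x \<in> W)"
  show ?thesis
  proof (rule that[of "?f xs"])
    fix L assume "rmodule V R L"
    then obtain A B C where x: "xs = A @ B @ C" "set B = L" using ord by blast
    let ?p = "length (?f A)" and ?q = "length (?f A) + length (?f B)"
    have d: "set A \<inter> L = {}" "set C \<inter> L = {}" using xs(1) x by auto
    have "?f xs ! i \<in> L \<longleftrightarrow> ?p \<le> i \<and> i < ?q" if "i < length (?f xs)" for i
    proof (cases "i < ?p")
      case True
      then have "?f xs ! i \<in> set A" using x nth_mem[of i "?f A"] by (auto simp: nth_append)
      then show ?thesis using d True by auto
    next
      case False
      show ?thesis
      proof (cases "i < ?q")
        case True
        then have "?f xs ! i \<in> set B" using x False nth_mem[of "i - ?p" "?f B"] by (auto simp: nth_append)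
        then show ?thesis using x False True by auto
      next
        case F: False
        then have "?f xs ! i \<in> set C" using x False that nth_mem[of "i - ?q" "?f C"] by (auto simp: nth_append)
        then show ?thesis using d F by auto
      qed
    qed
    moreover have "?q \<le> length (?f xs)" using x by simp
    ultimately show "\<exists>p q. p \<le> q \<and> q \<le> length (?f xs) \<and> (\<forall>i<length (?f xs). ?f xs ! i \<in> L \<longleftrightarrow> p \<le> i \<and> i < q)"
      by (metis le_add1)
  qed (use xs assms in auto)
qed

text \<open>The properties of the half-shift pairing, expressed through traces of modules on
  \<open>W\<close>, which are intervals of a list. A trace with two elements occupies consecutive
  positions, which are neither at distance \<open>k\<close> nor both at distance \<open>k\<close>
  from a third. A trace that lacks one vertex lacks an end of the list, and an end has a single
  partner. Removing an end and its partner does not leave an interval.\<close>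

locale crossing_pairing = rel_tournament V R for V :: "'a set" and R +
  fixes W :: "'a set" and ES :: "'a set set"
  assumes finite_edges: "finite ES"
    and card_edges: "card ES \<le> (card W + 1) div 2"
    and edge_ends: "{x, y} \<in> ES \<Longrightarrow> x \<noteq> y \<and> x \<in> W \<and> y \<in> W"
    and crossed: "\<lbrakk>rmodule V R L; x \<in> W; x \<in> L; y \<in> W; y \<notin> L\<rbrakk> \<Longrightarrow> \<exists>x y. {x, y} \<in> ES \<and> x \<in> L \<and> y \<notin> L"
    and trace_not_edge: "\<lbrakk>rmodule V R L; L \<inter> W = {x, y}\<rbrakk> \<Longrightarrow> {x, y} \<notin> ES"
    and trace_no_common: "\<lbrakk>rmodule V R L; L \<inter> W = {x, y}; x \<noteq> y; {x, c} \<in> ES\<rbrakk> \<Longrightarrow> {y, c} \<notin> ES"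
    and leaf: "\<lbrakk>rmodule V R L; z \<in> W; L \<inter> W = W - {z}\<rbrakk> \<Longrightarrow> \<exists>b. \<forall>y. {z, y} \<in> ES \<longleftrightarrow> y = b"
    and leaf_not_near_end: "\<lbrakk>rmodule V R L; z \<in> W; L \<inter> W = W - {z}; {z, b} \<in> ES; rmodule V R L'\<rbrakk> \<Longrightarrow>
      L' \<inter> W \<noteq> W - {z, b}"

lemma (in rel_tournament) crossing_pairing_ex:
  assumes "W \<subseteq> V" "4 \<le> card W"
  shows "\<exists>ES. crossing_pairing V R W ES"
proof -
  obtain ws where ws: "distinct ws" "set ws = W"
    and tr: "\<And>L. rmodule V R L \<Longrightarrow> \<exists>p q. p \<le> q \<and> q \<le> length ws \<and> (\<forall>i<length ws. ws ! i \<in> L \<longleftrightarrow> p \<le> i \<and> i < q)"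
    using module_trace_order[OF assms(1)] by blast
  define m where "m = length ws"
  define k where "k = m div 2"
  have m: "m = card W" using ws distinct_card unfolding m_def by metis
  \<comment> \<open>Here four vertices are needed: \<open>k\<close> \<ge> 2 keeps partners from
    being consecutive.\<close>
  have k: "m = 2 * k \<or> m = 2 * k + 1" "2 \<le> k" using m assms unfolding k_def by auto
  \<comment> \<open>These are \<open>m - k\<close> edges, half of \<open>m\<close> rounded up. For
    odd \<open>m\<close> only the middle position has two partners, the two ends.\<close>
  define ES where "ES = (\<lambda>i. {ws ! i, ws ! (i + k)}) ` {..<m - k}"
  have inj: "ws ! i = ws ! j \<longleftrightarrow> i = j" if "i < m" "j < m" for i j
    using that ws(1) nth_eq_iff_index_eq unfolding m_def by blast
  have inW: "ws ! i \<in> W" if "i < m" for i using that ws nth_mem unfolding m_def by blast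
  have idx: "\<exists>i<m. x = ws ! i" if "x \<in> W" for x using that ws in_set_conv_nth unfolding m_def by metis
  have ES_D: "\<exists>i j. i < m \<and> j < m \<and> x = ws ! i \<and> y = ws ! j \<and> (j = i + k \<or> i = j + k)" if "{x, y} \<in> ES" for x y
  proof -
    obtain i where "i < m - k" and i: "{x, y} = {ws ! i, ws ! (i + k)}"
      using \<open>{x, y} \<in> ES\<close> unfolding ES_def by blast
    then have "i + k < m" "i < m" by linarith+
    moreover have "x = ws ! i \<and> y = ws ! (i + k) \<or> x = ws ! (i + k) \<and> y = ws ! i"
      using i by (auto simp: doubleton_eq_iff)
    ultimately show ?thesis by blast
  qed
  have E: "{ws ! i, ws ! j} \<in> ES \<longleftrightarrow> j = i + k \<or> i = j + k" if "i < m" "j < m" for i j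
  proof
    assume "{ws ! i, ws ! j} \<in> ES"
    then show "j = i + k \<or> i = j + k" using ES_D[of "ws ! i" "ws ! j"] inj that by auto
  next
    assume "j = i + k \<or> i = j + k"
    then show "{ws ! i, ws ! j} \<in> ES"
    proof
      assume *: "j = i + k"
      then have "i \<in> {..<m - k}" using that by auto
      then show ?thesis unfolding ES_def * by (rule imageI)
    next
      assume *: "i = j + k"
      then have "j \<in> {..<m - k}" using that by auto
      then show ?thesis unfolding ES_def * by (subst insert_commute) (rule imageI)
    qed
  qed
  have trace: "\<exists>p q. p \<le> q \<and> q \<le> m \<and> (\<forall>i<m. ws ! i \<in> L \<longleftrightarrow> p \<le> i \<and> i < q)" if "rmodule V R L" for L
    using tr[OF that] unfolding m_def .
  have adj: "j = i + 1 \<or> i = j + 1" if L: "rmodule V R L" "L \<inter> W = {ws ! i, ws ! j}" and ij: "i < m" "j < m" "i \<noteq> j" for L i j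
  proof -
    obtain p q where pq: "p \<le> q" "q \<le> m" "\<And>i. i < m \<Longrightarrow> ws ! i \<in> L \<longleftrightarrow> p \<le> i \<and> i < q" using trace[OF L(1)] by blast
    have I: "p \<le> l \<and> l < q \<longleftrightarrow> l = i \<or> l = j" if "l < m" for l
      using pq(3)[OF that] inW[OF that] L(2) inj ij that by blast
    have "p \<le> i" "i < q" "p \<le> j" "j < q" using I[of i] I[of j] ij by blast+
    then show ?thesis using I[of "i + 1"] I[of "j + 1"] ij by (cases "i < j") auto
  qed
  have end_: "l = 0 \<or> l = m - 1" if L: "rmodule V R L" "L \<inter> W = W - {ws ! l}" and l: "l < m" for L l
  proof -
    obtain p q where pq: "p \<le> q" "q \<le> m" "\<And>i. i < m \<Longrightarrow> ws ! i \<in> L \<longleftrightarrow> p \<le> i \<and> i < q" using trace[OF L(1)] by blast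
    have I: "p \<le> i \<and> i < q \<longleftrightarrow> i \<noteq> l" if "i < m" for i
      using pq(3)[OF that] inW[OF that] L(2) inj l that by blast
    show ?thesis
    proof (rule ccontr)
      assume n: "\<not> ?thesis"
      then have "p = 0" "m - 1 < q" using I[of 0] I[of "m - 1"] l by auto
      then show False using I[of l] l by auto
    qed
  qed
  show ?thesis
  proof (intro exI[of _ ES], unfold_locales)
    show "finite ES" unfolding ES_def by simp
    show "card ES \<le> (card W + 1) div 2"
    proof -
      have "card ES \<le> m - k" unfolding ES_def using card_image_le[of "{..<m - k}"] by fastforce
      then show ?thesis using k m by auto
    qed
  next
    fix x y assume "{x, y} \<in> ES"
    then show "x \<noteq> y \<and> x \<in> W \<and> y \<in> W" using ES_D[of x y] inj inW k by fastforce
  next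
    fix L x y assume *: "rmodule V R L" "x \<in> W" "x \<in> L" "y \<in> W" "y \<notin> L"
    obtain i j where ij: "i < m" "x = ws ! i" "j < m" "y = ws ! j" using idx * by metis
    obtain p q where pq: "p \<le> q" "q \<le> m" "\<And>i. i < m \<Longrightarrow> ws ! i \<in> L \<longleftrightarrow> p \<le> i \<and> i < q" using trace[OF *(1)] by blast
    show "\<exists>x y. {x, y} \<in> ES \<and> x \<in> L \<and> y \<notin> L"
    proof (rule ccontr)
      assume n: "\<not> ?thesis"
      have i: "p \<le> i" "i < q" "\<not> (p \<le> j \<and> j < q)" using pq(3)[of i] pq(3)[of j] ij * by auto
      have "p = 0 \<and> q = m"
      proof (rule interval_closed_under_half_shift[OF k(1)])
        fix l assume l: "l + k < m"
        then have "{ws ! l, ws ! (l + k)} \<in> ES" "{ws ! (l + k), ws ! l} \<in> ES" using E by auto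
        then have "ws ! l \<in> L \<longleftrightarrow> ws ! (l + k) \<in> L" using n by blast
        then show "(p \<le> l \<and> l < q) = (p \<le> l + k \<and> l + k < q)" using pq(3)[of l] pq(3)[of "l + k"] l by simp
      qed (use i pq k in auto)
      then show False using i ij by auto
    qed
  next
    fix L x y assume *: "rmodule V R L" "L \<inter> W = {x, y}"
    show "{x, y} \<notin> ES"
    proof
      assume "{x, y} \<in> ES"
      then obtain i j where "i < m" "j < m" "x = ws ! i" "y = ws ! j" "j = i + k \<or> i = j + k" using ES_D by blast
      then have "(j = i + 1 \<or> i = j + 1) \<or> i = j" using adj[OF *(1), of i j] *(2) by blast
      then show False using \<open>j = i + k \<or> i = j + k\<close> k(2) by (elim disjE) linarith+
    qed
  next
    fix L x y c assume *: "rmodule V R L" "L \<inter> W = {x, y}" "x \<noteq> y" "{x, c} \<in> ES"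
    show "{y, c} \<notin> ES"
    proof
      assume "{y, c} \<in> ES"
      then obtain i j where ij: "i < m" "j < m" "y = ws ! i" "c = ws ! j" "j = i + k \<or> i = j + k" using ES_D by blast
      obtain l j' where l: "l < m" "j' < m" "x = ws ! l" "c = ws ! j'" "j' = l + k \<or> l = j' + k" using ES_D *(4) by blast
      have "j' = j" using l ij inj by blast
      have "l \<noteq> i" using * l ij by blast
      then have "i = l + 1 \<or> l = i + 1" using adj[OF *(1), of l i] *(2) ij(1,3) l(1,3) by simp
      then show False using ij(5) l(5)[unfolded \<open>j' = j\<close>] k(2) by (elim disjE) linarith+
    qed
  next
    fix L z assume *: "rmodule V R L" "z \<in> W" "L \<inter> W = W - {z}"
    obtain l where l: "l < m" "z = ws ! l" using idx * by blast
    have "l = 0 \<or> l = m - 1" using end_ l * by blast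
    then obtain l' where l': "l' < m" "\<And>j. j < m \<Longrightarrow> j = l + k \<or> l = j + k \<longleftrightarrow> j = l'"
    proof
      assume "l = 0"
      show ?thesis by (rule that[of k]) (use k \<open>l = 0\<close> in linarith)+
    next
      assume "l = m - 1"
      show ?thesis by (rule that[of "m - 1 - k"]) (use k \<open>l = m - 1\<close> in linarith)+
    qed
    have "\<forall>y. {z, y} \<in> ES \<longleftrightarrow> y = ws ! l'"
    proof (intro allI iffI)
      fix y assume "{z, y} \<in> ES"
      then obtain i j where ij: "i < m" "j < m" "z = ws ! i" "y = ws ! j" "j = i + k \<or> i = j + k" using ES_D by blast
      then have "i = l" using l inj by blast
      then show "y = ws ! l'" using l' ij by blast
    next
      fix y assume "y = ws ! l'"
      then show "{z, y} \<in> ES" using E[OF l(1) l'(1)] l'(2)[OF l'(1)] l by blast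
    qed
    then show "\<exists>b. \<forall>y. {z, y} \<in> ES \<longleftrightarrow> y = b" by blast
  next
    fix L L' z b assume *: "rmodule V R L" "z \<in> W" "L \<inter> W = W - {z}" "{z, b} \<in> ES" "rmodule V R L'"
    obtain l j where l: "l < m" "j < m" "z = ws ! l" "b = ws ! j" "j = l + k \<or> l = j + k" using ES_D *(4) by blast
    have l0: "l = 0 \<or> l = m - 1" using end_ l * by blast
    show "L' \<inter> W \<noteq> W - {z, b}"
    proof
      assume t: "L' \<inter> W = W - {z, b}"
      obtain p q where pq: "p \<le> q" "q \<le> m" "\<And>i. i < m \<Longrightarrow> ws ! i \<in> L' \<longleftrightarrow> p \<le> i \<and> i < q" using trace[OF *(5)] by blast
      have I: "p \<le> i \<and> i < q \<longleftrightarrow> i \<noteq> l \<and> i \<noteq> j" if "i < m" for i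
        using pq(3)[OF that] inW[OF that] t inj l that by blast
      from l0 show False
      proof
        assume "l = 0"
        then have "j = k" using l(5) k(2) by linarith
        \<comment> \<open>Positions \<open>1\<close> and \<open>m - 1\<close> remain, and the
          removed position \<open>k\<close> lies strictly between them.\<close>
        have "1 < m" "m - 1 < m" "1 \<noteq> k" "m - 1 \<noteq> k" "m - 1 \<noteq> 0" using k by auto
        then have "p \<le> 1" "m - 1 < q" using I[of 1] I[of "m - 1"] \<open>l = 0\<close> \<open>j = k\<close> by simp_all
        then show False using I[of k] \<open>j = k\<close> l(2) k(2) by simp
      next
        assume "l = m - 1"
        then have "j = m - 1 - k" using l(2,5) k(2) by linarith
        have "0 < m" "m - 2 < m" "0 \<noteq> j" "m - 2 \<noteq> j" "m - 2 \<noteq> m - 1" "0 \<noteq> m - 1"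
          using k \<open>j = m - 1 - k\<close> by auto
        then have "p = 0" "m - 2 < q" using I[of 0] I[of "m - 2"] \<open>l = m - 1\<close> by simp_all
        then show False using I[of j] \<open>j = m - 1 - k\<close> l(2) k(2) by simp
      qed
    qed
  qed
qed

section \<open>Tournaments with a source\<close>

definition prime_by_flips :: "nat \<Rightarrow> 'a set \<Rightarrow> ('a \<Rightarrow> 'a \<Rightarrow> bool) \<Rightarrow> bool" where
  "prime_by_flips n V R \<longleftrightarrow> (\<exists>ES. finite ES \<and> card ES \<le> n \<and> (\<forall>M. \<not> ntmodule V (flip ES R) M))"

text \<open>The extremal tournaments in intrinsic form: between a source \<open>s\<close> and a sink
  \<open>t\<close> all vertices fall into twin pairs \<open>{f w, w}\<close> with sink
  \<open>w\<close>. Nothing is said about arcs inside \<open>W\<close>; they form the arbitrary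
  tournament of the theorem.\<close>

definition twin_paired :: "nat \<Rightarrow> 'a set \<Rightarrow> ('a \<Rightarrow> 'a \<Rightarrow> bool) \<Rightarrow> bool" where
  "twin_paired m V R \<longleftrightarrow> (\<exists>s t W f. s \<noteq> t \<and> V = {s, t} \<union> W \<union> f ` W \<and> {s, t} \<inter> (W \<union> f ` W) = {} \<and>
     W \<inter> f ` W = {} \<and> inj_on f W \<and> card W = m \<and>
     (\<forall>v\<in>V - {s}. R s v) \<and> (\<forall>v\<in>V - {t}. R v t) \<and>
     (\<forall>w\<in>W. R (f w) w \<and> rmodule V R {f w, w}))"

lemma prime_by_flipsI:
  "finite ES \<Longrightarrow> card ES \<le> n \<Longrightarrow> (\<And>M. ntmodule V (flip ES R) M \<Longrightarrow> False) \<Longrightarrow> prime_by_flips n V R"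
  unfolding prime_by_flips_def by blast

text \<open>If reversing the arc to \<open>z\<close> fails, the obstructing module is
  \<open>{s, u}\<close>, and \<open>z\<close> is the only in-neighbour of \<open>u\<close> in
  \<open>V - {s}\<close>. If every \<open>z\<close> fails, the map from \<open>z\<close> to
  \<open>u\<close> is injective, hence onto, so each vertex of \<open>V - {s}\<close> has exactly
  one in-neighbour there. Four or more vertices have too many arcs for that.\<close>

lemma (in rel_tournament) source_over_prime:
  assumes s: "s \<in> V" "\<And>v. v \<in> V \<Longrightarrow> v \<noteq> s \<Longrightarrow> R s v"
    and prime: "\<And>L x y. rmodule (V - {s}) R L \<Longrightarrow> L \<noteq> V - {s} \<Longrightarrow> x \<in> L \<Longrightarrow> y \<in> L \<Longrightarrow> x = y"
    and card: "4 \<le> card (V - {s})"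
  shows "\<exists>z. \<forall>M. \<not> ntmodule V (flip {{s, z}} R) M"
proof (rule ccontr)
  assume n: "\<not> ?thesis"
  let ?X = "V - {s}"
  have bad: "\<exists>u. u \<in> ?X \<and> u \<noteq> z \<and> R z u \<and> (\<forall>v\<in>?X - {u, z}. R u v)" if z: "z \<in> ?X" for z
  proof -
    let ?R = "flip {{s, z}} R"
    interpret F: rel_tournament V ?R by (rule flip_tournament) (use z in force)
    obtain M where M: "ntmodule V ?R M" using n by blast
    have mM: "rmodule V ?R M" and sub: "M \<subseteq> V" using F.ntmoduleD[OF M] by blast+
    have eqX: "?R x y = R x y" if "x \<in> ?X" "y \<in> ?X" for x y
      using that by (auto simp: flip_def doubleton_eq_iff)
    have eqs: "?R s y \<longleftrightarrow> y \<noteq> z" if "y \<in> ?X" for y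
      using that s(2)[of y] by (auto simp: flip_def doubleton_eq_iff)
    have "rmodule ?X ?R (M \<inter> ?X)" by (rule F.rmodule_restrict[OF mM]) blast
    then have mX: "rmodule ?X R (M \<inter> ?X)" using eqX unfolding rmodule_def by blast
    have "\<not> ?X \<subseteq> M"
    proof
      assume *: "?X \<subseteq> M"
      then have "s \<notin> M" using F.ntmoduleD(3)[OF M] sub by blast
      have "2 \<le> card ?X" using card by linarith
      then obtain y where "y \<in> ?X" "y \<noteq> z" using card_ge2_obtain by metis
      then show False using F.rmodule_in[OF mM, of y z s] * z eqs \<open>s \<notin> M\<close> s by blast
    qed
    then have one: "x = y" if "x \<in> M \<inter> ?X" "y \<in> M \<inter> ?X" for x y
      using prime[OF mX _ that] by blast
    obtain u where u: "u \<in> M" "u \<noteq> s" using card_ge2_obtain[OF F.ntmoduleD(2)[OF M]] by metis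
    obtain u' where u': "u' \<in> M" "u' \<noteq> u" using card_ge2_obtain[OF F.ntmoduleD(2)[OF M]] by metis
    have sM: "s \<in> M" using one[of u u'] u u' sub by blast
    have uX: "u \<in> ?X" using u sub by blast
    have out: "?R s v = ?R u v" if "v \<in> ?X" "v \<noteq> u" for v
    proof -
      have "v \<notin> M" using one[of v u] that u uX by blast
      then show ?thesis using F.rmodule_out[OF mM sM u(1)] that by blast
    qed
    have uz: "u \<noteq> z"
    proof
      assume "u = z"
      then have "R z v" if "v \<in> ?X" "v \<noteq> z" for v using out eqs eqX that z by blast
      then have m: "rmodule ?X R (?X - {z})" unfolding rmodule_def using z by blast
      have "2 \<le> card (?X - {z})" using card z fin by simp
      then obtain x y where "x \<in> ?X - {z}" "y \<in> ?X - {z}" "x \<noteq> y" using card_ge2_obtain by metis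
      then show False using prime[OF m] z by blast
    qed
    have "R z u" using out[OF z] uz eqs[OF z] eqX[OF uX z] arc[of u z] uX z by blast
    moreover have "\<forall>v\<in>?X - {u, z}. R u v" using out eqs eqX[OF uX] by blast
    ultimately show ?thesis using uX uz by blast
  qed
  then obtain f where f: "\<And>z. z \<in> ?X \<Longrightarrow> f z \<in> ?X \<and> f z \<noteq> z \<and> R z (f z) \<and> (\<forall>v\<in>?X - {f z, z}. R (f z) v)"
    by metis
  have inj: "inj_on f ?X"
  proof (rule inj_onI, rule ccontr)
    fix x y assume *: "x \<in> ?X" "y \<in> ?X" "f x = f y" "x \<noteq> y"
    have "R (f x) y" using f[OF *(1)] f[OF *(2)] * by auto
    moreover have "R y (f x)" using f[OF *(2)] * by auto
    ultimately show False using arc[of y "f x"] f[OF *(1)] f[OF *(2)] * by auto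
  qed
  have "f ` ?X \<subseteq> ?X" using f by blast
  then have surj: "f ` ?X = ?X" using inj fin endo_inj_surj by blast
  have ex2: "\<exists>v\<in>A. v \<noteq> x \<and> v \<noteq> y" if "3 \<le> card A" "finite A" for A :: "'a set" and x y
  proof (rule ccontr)
    assume "\<not> ?thesis"
    then have "A \<subseteq> {x, y}" by blast
    then have "card A \<le> card {x, y}" by (intro card_mono) auto
    also have "\<dots> \<le> 2" by (simp add: card_insert_if)
    finally show False using that by linarith
  qed
  have "?X \<noteq> {}" using card by force
  then obtain x where x: "x \<in> f ` ?X" using surj by blast
  then obtain p where p: "p \<in> ?X" "x = f p" by blast
  have xX: "x \<in> ?X" using x surj by blast
  obtain v1 where v1: "v1 \<in> ?X" "v1 \<noteq> x" "v1 \<noteq> p" using ex2[of ?X x p] card fin by auto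
  have "3 \<le> card (?X - {v1})" using card v1 fin by simp
  then obtain v2 where v2: "v2 \<in> ?X" "v2 \<noteq> v1" "v2 \<noteq> x" "v2 \<noteq> p" using ex2[of "?X - {v1}" x p] fin by auto
  have dom: "R x v" if "v \<in> ?X" "v \<noteq> x" "v \<noteq> p" for v using f[OF p(1)] p that by blast
  \<comment> \<open>The only in-neighbour of \<open>v\<close> is \<open>x\<close>, so
    \<open>v\<close> dominates the rest; two such vertices would dominate each other.\<close>
  have pred: "R v u" if v: "v \<in> ?X" "v \<noteq> x" "v \<noteq> p" and u: "u \<in> ?X" "u \<noteq> v" "u \<noteq> x" for u v
  proof -
    obtain q where q: "q \<in> ?X" "v = f q" using v surj by blast
    have "\<not> R v x" using dom[OF v] arc[of v x] v xX by blast
    then have "q = x" using f[OF q(1)] q xX v by blast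
    then show ?thesis using f[OF q(1)] q u by blast
  qed
  show False using pred[of v1 v2] pred[of v2 v1] v1 v2 arc[of v1 v2] by blast
qed

context module_family
begin

lemma finite_W: "finite W"
  using W_sub fin by (rule finite_subset)

lemma card_Union_K: "2 * card W \<le> card (\<Union>w\<in>W. K w)"
proof -
  have "card (\<Union>w\<in>W. K w) = (\<Sum>w\<in>W. card (K w))"
    using finite_W K_finite K_disj by (intro card_UN_disjoint) blast+
  moreover have "(\<Sum>w\<in>W. 2) \<le> (\<Sum>w\<in>W. card (K w))" using K_card by (rule sum_mono)
  ultimately show ?thesis by simp
qed

lemma card_W_outside:
  assumes "U \<subseteq> V" "\<And>w. w \<in> W \<Longrightarrow> K w \<inter> U = {}"
  shows "2 * card W + card U \<le> card V"
proof -
  have "card (\<Union>w\<in>W. K w) + card U = card ((\<Union>w\<in>W. K w) \<union> U)"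
    using finite_W K_finite finite_subset[OF assms(1) fin] assms(2)
    by (intro card_Un_disjoint[symmetric]) auto
  also have "\<dots> \<le> card V" using K_sub assms(1) fin by (intro card_mono) blast+
  finally show ?thesis using card_Union_K by linarith
qed

text \<open>Subtracting this module from \<open>K a\<close> would leave \<open>K a - {a}\<close> as
  a module, that is, a single vertex. But \<open>K a\<close> has one vertex that dominates
  \<open>a\<close> and, by assumption, another that does not.\<close>

lemma insert_K_not_module:
  assumes a: "a \<in> W" "\<exists>c\<in>K a. c \<noteq> a \<and> \<not> R c a" and b: "b \<in> W" "a \<noteq> b"
  shows "\<not> rmodule V R (insert a (K b))"
proof
  assume m: "rmodule V R (insert a (K b))"
  have "b \<notin> K a" using K_disj[OF a(1) b(1) _ K_self[OF b(1)]] b(2) by blast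
  then have "rmodule V R (K a - insert a (K b))"
    using rmodule_Diff[OF K_module[OF a(1)] m] K_self[OF b(1)] by blast
  moreover have "K a - insert a (K b) = K a - {a}" using K_disj[OF a(1) b(1)] b(2) by blast
  ultimately have "x = y" if "x \<in> K a" "x \<noteq> a" "y \<in> K a" "y \<noteq> a" for x y
    using K_small[OF a(1), of "K a - {a}" x y] K_self[OF a(1)] that by auto
  moreover obtain c where "c \<in> K a" "c \<noteq> a" "R c a" using K_pred[OF a(1)] by blast
  ultimately show False using a(2) by blast
qed

end

lemma card3_obtain:
  assumes "card A = 3" "x \<in> A"
  obtains y z where "A = {x, y, z}" "x \<noteq> y" "x \<noteq> z" "y \<noteq> z"
proof -
  have "finite A" using assms(1) by (intro card_ge_0_finite) simp
  then have "card (A - {x}) = 2" using assms by simp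
  then obtain y z where "A - {x} = {y, z}" "y \<noteq> z" unfolding card_2_iff by blast
  moreover from this(1) have "A = {x, y, z}" using insert_Diff[OF assms(2)] by simp
  moreover have "x \<noteq> y" "x \<noteq> z" using calculation(1) by blast+
  ultimately show ?thesis using that by blast
qed

text \<open>Counting decides: \<open>n\<close> edges can join \<open>2 * n\<close> vertices, and
  \<open>2 * card W + card X \<le> 4 * n\<close> with \<open>card X \<le> 2\<close>. So
  \<open>card (W \<union> X)\<close> exceeds \<open>2 * n\<close> only if \<open>T\<close> is
  nonempty and \<open>card W = 2 * n - 1\<close>. Then there is no room left, and the sets
  \<open>K w\<close> are pairs that together with \<open>X\<close> fill \<open>V\<close>.\<close>

theorem (in rel_tournament) source_dichotomy:
  assumes s: "s \<in> V" "\<And>v. v \<in> V \<Longrightarrow> v \<noteq> s \<Longrightarrow> R s v"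
    and card: "card V = 4 * n" and n: "2 \<le> n"
  shows "prime_by_flips n V R \<or> twin_paired (2 * n - 1) V R"
proof -
  obtain W K where fam: "module_family V R W K" and Ks: "\<And>w. w \<in> W \<Longrightarrow> K w \<inter> {s} = {}"
    and hit: "\<And>L. ntmodule V R L \<Longrightarrow> L \<inter> (W \<union> {s}) \<noteq> {}"
  proof -
    have "\<exists>W K. module_family V R W K \<and> (\<forall>w\<in>W. K w \<inter> {s} = {}) \<and>
      (\<forall>L. ntmodule V R L \<longrightarrow> L \<inter> (W \<union> {s}) \<noteq> {})"
      by (rule module_family_ex) (use s in auto)
    then show ?thesis using that by blast
  qed
  interpret module_family V R W K by (rule fam)
  \<comment> \<open>A sink outside \<open>W\<close> has to be joined as well, since otherwise its
    complement could contain all joined vertices without being crossed. There is at most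
    one.\<close>
  define T where "T = {t \<in> V - W. t \<noteq> s \<and> (\<forall>v\<in>V. v \<noteq> t \<longrightarrow> R v t)}"
  define X where "X = insert s T"
  have T: "t \<in> V" "t \<notin> W" "t \<noteq> s" "\<And>v. v \<in> V \<Longrightarrow> v \<noteq> t \<Longrightarrow> R v t" if "t \<in> T" for t
    using that unfolding T_def by blast+
  have T1: "t = t'" if "t \<in> T" "t' \<in> T" for t t'
    using T(4)[OF that(1), of t'] T(4)[OF that(2), of t] T(1)[OF that(1)] T(1)[OF that(2)] arc[of t t'] by blast
  have TK: "t \<notin> K w" if t: "t \<in> T" and w: "w \<in> W" for t w
  proof
    assume tK: "t \<in> K w"
    have wV: "w \<in> V" using w W_sub by blast
    have "t \<noteq> w" using T(2)[OF t] w by blast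
    have "rmodule V R (K w - {t})"
    proof (rule rmoduleI)
      fix x y v assume *: "x \<in> K w - {t}" "y \<in> K w - {t}" "v \<in> V" "v \<notin> K w - {t}" "R v x"
      show "R v y"
      proof (cases "v = t")
        case True
        then show ?thesis using T(4)[OF t, of x] arc[of x t] * T(1)[OF t] K_sub[OF w] by blast
      next
        case False
        then show ?thesis using * K_in[OF w, of x y v] by blast
      qed
    qed (use K_sub[OF w] in blast)
    moreover obtain c where c: "c \<in> K w" "c \<noteq> w" "R c w" using K_pred[OF w] by blast
    ultimately have "c = t" using K_small[OF w, of "K w - {t}" c w] K_self[OF w] tK \<open>t \<noteq> w\<close> by blast
    then show False using c T(4)[OF t wV] arc[OF wV T(1)[OF t]] \<open>t \<noteq> w\<close> by blast
  qed
  have sT: "s \<notin> T" using T by blast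
  have sW: "s \<notin> W" using Ks K_self by blast
  have X_sub: "X \<subseteq> V" using s T unfolding X_def by blast
  have X_K: "x \<notin> K w" if "x \<in> X" "w \<in> W" for x w using that TK Ks unfolding X_def by blast
  have X_W: "X \<inter> W = {}" using X_K K_self by blast
  have finX: "finite X" using X_sub fin by (rule finite_subset)
  have Vs: "rmodule V R (V - {s})" using source_compl_module s by blast
  have "2 \<le> card (V - {s})" using card n s fin by simp
  then have ntVs: "ntmodule V R (V - {s})" using Vs s unfolding ntmodule_def by blast
  have W_ne: "W \<noteq> {}" using hit[OF ntVs] by blast
  have hitX: "L \<inter> (W \<union> X) \<noteq> {}" if "ntmodule V R L" for L using hit[OF that] unfolding X_def by blast
  \<comment> \<open>A module that contains \<open>s\<close> dominates its complement, which is then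
    a module too. Either the complement is hit, or it is a single vertex, and this vertex is a
    sink.\<close>
  have not_all: "\<not> W \<union> X \<subseteq> L" if L: "ntmodule V R L" for L
  proof
    assume *: "W \<union> X \<subseteq> L"
    have mL: "rmodule V R L" and subL: "L \<subseteq> V" and neL: "L \<noteq> V" using ntmoduleD[OF L] by blast+
    have sL: "s \<in> L" using * unfolding X_def by blast
    have LV: "R x v" if "x \<in> L" "v \<in> V" "v \<notin> L" for x v
      using rmodule_out[OF mL sL that] s(2)[of v] that sL by blast
    have m: "rmodule V R (V - L)"
      by (rule rmoduleI) (use LV in blast)+
    show False
    proof (cases "2 \<le> card (V - L)")
      case True
      then have "ntmodule V R (V - L)" using m sL s unfolding ntmodule_def by blast
      then show False using hitX * by blast
    next
      case False
      obtain v where v: "v \<in> V" "v \<notin> L" using subL neL by blast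
      have "finite (V - L)" using fin by blast
      then have only: "v' = v" if "v' \<in> V - L" for v'
        using False v that by (auto simp: card_le_Suc0_iff_eq not_le less_Suc_eq_le numeral_2_eq_2)
      then have "R y v" if "y \<in> V" "y \<noteq> v" for y using LV[of y v] v that by blast
      then have "v \<in> T \<or> v \<in> W" using v sL unfolding T_def by blast
      then show False using * v unfolding X_def by blast
    qed
  qed
  have card_le: "2 * card W + card X \<le> 4 * n" using card_W_outside[OF X_sub] X_K card by fastforce
  have card_WX: "card (W \<union> X) = card W + card X" using finite_W finX X_W by (intro card_Un_disjoint) blast+
  have trace: "insert a (K b) \<inter> (W \<union> X) = {a, b}" if "a \<in> W \<union> X" "b \<in> W" for a b
    using that K_disj[OF that(2) _ _ K_self] X_K K_self[OF that(2)] by blast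
  have card_T: "card T \<le> 1"
  proof -
    have "finite T" using finX unfolding X_def by simp
    then show ?thesis using T1 by (simp add: card_le_Suc0_iff_eq)
  qed
  have card_X: "card X = Suc (card T)" using sT finX unfolding X_def by simp
  show ?thesis
  proof (cases "card (W \<union> X) \<le> 2 * n")
    case False
    then have c: "card W = 2 * n - 1" "card T = 1"
      using card_WX card_le card_X card_T n by linarith+
    then obtain t where t: "T = {t}" using card_1_singletonE by blast
    have tT: "t \<in> T" using t by blast
    have UK: "card (\<Union>w\<in>W. K w) = (\<Sum>w\<in>W. card (K w))"
      using finite_W K_finite K_disj by (intro card_UN_disjoint) blast+
    have disj: "(\<Union>w\<in>W. K w) \<inter> X = {}" using X_K by blast
    have finU: "finite (\<Union>w\<in>W. K w)" using finite_W K_finite by blast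
    have subU: "(\<Union>w\<in>W. K w) \<union> X \<subseteq> V" using K_sub X_sub by blast
    have cU: "card ((\<Union>w\<in>W. K w) \<union> X) = card (\<Union>w\<in>W. K w) + card X"
      using finU finX disj by (rule card_Un_disjoint)
    have "card (\<Union>w\<in>W. K w) + card X \<le> 4 * n" using card_mono[OF fin subU] cU card by simp
    then have cle: "card (\<Union>w\<in>W. K w) \<le> 2 * card W" using c card_X n by linarith
    have Veq: "V = (\<Union>w\<in>W. K w) \<union> X"
      using card_subset_eq[OF fin subU] cU card_Union_K cle card_X c card n by simp
    have "card (K w) = 2" if w: "w \<in> W" for w
    proof (rule ccontr)
      assume "card (K w) \<noteq> 2"
      then have "(\<Sum>w\<in>W. 2) < (\<Sum>w\<in>W. card (K w))"
        using finite_W K_card w by (intro sum_strict_mono_ex1) (auto intro!: bexI[of _ w] le_neq_trans)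
      then show False using UK cle by simp
    qed
    then have "\<exists>c. K w = {c, w} \<and> c \<noteq> w \<and> R c w" if w: "w \<in> W" for w
    proof -
      obtain c where c: "c \<in> K w" "c \<noteq> w" "R c w" using K_pred[OF w] by blast
      then have "{c, w} \<subseteq> K w" "card {c, w} = 2" using K_self[OF w] by auto
      then have "{c, w} = K w" using card_subset_eq[OF K_finite[OF w]] \<open>\<And>w. w \<in> W \<Longrightarrow> card (K w) = 2\<close>[OF w] by simp
      then show ?thesis using c by blast
    qed
    then obtain f where f: "\<And>w. w \<in> W \<Longrightarrow> K w = {f w, w} \<and> f w \<noteq> w \<and> R (f w) w" by metis
    have fK: "f w \<in> K w" if "w \<in> W" for w using f[OF that] by blast
    have "twin_paired (2 * n - 1) V R"
      unfolding twin_paired_def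
    proof (intro exI conjI)
      show "s \<noteq> t" using T(3)[OF tT] by blast
      show "V = {s, t} \<union> W \<union> f ` W" using Veq f t unfolding X_def by auto
      show "{s, t} \<inter> (W \<union> f ` W) = {}" using X_K[of s] X_K[of t] K_self fK t unfolding X_def by blast
      show "W \<inter> f ` W = {}" using K_disj[OF _ _ K_self fK] f by fastforce
      show "inj_on f W"
      proof (rule inj_onI)
        fix x y assume "x \<in> W" "y \<in> W" "f x = f y"
        then show "x = y" using K_disj[of x y "f x"] fK[of x] fK[of y] by auto
      qed
      show "card W = 2 * n - 1" by (rule c)
      show "\<forall>v\<in>V - {s}. R s v" using s by blast
      show "\<forall>v\<in>V - {t}. R v t" using T(4)[OF tT] by blast
      show "\<forall>w\<in>W. R (f w) w \<and> rmodule V R {f w, w}"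
      proof
        fix w assume w: "w \<in> W"
        show "R (f w) w \<and> rmodule V R {f w, w}" using f[OF w] K_module[OF w] by simp
      qed
    qed
    then show ?thesis ..
  next
    case True
    have card_pos: "1 \<le> card W" using W_ne finite_W by (simp add: Suc_leI card_gt_0_iff)
    consider (m2) "card (W \<union> X) = 2" | (m3) "card (W \<union> X) = 3" | (m4) "4 \<le> card (W \<union> X)"
      using card_WX card_X card_pos by linarith
    then have "prime_by_flips n V R"
    proof cases
      case m4
      have WXV: "W \<union> X \<subseteq> V" using W_sub X_sub by blast
      obtain ES where "crossing_pairing V R (W \<union> X) ES" using crossing_pairing_ex[OF WXV m4] by blast
      then interpret P: crossing_pairing V R "W \<union> X" ES .
      interpret flipped_family V R W K X ES
        by unfold_locales (use P.edge_ends X_sub X_K in blast)+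
      have irr: "\<exists>x y. E x y \<and> x \<in> L \<and> y \<notin> L" if L: "ntmodule V R L" for L
        using P.crossed[OF ntmoduleD(1)[OF L]] hitX[OF L] not_all[OF L] by blast
      \<comment> \<open>The trace of this set is \<open>{a, b}\<close>, which as an edge cannot be
        the trace of a module. This also serves as the \<open>leaf\<close> condition.\<close>
      have J: "\<not> rmodule V R (insert a (K b))" if "a \<in> W \<union> X" "b \<in> W" "E a b" for a b
        using P.trace_not_edge[of "insert a (K b)" a b] trace[OF that(1,2)] that(3) by blast
      have sX: "s \<in> X" unfolding X_def by blast
      have Ts: "rmodule V R (V - {s, t})" if t: "t \<in> T" for t
      proof (rule rmoduleI)
        fix x y v assume *: "x \<in> V - {s, t}" "y \<in> V - {s, t}" "v \<in> V" "v \<notin> V - {s, t}" "R v x"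
        then have "v = s" using T(4)[OF t, of x] arc[of x t] T(1)[OF t] by blast
        then show "R v y" using s * by blast
      qed blast
      \<comment> \<open>Removing \<open>s\<close> and \<open>t\<close> leaves a module, so they are
        not an end of the list and its partner.\<close>
      have st: "\<not> E s t" if t: "t \<in> T" for t
      proof
        assume "E s t"
        then show False using P.leaf_not_near_end[OF Vs, of s t "V - {s, t}"] Ts[OF t] WXV sX by blast
      qed
      obtain b where b: "\<And>y. E s y \<longleftrightarrow> y = b" using P.leaf[OF Vs, of s] WXV sX by blast
      have bW: "b \<in> W" using edge[of s b] b st unfolding X_def by blast
      show ?thesis
      proof (rule prime_by_flipsI[OF P.finite_edges])
        show "card ES \<le> n" using P.card_edges True by linarith
        fix M assume M: "ntmodule V R' M"
        have s_ok: "s \<in> M \<longleftrightarrow> y \<in> M" if "E s y" for y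
        proof -
          have "s \<in> M \<longleftrightarrow> b \<in> M"
            by (rule source_uncrossed[OF M sX s(2)]) (use T bW b J sX in \<open>auto simp: X_def\<close>)
          moreover have "y = b" using that b by blast
          ultimately show ?thesis by simp
        qed
        have t_ok: "t \<in> M \<longleftrightarrow> y \<in> M" if t: "t \<in> T" and e: "E t y" for t y
        proof -
          have tX: "t \<in> X" using t unfolding X_def by blast
          have Vt: "rmodule V R (V - {t})" using sink_compl_module T(1,4)[OF t] by blast
          obtain d where d: "\<And>y. E t y \<longleftrightarrow> y = d" using P.leaf[OF Vt, of t] WXV tX by blast
          have etd: "E t d" using d by blast
          have "d \<noteq> s" using st[OF t] E_sym[OF etd] by blast
          moreover have "d \<notin> T" using edge[OF etd] T1[OF t] by blast
          ultimately have dW: "d \<in> W" using edge[OF etd] unfolding X_def by blast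
          have "t \<in> M \<longleftrightarrow> d \<in> M"
          proof (rule sink_uncrossed[OF M tX T(4)[OF t] _ dW etd])
            fix u v assume "u \<in> X" "u \<noteq> t" "v \<in> V" "v \<noteq> u"
            then show "R u v" using T1[OF t] s unfolding X_def by blast
          next
            fix y assume "E t y" then show "y = d" using d by blast
          next
            show "\<not> rmodule V R (insert t (K d))" using J tX dW etd by blast
            have "{d, t} \<inter> (W \<union> X) = {d, t}" using dW tX by blast
            then show "\<not> rmodule V R {d, t}" using P.trace_not_edge[of "{d, t}" d t] E_sym[OF etd] by blast
            fix x assume x: "x \<in> W" "E x d"
            have "{x, t} \<inter> (W \<union> X) = {x, t}" "x \<noteq> t" using x tX T(2)[OF t] by blast+
            then show "\<not> rmodule V R {x, t}" using P.trace_no_common[of "{x, t}" x t d] x etd by blast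
          qed
          moreover have "y = d" using e d by blast
          ultimately show ?thesis by simp
        qed
        show False
          by (rule no_module_if_extras_uncrossed[OF M irr]) (use J s_ok t_ok X_def in blast)+
      qed
    next
      case m2
      then have "card W = 1" "T = {}" using card_WX card_X card_pos finX unfolding X_def by auto
      then obtain b where W: "W = {b}" using card_1_singletonE by blast
      have X: "X = {s}" using \<open>T = {}\<close> unfolding X_def by blast
      have bW: "b \<in> W" using W by blast
      have sb: "s \<noteq> b" using sW bW by blast
      have subi: "insert s (K b) \<subseteq> V" using K_sub[OF bW] s by blast
      show ?thesis
      proof (cases "rmodule V R (insert s (K b))")
        case m: True
        \<comment> \<open>As a module containing all joined vertices, \<open>insert s (K b)\<close>
          is all of \<open>V\<close>. So \<open>V - {s}\<close> is a minimal module, and a suitable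
          partner of \<open>s\<close>, not necessarily \<open>b\<close>, is found in it by
          counting.\<close>
        have "2 \<le> card (insert s (K b))"
          using K_card[OF bW] card_insert_le[of "K b" s] by linarith
        then have Veq: "V = insert s (K b)"
          using not_all[of "insert s (K b)"] m W X K_self[OF bW] unfolding ntmodule_def by auto
        then have Kb: "K b = V - {s}" using Ks[OF bW] by blast
        have "\<exists>z. \<forall>M. \<not> ntmodule V (flip {{s, z}} R) M"
        proof (rule source_over_prime[OF s])
          fix L x y assume L: "rmodule (V - {s}) R L" "L \<noteq> V - {s}" "x \<in> L" "y \<in> L"
          have "rmodule (K b) R L" using L(1) Kb by simp
          moreover have "L \<subseteq> K b" "L \<noteq> K b" using L(1,2) Kb unfolding rmodule_def by blast+
          ultimately show "x = y" using K_small[OF bW rmodule_trans[OF K_module[OF bW]] _ _ L(3,4)] by blast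
        next
          show "4 \<le> card (V - {s})" using card n s fin by simp
        qed
        then obtain z where "\<forall>M. \<not> ntmodule V (flip {{s, z}} R) M" by blast
        then show ?thesis using n by (intro prime_by_flipsI[of "{{s, z}}"]) auto
      next
        case J: False
        interpret flipped_family V R W K X "{{s, b}}"
          by unfold_locales (use W X sb X_sub X_K in \<open>auto simp: doubleton_eq_iff\<close>)
        have E: "E x y \<longleftrightarrow> x = s \<and> y = b \<or> x = b \<and> y = s" for x y by (auto simp: doubleton_eq_iff)
        show ?thesis
        proof (rule prime_by_flipsI[of "{{s, b}}"])
          fix M assume M: "ntmodule V R' M"
          have s_ok: "s \<in> M \<longleftrightarrow> b \<in> M"
            by (rule source_uncrossed[OF M _ s(2)]) (use X bW E J sb in \<open>auto simp: doubleton_eq_iff\<close>)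
          show False
          proof (rule no_module_if_extras_uncrossed[OF M])
            fix L assume L: "ntmodule V R L"
            show "\<exists>x y. E x y \<and> x \<in> L \<and> y \<notin> L" using hitX[OF L] not_all[OF L] W X unfolding E by auto
          next
            fix a c assume "a \<in> W" "c \<in> W" "E a c"
            then show False using sW unfolding E by blast
          next
            fix x y assume "x \<in> X" "E x y"
            then show "(x \<in> M) = (y \<in> M)" using X s_ok sb unfolding E by blast
          qed
        qed (use n in auto)
      qed
    next
      case m3
      obtain b where bW: "b \<in> W" using W_ne by blast
      have "s \<in> W \<union> X" "b \<in> W \<union> X" "s \<noteq> b" using bW sW unfolding X_def by blast+
      obtain y z where yz: "W \<union> X = {s, y, z}" "s \<noteq> y" "s \<noteq> z" "y \<noteq> z"
        using card3_obtain[OF m3 \<open>s \<in> W \<union> X\<close>] by metis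
      define d where "d = (if b = y then z else y)"
      have WX: "W \<union> X = {s, b, d}" "s \<noteq> d" "b \<noteq> d"
        using yz \<open>b \<in> W \<union> X\<close> \<open>s \<noteq> b\<close> unfolding d_def by auto
      have dT: "d \<in> W \<or> d \<in> T" using WX unfolding X_def by blast
      have d_cond: "d \<in> W \<or> d \<in> X \<and> d \<noteq> s \<and> (\<forall>v\<in>V. v \<noteq> d \<longrightarrow> R v d) \<and> \<not> rmodule V R {b, d}"
      proof (cases "d \<in> W")
        case False
        then have d: "d \<in> T" using dT by blast
        \<comment> \<open>Otherwise \<open>K b\<close> is a pair \<open>{c, b}\<close>. The vertices
          beyond \<open>s\<close>, \<open>b\<close>, \<open>c\<close>, \<open>d\<close> dominate
          \<open>b\<close>, \<open>c\<close> and \<open>d\<close>, so they form a module without any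
          joined vertex.\<close>
        have "\<not> rmodule V R {b, d}"
        proof
          assume m: "rmodule V R {b, d}"
          have dK: "d \<notin> K b" using TK[OF d bW] .
          have "K b - {b, d} = K b - {b}" using dK by blast
          then have "rmodule V R (K b - {b})" using rmodule_Diff[OF K_module[OF bW] m] dK by auto
          then have one: "x = y" if "x \<in> K b" "x \<noteq> b" "y \<in> K b" "y \<noteq> b" for x y
            using K_small[OF bW, of "K b - {b}" x y] K_self[OF bW] that by blast
          obtain c where c: "c \<in> K b" "c \<noteq> b" "R c b" using K_pred[OF bW] by blast
          have Kb: "K b = {c, b}" using one c K_self[OF bW] by blast
          define H where "H = V - {s, b, c, d}"
          have nH: "\<not> R v x" if v: "v \<in> {b, c, d}" and x: "x \<in> H" for v x
          proof -
            have xV: "x \<in> V" "x \<noteq> d" "x \<notin> {b, d}" "x \<notin> K b" using x Kb unfolding H_def by blast+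
            have 1: "\<not> R d x" using T(4)[OF d xV(1,2)] arc[OF xV(1) T(1)[OF d] xV(2)] by blast
            have 2: "R b x = R d x" using rmodule_out[OF m _ _ xV(1,3)] by blast
            have 3: "R c x = R b x" using K_out[OF bW c(1) K_self[OF bW] xV(1,4)] .
            show ?thesis using 1 2 3 v by blast
          qed
          have "rmodule V R H"
          proof (rule rmoduleI)
            fix x y v assume *: "x \<in> H" "y \<in> H" "v \<in> V" "v \<notin> H" "R v x"
            then have "v = s" using nH[of v x] unfolding H_def by blast
            then show "R v y" using s(2)[of y] * unfolding H_def by blast
          qed (auto simp: H_def)
          moreover have "2 \<le> card H"
          proof -
            have "card {s, b, c, d} \<le> 4" by (simp add: card_insert_if)
            then show ?thesis using diff_card_le_card_Diff[of "{s, b, c, d}" V] card n unfolding H_def by auto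
          qed
          moreover have "H \<noteq> V" using s unfolding H_def by blast
          ultimately have "ntmodule V R H" unfolding ntmodule_def by blast
          then show False using hitX[of H] WX unfolding H_def by blast
        qed
        then show ?thesis using d T[OF d] unfolding X_def by blast
      qed blast
      let ?ES = "{{s, b}, {s, d}}"
      interpret flipped_family V R W K X ?ES
        by unfold_locales (use WX \<open>s \<noteq> b\<close> X_sub X_K in \<open>auto simp: doubleton_eq_iff\<close>)
      have E: "E x y \<longleftrightarrow> x = s \<and> (y = b \<or> y = d) \<or> (x = b \<or> x = d) \<and> y = s" for x y
        by (auto simp: doubleton_eq_iff)
      have sX: "s \<in> X" unfolding X_def by blast
      show ?thesis
      proof (rule prime_by_flipsI[of ?ES])
        show "card ?ES \<le> n" using n by (simp add: card_insert_if)
        fix M assume M: "ntmodule V R' M"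
        have ok: "(s \<in> M \<longleftrightarrow> b \<in> M) \<and> (s \<in> M \<longleftrightarrow> d \<in> M)"
          by (rule source_centre_uncrossed[OF M sX s(2) refl bW WX(3) d_cond])
        show False
        proof (rule no_module_if_extras_uncrossed[OF M])
          fix L assume L: "ntmodule V R L"
          have "\<exists>x. x \<in> {s, b, d} \<and> x \<in> L" "\<exists>x. x \<in> {s, b, d} \<and> x \<notin> L"
            using hitX[OF L] not_all[OF L] unfolding WX(1) by blast+
          then show "\<exists>x y. E x y \<and> x \<in> L \<and> y \<notin> L" unfolding E by blast
        next
          fix a c assume "a \<in> W" "c \<in> W" "E a c"
          then show False using sW unfolding E by blast
        next
          fix x y assume "x \<in> X" "E x y"
          then show "(x \<in> M) = (y \<in> M)" using ok unfolding E by blast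
        qed
      qed simp
    qed
    then show ?thesis ..
  qed
qed

section \<open>Tournaments without a source\<close>

lemma flip_empty [simp]: "flip {} R = R"
  by (simp add: flip_def fun_eq_iff)

text \<open>When all representatives lie in one nontrivial module, a vertex outside it has to be
  joined. Maximum size of \<open>M1\<close> makes the quotient by \<open>M1\<close> prime. Without
  source and sink, at least two vertices lie outside \<open>M1\<close>, since a single one would be
  a source or a sink.\<close>

locale outer_module = module_family V R W K for V :: "'a set" and R W K +
  fixes M1 :: "'a set"
  assumes M1: "ntmodule V R M1" "W \<subseteq> M1"
    and M1_max: "ntmodule V R L \<Longrightarrow> W \<subseteq> L \<Longrightarrow> card L \<le> card M1"
    and hit: "ntmodule V R L \<Longrightarrow> L \<inter> W \<noteq> {}"
    and no_source: "s \<in> V \<Longrightarrow> \<exists>v\<in>V. v \<noteq> s \<and> \<not> R s v"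
    and no_sink: "s \<in> V \<Longrightarrow> \<exists>v\<in>V. v \<noteq> s \<and> \<not> R v s"
begin

lemma M1_module: "rmodule V R M1" and M1_sub: "M1 \<subseteq> V" and M1_fin: "finite M1" and M1_neq: "M1 \<noteq> V"
  using ntmoduleD[OF M1(1)] by blast+

lemma W_nonempty: "W \<noteq> {}"
  using hit[OF M1(1)] by blast

lemma absorb:
  assumes "rmodule V R L" "L \<inter> M1 \<noteq> {}" "\<not> L \<subseteq> M1"
  shows "L \<union> M1 = V"
proof (rule ccontr)
  assume "L \<union> M1 \<noteq> V"
  moreover have m: "rmodule V R (L \<union> M1)" using rmodule_Un assms(1,2) M1_module by blast
  moreover have fin': "finite (L \<union> M1)" using rmodule_sub[OF m] fin by (rule finite_subset)
  moreover have less: "card M1 < card (L \<union> M1)" using fin' assms(3) by (intro psubset_card_mono) blast+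
  ultimately have "ntmodule V R (L \<union> M1)" using ntmoduleD(2)[OF M1(1)] unfolding ntmodule_def by linarith
  then show False using M1_max[of "L \<union> M1"] M1(2) less by fastforce
qed

lemma card_outside: "2 \<le> card (V - M1)"
proof (rule ccontr)
  assume n: "\<not> ?thesis"
  obtain s where s: "s \<in> V" "s \<notin> M1" using M1_sub M1_neq by blast
  have "V - M1 \<subseteq> {s}" using n s fin by (auto simp: card_le_Suc0_iff_eq not_le less_Suc_eq_le numeral_2_eq_2)
  then have "M1 = V - {s}" using s M1_sub by blast
  then show False
    using compl_module_source_sink[OF s(1)] M1_module no_source[OF s(1)] no_sink[OF s(1)] by blast
qed

lemma outside_not_module: "\<not> rmodule V R (V - M1)"
proof
  assume "rmodule V R (V - M1)"
  moreover have "V - M1 \<noteq> V" using W_nonempty M1(2) M1_sub by blast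
  ultimately have "ntmodule V R (V - M1)" using card_outside unfolding ntmodule_def by blast
  then show False using hit M1(2) by blast
qed

text \<open>By maximality \<open>L \<union> M1\<close> is \<open>V\<close>. If \<open>L\<close> were
  not \<open>V\<close>, then \<open>L - M1\<close> would be a module, namely the complement of
  \<open>M1\<close>, which \<open>W\<close> does not hit.\<close>

lemma absorb_sub:
  assumes "rmodule V R L" "L \<inter> M1 \<noteq> {}" "\<not> L \<subseteq> M1"
  shows "L = V"
proof (rule ccontr)
  assume "L \<noteq> V"
  have u: "L \<union> M1 = V" by (rule absorb[OF assms])
  then have "\<not> M1 \<subseteq> L" using \<open>L \<noteq> V\<close> by blast
  then have "rmodule V R (L - M1)" using rmodule_Diff[OF assms(1) M1_module] by blast
  moreover have "L - M1 = V - M1" using u by blast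
  ultimately show False using outside_not_module by simp
qed

lemma K_inside: "w \<in> W \<Longrightarrow> K w \<subseteq> M1"
  using absorb_sub[OF K_module] K_neq K_self M1(2) by blast

text \<open>The vertex \<open>y\<close> stands for \<open>M1\<close> contracted to a point. A module
  with two elements that avoids \<open>y\<close> is a module of the whole tournament not hit by
  \<open>W\<close>. One that contains \<open>y\<close> becomes a module of the whole tournament when
  \<open>M1\<close> is added, and \<open>absorb_sub\<close> shows that it was everything.\<close>

lemma quotient_prime:
  assumes y: "y \<in> M1" and L: "rmodule (insert y (V - M1)) R L" "L \<noteq> insert y (V - M1)"
    and u: "u \<in> L" "u' \<in> L"
  shows "u = u'"
proof (rule ccontr)
  assume "u \<noteq> u'"
  have sub: "L \<subseteq> insert y (V - M1)" using L(1) unfolding rmodule_def by blast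
  have yV: "y \<in> V" using y M1_sub by blast
  have subV: "L \<subseteq> V" using sub yV by blast
  have uni: "R v x = R v x'" if "x \<in> L" "x' \<in> L" "v \<in> insert y (V - M1)" "v \<notin> L" for v x x'
    using L(1) that unfolding rmodule_def by blast
  show False
  proof (cases "y \<in> L")
    case False
    have "rmodule V R L"
    proof (rule rmoduleI[OF subV])
      fix x x' v assume *: "x \<in> L" "x' \<in> L" "v \<in> V" "v \<notin> L" "R v x"
      show "R v x'"
      proof (cases "v \<in> M1")
        case True
        have "x \<in> V - M1" "x' \<in> V - M1" using * sub False by blast+
        then have "R v x = R y x" "R v x' = R y x'" using rmodule_out[OF M1_module True y] by blast+
        then show ?thesis using uni[of x x' y] * False by blast
      next
        case False
        then show ?thesis using uni[of x x' v] * by blast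
      qed
    qed
    moreover have "2 \<le> card L"
    proof -
      have "card {u, u'} \<le> card L" using u subV fin by (intro card_mono) (auto intro: finite_subset)
      then show ?thesis using \<open>u \<noteq> u'\<close> by simp
    qed
    moreover have "L \<noteq> V" using False yV by blast
    ultimately have "ntmodule V R L" unfolding ntmodule_def by blast
    then show False using hit[of L] sub False M1(2) by blast
  next
    case True
    have "rmodule V R (L \<union> M1)"
    proof (rule rmoduleI)
      fix x x' v assume *: "x \<in> L \<union> M1" "x' \<in> L \<union> M1" "v \<in> V" "v \<notin> L \<union> M1" "R v x"
      have "R v z = R v y" if "z \<in> L \<union> M1" for z
        using that uni[of z y v] rmodule_in[OF M1_module _ y, of z v] True * by blast
      then show "R v x'" using * by blast
    qed (use subV M1_sub in blast)
    moreover have "\<not> L \<union> M1 \<subseteq> M1"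
    proof
      assume "L \<union> M1 \<subseteq> M1"
      then have "L \<subseteq> {y}" using sub by blast
      then show False using u \<open>u \<noteq> u'\<close> by blast
    qed
    ultimately have "L \<union> M1 = V" using absorb_sub[of "L \<union> M1"] y by blast
    then have "insert y (V - M1) \<subseteq> L" using True by blast
    then show False using L(2) sub by blast
  qed
qed

lemma not_both:
  assumes "ntmodule V R L" "z \<notin> M1" "z \<in> L" shows "\<not> W \<subseteq> L"
  using absorb_sub[of L] ntmoduleD[OF assms(1)] assms M1(2) W_nonempty by blast

lemma crossing_shape:
  assumes ff: "flipped_family V R W K {z} ES" and M: "ntmodule V (flip ES R) M"
    and z: "z \<notin> M1" "\<And>y. {z, y} \<in> ES \<longleftrightarrow> y = b" "b \<in> W"
    and cross: "(z \<in> M) \<noteq> (b \<in> M)"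
  shows "(\<forall>y. {b, y} \<in> ES \<longrightarrow> y = z) \<and> (\<forall>y\<in>M1 - {b}. R y b) \<and>
    ((R b z \<and> (\<forall>u\<in>V - M1 - {z}. R u b)) \<or>
     (\<exists>u\<in>V - M1 - {z}. R b u \<and> (R z u \<longleftrightarrow> \<not> R z b) \<and> (\<forall>v\<in>V - M1 - {u, z}. R v u \<longleftrightarrow> R v b)))"
proof -
  interpret flipped_family V R W K "{z}" ES by (rule ff)
  show ?thesis
  proof (rule outside_crossed[OF M refl z(3) _ _ M1_module _ z(1) card_outside _ cross])
    show "E z b" using z(2) by blast
    show "y = b" if "E z y" for y using z(2) that by blast
    show "K w \<subseteq> M1" if "w \<in> W" for w by (rule K_inside[OF that])
    show "u = u'" if "y \<in> M1" "rmodule (insert y (V - M1)) R L" "L \<noteq> insert y (V - M1)" "u \<in> L" "u' \<in> L"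
      for y L u u' by (rule quotient_prime[OF that])
  qed
qed

text \<open>It is applied in two ways: \<open>b\<close> has a neighbour other than \<open>z\<close>,
  or \<open>b\<close> is not the sink of \<open>M1\<close>.\<close>

lemma outside_uncrossed:
  assumes "flipped_family V R W K {z} ES" "ntmodule V (flip ES R) M"
    and "z \<notin> M1" "\<And>y. {z, y} \<in> ES \<longleftrightarrow> y = b" "b \<in> W"
    and "\<not> ((\<forall>y. {b, y} \<in> ES \<longrightarrow> y = z) \<and> (\<forall>y\<in>M1 - {b}. R y b))"
  shows "z \<in> M \<longleftrightarrow> b \<in> M"
  using crossing_shape[OF assms(1-5)] assms(6) by blast

text \<open>A fixed \<open>z\<close> may fail here. By \<open>crossing_shape\<close> a failing
  \<open>z\<close> is the only out-neighbour of \<open>b\<close> outside \<open>M1\<close>, or else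
  \<open>b\<close> has an out-neighbour \<open>u\<close> outside \<open>M1\<close> such that, of the
  other vertices there, \<open>z\<close> alone tells \<open>u\<close> from \<open>b\<close>. If the
  first happens for some \<open>z0\<close>, then \<open>u = z0\<close> for all other
  \<open>z\<close>, and two of these contradict each other. Otherwise \<open>u\<close> determines
  \<open>z\<close>, so by counting every outer vertex occurs as \<open>u\<close>; then
  \<open>b\<close>, and with it \<open>c\<close>, dominates all of them, and \<open>c\<close> is a
  source.\<close>

lemma twin_quotient:
  assumes b: "W = {b}" "M1 = K b" "K b = {c, b}" "c \<noteq> b" "R c b" and card: "3 \<le> card (V - M1)"
  shows "\<exists>z. \<forall>M. \<not> ntmodule V (flip {{z, b}} R) M"
proof (rule ccontr)
  assume n: "\<not> ?thesis"
  let ?U = "V - M1"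
  have bW: "b \<in> W" using b by blast
  have bM1: "b \<in> M1" "c \<in> M1" using b by blast+
  have bV: "b \<in> V" "c \<in> V" using bM1 M1_sub by blast+
  have bad: "(R b z \<and> (\<forall>u\<in>?U - {z}. R u b)) \<or>
      (\<exists>u\<in>?U - {z}. R b u \<and> (R z u \<longleftrightarrow> \<not> R z b) \<and> (\<forall>v\<in>?U - {u, z}. R v u \<longleftrightarrow> R v b))" if z: "z \<in> ?U" for z
  proof -
    have zb: "z \<noteq> b" using z bM1 by blast
    have ff: "flipped_family V R W K {z} {{z, b}}"
      by unfold_locales (use b z zb in \<open>auto simp: doubleton_eq_iff\<close>)
    interpret flipped_family V R W K "{z}" "{{z, b}}" by (rule ff)
    have E: "E x y \<longleftrightarrow> x = z \<and> y = b \<or> x = b \<and> y = z" for x y by (auto simp: doubleton_eq_iff)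
    obtain M where M: "ntmodule V R' M" using n by blast
    have cross: "(z \<in> M) \<noteq> (b \<in> M)"
    proof (rule ccontr)
      assume same: "\<not> ?thesis"
      show False
      proof (rule no_module_if_extras_uncrossed[OF M])
        fix L assume L: "ntmodule V R L"
        have "b \<in> L" using hit[OF L] b by blast
        moreover have "z \<notin> L" using not_both[OF L, of z] z b \<open>b \<in> L\<close> by blast
        ultimately show "\<exists>x y. E x y \<and> x \<in> L \<and> y \<notin> L" unfolding E by blast
      next
        fix x y assume "x \<in> W" "y \<in> W" "E x y"
        then show False using b zb unfolding E by blast
      next
        fix x y assume "x \<in> {z}" "E x y"
        then show "(x \<in> M) = (y \<in> M)" using same zb unfolding E by blast
      qed
    qed
    have Ez: "E z y \<longleftrightarrow> y = b" for y unfolding E using zb by blast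
    have "z \<notin> M1" using z by blast
    from crossing_shape[OF ff M this Ez bW cross] show ?thesis by blast
  qed
  show False
  proof (cases "\<exists>z0\<in>?U. R b z0 \<and> (\<forall>u\<in>?U - {z0}. R u b)")
    case True
    then obtain z0 where z0: "z0 \<in> ?U" "R b z0" "\<And>u. u \<in> ?U \<Longrightarrow> u \<noteq> z0 \<Longrightarrow> R u b" by blast
    have nb: "\<not> R b u" if "u \<in> ?U" "u \<noteq> z0" for u using z0(3)[OF that] arc[of u b] that bV bM1 by blast
    have "2 \<le> card (?U - {z0})" using card z0(1) fin by simp
    then obtain z1 z2 where z12: "z1 \<in> ?U - {z0}" "z2 \<in> ?U - {z0}" "z1 \<noteq> z2" using card_ge2_obtain by metis
    have sol: "(R z z0 \<longleftrightarrow> \<not> R z b) \<and> (\<forall>v\<in>?U - {z0, z}. R v z0 \<longleftrightarrow> R v b)" if z: "z \<in> ?U - {z0}" for z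
    proof -
      obtain u where u: "u \<in> ?U - {z}" "R b u" "R z u \<longleftrightarrow> \<not> R z b" "\<forall>v\<in>?U - {u, z}. R v u \<longleftrightarrow> R v b"
        using bad[of z] nb[of z] z by blast
      then have "u = z0" using nb by blast
      then show ?thesis using u by blast
    qed
    show False using sol[OF z12(1)] sol[OF z12(2)] z12 by blast
  next
    case False
    then have "\<exists>u\<in>?U - {z}. R b u \<and> (R z u \<longleftrightarrow> \<not> R z b) \<and> (\<forall>v\<in>?U - {u, z}. R v u \<longleftrightarrow> R v b)" if "z \<in> ?U" for z
      using bad[OF that] that by blast
    then obtain f where f: "\<And>z. z \<in> ?U \<Longrightarrow> f z \<in> ?U - {z} \<and> R b (f z) \<and> (R z (f z) \<longleftrightarrow> \<not> R z b) \<and>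
        (\<forall>v\<in>?U - {f z, z}. R v (f z) \<longleftrightarrow> R v b)" by metis
    have inj: "inj_on f ?U"
    proof (rule inj_onI, rule ccontr)
      fix x y assume *: "x \<in> ?U" "y \<in> ?U" "f x = f y" "x \<noteq> y"
      have "y \<in> ?U - {f x, x}" using * f[OF *(2)] by auto
      then have "R y (f x) \<longleftrightarrow> R y b" using f[OF *(1)] by blast
      then show False using f[OF *(2)] *(3) by auto
    qed
    have "f ` ?U \<subseteq> ?U" using f by blast
    then have surj: "f ` ?U = ?U" using inj fin endo_inj_surj by blast
    have bU: "R b u" if u: "u \<in> ?U" for u
    proof -
      obtain z where "z \<in> ?U" "u = f z" using u surj by blast
      then show ?thesis using f by blast
    qed
    have "R c v" if v: "v \<in> V" "v \<noteq> c" for v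
    proof (cases "v = b")
      case True then show ?thesis using b by simp
    next
      case False
      then have "v \<in> ?U" using b v by blast
      then show ?thesis using bU rmodule_out[OF M1_module bM1, of v] by blast
    qed
    then show False using no_source[OF bV(2)] by blast
  qed
qed

theorem prime_by_flips_outer:
  assumes card: "card V = 4 * n" and n: "2 \<le> n"
  shows "prime_by_flips n V R"
proof -
  have "K w \<inter> (V - M1) = {}" if "w \<in> W" for w using K_inside[OF that] by blast
  then have "2 * card W + card (V - M1) \<le> 4 * n" using card_W_outside[of "V - M1"] card by auto
  then have cW: "card W + 1 \<le> 2 * n" using card_outside by linarith
  have cW1: "1 \<le> card W" using W_nonempty finite_W by (simp add: Suc_leI card_gt_0_iff)
  obtain z where z: "z \<in> V" "z \<notin> M1" using M1_sub M1_neq by blast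
  have zW: "z \<notin> W" "{z} \<subseteq> V" using z M1(2) by blast+
  have zK: "x \<notin> K w" if "x \<in> {z}" "w \<in> W" for x w using K_inside[OF that(2)] that z by blast
  have card_zW: "card (W \<union> {z}) = card W + 1" using finite_W zW by simp
  consider (r1) "card W = 1" | (r2) "card W = 2" | (r3) "3 \<le> card W" using cW1 by linarith
  then show ?thesis
  proof cases
    case r3
    have sub: "W \<union> {z} \<subseteq> V" and c4: "4 \<le> card (W \<union> {z})" using W_sub z card_zW r3 by auto
    let ?W = "W \<union> {z}"
    obtain ES where "crossing_pairing V R ?W ES" using crossing_pairing_ex[OF sub c4] by blast
    then interpret P: crossing_pairing V R ?W ES .
    have ff: "flipped_family V R W K {z} ES"
      by unfold_locales (use P.edge_ends zW zK in blast)+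
    interpret flipped_family V R W K "{z}" ES by (rule ff)
    have tr: "M1 \<inter> ?W = ?W - {z}" using M1(2) z by blast
    obtain b where b: "\<And>y. E z y \<longleftrightarrow> y = b" using P.leaf[OF M1_module _ tr] by blast
    have Ezb: "E z b" using b by blast
    have bW: "b \<in> W" using edge[OF Ezb] by blast
    show ?thesis
    proof (rule prime_by_flipsI[OF P.finite_edges])
      show "card ES \<le> n" using P.card_edges cW card_zW by linarith
      fix M assume M: "ntmodule V R' M"
      \<comment> \<open>If \<open>b\<close> were the sink of \<open>M1\<close>, then
        \<open>M1 - {b}\<close> would be a module whose trace lacks exactly the end \<open>z\<close>
        and its partner \<open>b\<close>.\<close>
      have nb: "\<not> (\<forall>y\<in>M1 - {b}. R y b)"
      proof
        assume sink: "\<forall>y\<in>M1 - {b}. R y b"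
        have "rmodule V R (M1 - {b})"
        proof (rule rmoduleI)
          fix x y v assume *: "x \<in> M1 - {b}" "y \<in> M1 - {b}" "v \<in> V" "v \<notin> M1 - {b}" "R v x"
          then have "v \<noteq> b" using sink arc[of x b] M1_sub by blast
          then show "R v y" using * rmodule_in[OF M1_module, of x y v] by blast
        qed (use M1_sub in blast)
        moreover have "(M1 - {b}) \<inter> ?W = ?W - {z, b}" using M1(2) z by blast
        ultimately show False using P.leaf_not_near_end[OF M1_module _ tr Ezb] by blast
      qed
      have zb: "z \<in> M \<longleftrightarrow> b \<in> M"
        by (rule outside_uncrossed[OF ff M z(2) b bW]) (use nb in blast)
      show False
      proof (rule no_module_if_extras_uncrossed[OF M])
        fix L assume L: "ntmodule V R L"
        obtain x where x: "x \<in> ?W" "x \<in> L" using hit[OF L] by blast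
        obtain y where y: "y \<in> ?W" "y \<notin> L" using not_both[OF L z(2)] by blast
        show "\<exists>x y. E x y \<and> x \<in> L \<and> y \<notin> L" by (rule P.crossed[OF ntmoduleD(1)[OF L] x y])
      next
        fix a d assume ad: "a \<in> W" "d \<in> W" "E a d" "rmodule V R (insert a (K d))"
        have "insert a (K d) \<inter> ?W = {a, d}" using ad(1,2) K_disj[OF ad(2) _ _ K_self] zK K_self[OF ad(2)] zW by blast
        then show False using P.trace_not_edge[OF ad(4)] ad(3) by blast
      next
        fix x y assume "x \<in> {z}" "E x y"
        then have "x = z" "y = b" using b by blast+
        then show "(x \<in> M) = (y \<in> M)" using zb by simp
      qed
    qed
  next
    case r2
    then obtain w1 w2 where w: "W = {w1, w2}" "w1 \<noteq> w2" unfolding card_2_iff by blast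
    let ?big = "\<lambda>w. \<exists>c\<in>K w. c \<noteq> w \<and> \<not> R c w"
    \<comment> \<open>On the path \<open>z\<close>, \<open>b\<close>, \<open>d\<close> the leaf
      \<open>d\<close> is a problem only if \<open>b\<close> is not the sink of \<open>K b\<close>.
      The choice ensures that \<open>d\<close> is not the sink of \<open>K d\<close> in that case,
      as \<open>insert_K_not_module\<close> requires.\<close>
    define b where "b = (if ?big w1 then w2 else w1)"
    define d where "d = (if ?big w1 then w1 else w2)"
    have bd: "W = {b, d}" "b \<noteq> d" "?big b \<Longrightarrow> ?big d" using w unfolding b_def d_def by (auto split: if_splits)
    let ?ES = "{{z, b}, {b, d}}"
    have zbd: "z \<noteq> b" "z \<noteq> d" using zW bd by blast+
    have ff: "flipped_family V R W K {z} ?ES"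
      by unfold_locales (use bd zbd zW zK in \<open>auto simp: doubleton_eq_iff\<close>)
    interpret flipped_family V R W K "{z}" ?ES by (rule ff)
    have E: "E x y \<longleftrightarrow> x = b \<and> (y = z \<or> y = d) \<or> (x = z \<or> x = d) \<and> y = b" for x y
      by (auto simp: doubleton_eq_iff)
    show ?thesis
    proof (rule prime_by_flipsI[of ?ES])
      show "card ?ES \<le> n" using n by (simp add: card_insert_if)
      fix M assume M: "ntmodule V R' M"
      have Ez: "E z y \<longleftrightarrow> y = b" for y unfolding E using zbd by blast
      have Ebd: "E b d" unfolding E by blast
      have bW: "b \<in> W" "d \<in> W" using bd by blast+
      have zb: "z \<in> M \<longleftrightarrow> b \<in> M"
        by (rule outside_uncrossed[OF ff M z(2) Ez bW(1)]) (use Ebd zbd in blast)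
      show False
      proof (rule no_module_if_extras_uncrossed[OF M])
        fix L assume L: "ntmodule V R L"
        have "\<exists>x. x \<in> {z, b, d} \<and> x \<in> L" "\<exists>x. x \<in> {z, b, d} \<and> x \<notin> L"
          using hit[OF L] not_both[OF L z(2)] bd(1) by blast+
        then show "\<exists>x y. E x y \<and> x \<in> L \<and> y \<notin> L" unfolding E by blast
      next
        fix a e assume ae: "a \<in> W" "e \<in> W" "E a e" "\<And>y. E a y \<Longrightarrow> y = e" "?big e" "rmodule V R (insert a (K e))"
        have "a \<noteq> b"
        proof
          assume "a = b"
          then have "z = e" "d = e" using ae(4)[of z] ae(4)[of d] unfolding E by blast+
          then show False using zbd by blast
        qed
        then have "a = d" "e = b" using ae(1,3) bd(1) unfolding E by blast+
        then show False using insert_K_not_module[OF bW(2) _ bW(1)] ae(5,6) bd(2,3) by blast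
      next
        fix x y assume "x \<in> {z}" "E x y"
        then have "x = z" "y = b" using Ez by blast+
        then show "(x \<in> M) = (y \<in> M)" using zb by simp
      qed
    qed simp
  next
    case r1
    then obtain b where b: "W = {b}" using card_1_singletonE by blast
    have bW: "b \<in> W" using b by blast
    have bM1: "b \<in> M1" using M1(2) b by blast
    show ?thesis
    proof (cases "\<forall>y\<in>M1 - {b}. R y b")
      case False
      have zb: "z \<noteq> b" using zW b by blast
      have ff: "flipped_family V R W K {z} {{z, b}}"
        by unfold_locales (use b zb zW zK in \<open>auto simp: doubleton_eq_iff\<close>)
      interpret flipped_family V R W K "{z}" "{{z, b}}" by (rule ff)
      have E: "E x y \<longleftrightarrow> x = z \<and> y = b \<or> x = b \<and> y = z" for x y by (auto simp: doubleton_eq_iff)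
      show ?thesis
      proof (rule prime_by_flipsI[of "{{z, b}}"])
        fix M assume M: "ntmodule V R' M"
        have Ez: "E z y \<longleftrightarrow> y = b" for y unfolding E using zb by blast
        have same: "z \<in> M \<longleftrightarrow> b \<in> M"
          by (rule outside_uncrossed[OF ff M z(2) Ez bW]) (use False in blast)
        show False
        proof (rule no_module_if_extras_uncrossed[OF M])
          fix L assume L: "ntmodule V R L"
          have "b \<in> L" using hit[OF L] b by blast
          moreover have "z \<notin> L" using not_both[OF L z(2)] b \<open>b \<in> L\<close> by blast
          ultimately show "\<exists>x y. E x y \<and> x \<in> L \<and> y \<notin> L" unfolding E by blast
        next
          fix x y assume "x \<in> W" "y \<in> W" "E x y"
          then show False using b zb unfolding E by blast
        next
          fix x y assume "x \<in> {z}" "E x y"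
          then show "(x \<in> M) = (y \<in> M)" using same zb unfolding E by blast
        qed
      qed (use n in auto)
    next
      case sink: True
      have KM: "K b \<subseteq> M1" by (rule K_inside[OF bW])
      have bK: "b \<in> K b" by (rule K_self[OF bW])
      have bV: "b \<in> V" using bW W_sub by blast
      obtain c where c: "K b = {c, b}" "c \<noteq> b" "R c b" using K_pair[OF bW] sink KM by blast
      have cV: "c \<in> V" "c \<in> M1" using c KM M1_sub by blast+
      have nR: "\<not> R v x" if "x \<in> M1" "x \<notin> K b" "v \<in> K b" for x v
      proof -
        have xV: "x \<in> V" "x \<noteq> b" using that M1_sub bK by blast+
        have "R x b" using sink that(1) xV by blast
        then have "\<not> R b x" using arc[OF xV(1) bV xV(2)] by blast
        then show ?thesis using K_out[OF bW that(3) bK xV(1) that(2)] by blast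
      qed
      \<comment> \<open>\<open>M1\<close> is reduced to the pair \<open>K b\<close>, because further
        vertices would yield a module without \<open>b\<close>: either \<open>M1 - K b\<close>, or
        \<open>{h, c}\<close> if only one vertex \<open>h\<close> is left.\<close>
      have one: "x = y" if "x \<in> M1 - K b" "y \<in> M1 - K b" for x y
      proof (rule ccontr)
        assume "x \<noteq> y"
        have "rmodule V R (M1 - K b)"
        proof (rule rmoduleI)
          fix x y v assume *: "x \<in> M1 - K b" "y \<in> M1 - K b" "v \<in> V" "v \<notin> M1 - K b" "R v x"
          then show "R v y" using nR[of x v] rmodule_in[OF M1_module, of x y v] by blast
        qed (use M1_sub in blast)
        moreover have "card {x, y} \<le> card (M1 - K b)" using that M1_fin by (intro card_mono) auto
        moreover have "M1 - K b \<noteq> V" using bK bV by blast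
        ultimately have "ntmodule V R (M1 - K b)" using \<open>x \<noteq> y\<close> unfolding ntmodule_def by simp
        then show False using hit[of "M1 - K b"] b bK by blast
      qed
      have "M1 = K b"
      proof (rule ccontr)
        assume "M1 \<noteq> K b"
        then obtain h where h: "h \<in> M1" "h \<notin> K b" using KM by blast
        have M1eq: "M1 = {h, c, b}" using one[of _ h] h KM c by blast
        have hV: "h \<in> V" using h M1_sub by blast
        have hc: "h \<noteq> c" "h \<noteq> b" using h c by blast+
        have "rmodule V R {h, c}"
        proof (rule rmoduleI)
          fix x y v assume *: "x \<in> {h, c}" "y \<in> {h, c}" "v \<in> V" "v \<notin> {h, c}" "R v x"
          have "v \<noteq> b"
          proof
            assume "v = b"
            then show False using * sink arc[of x b] bV hV cV hc c h by blast
          qed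
          then have "v \<notin> M1" using M1eq * by blast
          then show "R v y" using rmodule_in[OF M1_module, of x y v] * h cV by blast
        qed (use hV cV in blast)
        moreover have "{h, c} \<noteq> V" using bV hc c(2) by blast
        ultimately have "ntmodule V R {h, c}" using hc unfolding ntmodule_def by simp
        then show False using hit[of "{h, c}"] b hc c(2) by blast
      qed
      have "card (V - M1) = 4 * n - 2"
        using card card_Diff_subset[OF M1_fin M1_sub] \<open>M1 = K b\<close> c by simp
      then have "3 \<le> card (V - M1)" using n by linarith
      from twin_quotient[OF b \<open>M1 = K b\<close> c this]
      obtain z where "\<forall>M. \<not> ntmodule V (flip {{z, b}} R) M" by blast
      then show ?thesis using n by (intro prime_by_flipsI[of "{{z, b}}"]) auto
    qed
  qed
qed

end

text \<open>If no nontrivial module contains all representatives, joining them among themselves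
  suffices, and \<open>X\<close> is empty; at most \<open>2 * n\<close> of them exist, as each takes
  up two vertices.\<close>

theorem (in rel_tournament) prime_by_flips_no_source_sink:
  assumes no_source: "\<And>s. s \<in> V \<Longrightarrow> \<exists>v\<in>V. v \<noteq> s \<and> \<not> R s v"
    and no_sink: "\<And>s. s \<in> V \<Longrightarrow> \<exists>v\<in>V. v \<noteq> s \<and> \<not> R v s"
    and card: "card V = 4 * n" and n: "2 \<le> n"
  shows "prime_by_flips n V R"
proof -
  have "\<exists>W K. module_family V R W K \<and> (\<forall>w\<in>W. K w \<inter> {} = {}) \<and>
      (\<forall>L. ntmodule V R L \<longrightarrow> L \<inter> (W \<union> {}) \<noteq> {})"
    by (rule module_family_ex) auto
  then obtain W K where fam: "module_family V R W K"
    and hit: "\<And>L. ntmodule V R L \<Longrightarrow> L \<inter> W \<noteq> {}" by auto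
  interpret module_family V R W K by (rule fam)
  show ?thesis
  proof (cases "\<exists>L. ntmodule V R L \<and> W \<subseteq> L")
    case True
    let ?P = "\<lambda>L. ntmodule V R L \<and> W \<subseteq> L"
    have "card L < Suc (card V)" if "?P L" for L
      using card_mono[OF fin, of L] ntmoduleD(4)[of L] that by auto
    then obtain M1 where "?P M1" "\<And>L. ?P L \<Longrightarrow> card L \<le> card M1"
      using ex_has_greatest_nat[of ?P _ card "Suc (card V)"] True by (metis less_imp_le)
    then interpret outer_module V R W K M1
      by unfold_locales (use hit no_source no_sink in blast)+
    show ?thesis by (rule prime_by_flips_outer[OF card n])
  next
    case nall: False
    have cW: "card W \<le> 2 * n" using card_W_outside[of "{}"] card by simp
    \<comment> \<open>With two representatives this module would contain both; it is proper because
      it misses the rest of \<open>K a\<close>.\<close>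
    have leafcond: "\<not> rmodule V R (insert a (K b))" if ab: "a \<in> W" "b \<in> W" "a \<noteq> b" "W = {a, b}" for a b
    proof
      assume m: "rmodule V R (insert a (K b))"
      obtain c where c: "c \<in> K a" "c \<noteq> a" using K_pred[OF ab(1)] by blast
      have "c \<notin> insert a (K b)" using K_disj[OF ab(1,2) c(1)] c(2) ab(3) by blast
      moreover have "c \<in> V" using c K_sub[OF ab(1)] by blast
      moreover have "2 \<le> card (insert a (K b))" using K_card[OF ab(2)] card_insert_le[of "K b" a] by linarith
      ultimately have "ntmodule V R (insert a (K b))" using m unfolding ntmodule_def by blast
      then show False using nall ab(4) K_self[OF ab(2)] by blast
    qed
    consider (r0) "card W = 0" | (r1) "card W = 1" | (r2) "card W = 2" | (r3) "card W = 3" | (r4) "4 \<le> card W"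
      by linarith
    then show ?thesis
    proof cases
      case r0
      then have "W = {}" using finite_W by simp
      then have "\<not> ntmodule V R L" for L using hit by blast
      then show ?thesis by (intro prime_by_flipsI[of "{}"]) auto
    next
      case r1
      then obtain b where "W = {b}" using card_1_singletonE by blast
      then show ?thesis using nall K_ntmodule[of b] K_self[of b] by blast
    next
      case r2
      then obtain a b where w: "W = {a, b}" "a \<noteq> b" unfolding card_2_iff by blast
      interpret flipped_family V R W K "{}" "{{a, b}}"
        by unfold_locales (use w in \<open>auto simp: doubleton_eq_iff\<close>)
      have E: "E x y \<longleftrightarrow> x = a \<and> y = b \<or> x = b \<and> y = a" for x y by (auto simp: doubleton_eq_iff)
      show ?thesis
      proof (rule prime_by_flipsI[of "{{a, b}}"])
        fix M assume M: "ntmodule V R' M"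
        show False
        proof (rule no_module_if_extras_uncrossed[OF M])
          fix L assume L: "ntmodule V R L"
          have "\<not> W \<subseteq> L" using nall L by blast
          then show "\<exists>x y. E x y \<and> x \<in> L \<and> y \<notin> L" using hit[OF L] w unfolding E by blast
        next
          fix x y assume "x \<in> W" "y \<in> W" "E x y" "rmodule V R (insert x (K y))"
          then show False using leafcond[of x y] w unfolding E by blast
        qed blast
      qed (use n in auto)
    next
      case r3
      let ?big = "\<lambda>w. \<exists>c\<in>K w. c \<noteq> w \<and> \<not> R c w"
      \<comment> \<open>The middle vertex \<open>q\<close> is chosen so that, if it is not the sink
        of its own set, the same holds for both leaves. Then \<open>insert_K_not_module\<close>
        excludes crossings at the leaves.\<close>
      have "\<exists>q\<in>W. ?big q \<longrightarrow> (\<forall>w\<in>W. ?big w)"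
      proof (cases "\<forall>w\<in>W. ?big w")
        case True
        have "W \<noteq> {}" using r3 by auto
        then show ?thesis using True by blast
      qed blast
      then obtain q where q: "q \<in> W" "?big q \<Longrightarrow> \<forall>w\<in>W. ?big w" by blast
      obtain x y where w: "W = {q, x, y}" "q \<noteq> x" "q \<noteq> y" "x \<noteq> y" by (rule card3_obtain[OF r3 q(1)])
      let ?ES = "{{q, x}, {q, y}}"
      interpret flipped_family V R W K "{}" ?ES
        by unfold_locales (use w in \<open>auto simp: doubleton_eq_iff\<close>)
      have E: "E u v \<longleftrightarrow> u = q \<and> (v = x \<or> v = y) \<or> (u = x \<or> u = y) \<and> v = q" for u v
        by (auto simp: doubleton_eq_iff)
      show ?thesis
      proof (rule prime_by_flipsI[of ?ES])
        show "card ?ES \<le> n" using n by (simp add: card_insert_if)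
        fix M assume M: "ntmodule V R' M"
        show False
        proof (rule no_module_if_extras_uncrossed[OF M])
          fix L assume L: "ntmodule V R L"
          have "\<not> W \<subseteq> L" using nall L by blast
          then have "\<exists>u. u \<in> {q, x, y} \<and> u \<in> L" "\<exists>u. u \<in> {q, x, y} \<and> u \<notin> L"
            using hit[OF L] w(1) by blast+
          then show "\<exists>x y. E x y \<and> x \<in> L \<and> y \<notin> L" unfolding E by blast
        next
          fix a e assume ae: "a \<in> W" "e \<in> W" "E a e" "\<And>u. E a u \<Longrightarrow> u = e" "?big e" "rmodule V R (insert a (K e))"
          have "a \<noteq> q"
          proof
            assume "a = q"
            then have "x = e" "y = e" using ae(4)[of x] ae(4)[of y] unfolding E by blast+
            then show False using w by blast
          qed
          then have "e = q" using ae(3) unfolding E by blast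
          then have "?big a" using q(2) ae(1,5) by blast
          then show False using insert_K_not_module[OF ae(1) _ ae(2)] ae(6) \<open>a \<noteq> q\<close> \<open>e = q\<close> by blast
        qed blast
      qed simp
    next
      case r4
      obtain ES where "crossing_pairing V R W ES" using crossing_pairing_ex[OF W_sub r4] by blast
      then interpret P: crossing_pairing V R W ES .
      interpret flipped_family V R W K "{}" ES
        by unfold_locales (use P.edge_ends in blast)+
      show ?thesis
      proof (rule prime_by_flipsI[OF P.finite_edges])
        show "card ES \<le> n" using P.card_edges cW by linarith
        fix M assume M: "ntmodule V R' M"
        show False
        proof (rule no_module_if_extras_uncrossed[OF M])
          fix L assume L: "ntmodule V R L"
          obtain x where x: "x \<in> W" "x \<in> L" using hit[OF L] by blast
          obtain y where y: "y \<in> W" "y \<notin> L" using nall L by blast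
          show "\<exists>x y. E x y \<and> x \<in> L \<and> y \<notin> L" by (rule P.crossed[OF ntmoduleD(1)[OF L] x y])
        next
          fix a d assume ad: "a \<in> W" "d \<in> W" "E a d" "rmodule V R (insert a (K d))"
          have "insert a (K d) \<inter> W = {a, d}" using ad(1,2) K_disj[OF ad(2) _ _ K_self] K_self[OF ad(2)] by blast
          then show False using P.trace_not_edge[OF ad(4)] ad(3) by blast
        qed blast
      qed
    qed
  qed
qed

text \<open>Sources and sinks are not interchangeable in the construction, because pairs are
  represented by their sinks. A tournament with a sink and no source is replaced by its converse,
  which has a source; the converse has no sink and thus is not \<open>twin_paired\<close>.\<close>

theorem prime_by_flips_or_twin_paired:
  assumes T: "rel_tournament V R" and card: "card V = 4 * n" and n: "2 \<le> n"
  shows "prime_by_flips n V R \<or> twin_paired (2 * n - 1) V R"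
proof -
  interpret rel_tournament V R by fact
  have sink_sub: "prime_by_flips n V R" if t: "t \<in> V" "\<And>v. v \<in> V \<Longrightarrow> v \<noteq> t \<Longrightarrow> R v t"
    and ns: "\<And>s. s \<in> V \<Longrightarrow> \<exists>v\<in>V. v \<noteq> s \<and> \<not> R s v" for t
  proof -
    interpret C: rel_tournament V "\<lambda>x y. R y x" by (rule rel_tournament_converse[OF T])
    have "prime_by_flips n V (\<lambda>x y. R y x) \<or> twin_paired (2 * n - 1) V (\<lambda>x y. R y x)"
      by (rule C.source_dichotomy[OF t(1) _ card n]) (use t(2) in blast)
    moreover have "\<not> twin_paired (2 * n - 1) V (\<lambda>x y. R y x)"
    proof
      assume "twin_paired (2 * n - 1) V (\<lambda>x y. R y x)"
      then obtain s where "s \<in> V" "\<forall>v\<in>V - {s}. R s v" unfolding twin_paired_def by blast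
      then show False using ns[of s] by blast
    qed
    ultimately obtain ES where ES: "finite ES" "card ES \<le> n" "\<forall>M. \<not> ntmodule V (flip ES (\<lambda>x y. R y x)) M"
      unfolding prime_by_flips_def by blast
    have "rmodule V (\<lambda>x y. flip ES R y x) M \<longleftrightarrow> rmodule V (flip ES R) M" for M
    proof (rule rmodule_converse)
      fix x y assume "x \<in> V" "y \<in> V" "x \<noteq> y"
      from arc[OF this] show "flip ES R x y \<longleftrightarrow> \<not> flip ES R y x" by (auto simp: flip_def insert_commute)
    qed
    then have "\<not> ntmodule V (flip ES R) M" for M
      using ES(3)[rule_format, of M] unfolding ntmodule_def by (simp add: flip_converse[of ES R])
    then show ?thesis using ES(1,2) by (intro prime_by_flipsI[of ES]) blast+
  qed
  consider (src) s where "s \<in> V" "\<And>v. v \<in> V \<Longrightarrow> v \<noteq> s \<Longrightarrow> R s v"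
    | (snk) t where "t \<in> V" "\<And>v. v \<in> V \<Longrightarrow> v \<noteq> t \<Longrightarrow> R v t" "\<And>s. s \<in> V \<Longrightarrow> \<exists>v\<in>V. v \<noteq> s \<and> \<not> R s v"
    | (none) "\<And>s. s \<in> V \<Longrightarrow> \<exists>v\<in>V. v \<noteq> s \<and> \<not> R s v" "\<And>s. s \<in> V \<Longrightarrow> \<exists>v\<in>V. v \<noteq> s \<and> \<not> R v s"
    by blast
  then show ?thesis
  proof cases
    case src then show ?thesis using source_dichotomy[OF _ _ card n] by blast
  next
    case snk then show ?thesis using sink_sub by blast
  next
    case none then show ?thesis using prime_by_flips_no_source_sink[OF _ _ card n] by blast
  qed
qed

section \<open>Reversing arcs\<close>

abbreviation arc_of :: "'a pair_pre_digraph \<Rightarrow> 'a \<Rightarrow> 'a \<Rightarrow> bool" where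
  "arc_of T \<equiv> \<lambda>x y. (x, y) \<in> parcs T"

lemma module_of_iff: "module_of T M \<longleftrightarrow> rmodule (pverts T) (arc_of T) M"
  by (auto simp: module_of_def rmodule_def)

lemma indecomposable_iff:
  assumes "finite (pverts T)"
  shows "indecomposable T \<longleftrightarrow> (\<forall>M. \<not> ntmodule (pverts T) (arc_of T) M)"
proof -
  have "trivial_module T M \<longleftrightarrow> \<not> 2 \<le> card M \<or> M = pverts T" if "M \<subseteq> pverts T" for M
  proof -
    have "finite M" using that assms by (rule finite_subset)
    have "\<not> 2 \<le> card M \<longleftrightarrow> card M = 0 \<or> card M = 1" by linarith
    also have "\<dots> \<longleftrightarrow> M = {} \<or> (\<exists>x. M = {x})"
      using \<open>finite M\<close> by (simp only: card_0_eq card_1_singleton_iff One_nat_def)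
    finally have "\<not> 2 \<le> card M \<longleftrightarrow> M = {} \<or> (\<exists>x. M = {x})" .
    then show ?thesis using that unfolding trivial_module_def by blast
  qed
  moreover have "M \<subseteq> pverts T" if "rmodule (pverts T) (arc_of T) M" for M
    using that unfolding rmodule_def by (rule conjunct1)
  ultimately have "(rmodule (pverts T) (arc_of T) M \<longrightarrow> trivial_module T M) \<longleftrightarrow> \<not> ntmodule (pverts T) (arc_of T) M" for M
    unfolding ntmodule_def by blast
  then show ?thesis unfolding indecomposable_def module_of_iff by simp
qed

lemma tournament_rel:
  assumes "tournament T" shows "rel_tournament (pverts T) (arc_of T)"
proof -
  interpret tournament T by fact
  show ?thesis
  proof
    show "finite (pverts T)" by (rule pair_finite_verts)
    show "\<not> arc_of T x x" for x using no_loops' by blast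
    show "arc_of T x y = (\<not> arc_of T y x)" if "x \<in> pverts T" "y \<in> pverts T" "x \<noteq> y" for x y
      using that by (rule arc_iff)
  qed
qed

lemma tournament_arcs: "tournament T \<Longrightarrow> parcs T \<subseteq> pverts T \<times> pverts T"
proof -
  assume "tournament T"
  then interpret tournament T .
  show ?thesis using in_arcsD1 in_arcsD2 by auto
qed

lemma tournament_finite: "tournament T \<Longrightarrow> finite (pverts T)" "tournament T \<Longrightarrow> finite (parcs T)"
  using rel_tournament.fin[OF tournament_rel] tournament_arcs finite_subset[of "parcs T" "pverts T \<times> pverts T"] by auto

lemma tournament_asym: "tournament T \<Longrightarrow> (x, y) \<in> parcs T \<Longrightarrow> (y, x) \<notin> parcs T \<and> x \<noteq> y"
  using rel_tournament.arc[OF tournament_rel, of T x y] rel_tournament.irrefl[OF tournament_rel, of T x]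
    tournament_arcs[of T] by blast

text \<open>Each arc of \<open>B\<close> comes from its own member of \<open>ES\<close>. Members of
  \<open>ES\<close> that are not the two ends of an arc contribute nothing, so only an inequality is
  obtained.\<close>

lemma reversal_of_flips:
  assumes T: "tournament T" and "prime_by_flips n (pverts T) (arc_of T)"
  shows "\<exists>B\<subseteq>parcs T. card B \<le> n \<and> indecomposable (Inv T B)"
proof -
  obtain ES where ES: "finite ES" "card ES \<le> n" "\<And>M. \<not> ntmodule (pverts T) (flip ES (arc_of T)) M"
    using assms(2) unfolding prime_by_flips_def by blast
  define B where "B = {(x, y) \<in> parcs T. {x, y} \<in> ES}"
  have "inj_on (\<lambda>(x, y). {x, y}) B"
  proof (rule inj_onI, clarify)
    fix a b c d assume *: "(a, b) \<in> B" "(c, d) \<in> B" "{a, b} = {c, d}"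
    then have "(a, b) \<in> parcs T" "(c, d) \<in> parcs T" unfolding B_def by blast+
    then show "a = c \<and> b = d" using tournament_asym[OF T, of a b] *(3) unfolding doubleton_eq_iff by blast
  qed
  then have "card B \<le> card ES" using ES(1) by (intro card_inj_on_le) (auto simp: B_def)
  have eq: "arc_of (Inv T B) v x \<longleftrightarrow> flip ES (arc_of T) v x" if "v \<in> pverts T" "x \<in> pverts T" "v \<noteq> x" for v x
    using rel_tournament.arc[OF tournament_rel[OF T] that]
    by (auto simp: Inv_def flip_def B_def insert_commute)
  have "rmodule (pverts T) (arc_of (Inv T B)) M \<longleftrightarrow> rmodule (pverts T) (flip ES (arc_of T)) M" for M
  proof (cases "M \<subseteq> pverts T")
    case True
    then have "arc_of (Inv T B) v x \<longleftrightarrow> flip ES (arc_of T) v x" if "v \<in> pverts T - M" "x \<in> M" for v x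
      using eq[of v x] that by blast
    then show ?thesis unfolding rmodule_def by blast
  qed (simp add: rmodule_def)
  then have "\<not> ntmodule (pverts T) (arc_of (Inv T B)) M" for M
    using ES(3)[of M] unfolding ntmodule_def by blast
  moreover have "pverts (Inv T B) = pverts T" by (simp add: Inv_def)
  ultimately have "indecomposable (Inv T B)"
    using indecomposable_iff[of "Inv T B"] tournament_finite(1)[OF T] by simp
  moreover have "B \<subseteq> parcs T" unfolding B_def by blast
  ultimately show ?thesis using \<open>card B \<le> card ES\<close> ES(2) by (intro exI[of _ B]) linarith
qed

lemma rmodule_Inv:
  assumes "rmodule (pverts T) (arc_of T) M" "\<And>x y. (x, y) \<in> B \<Longrightarrow> x \<in> M \<longleftrightarrow> y \<in> M"
  shows "rmodule (pverts (Inv T B)) (arc_of (Inv T B)) M"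
proof -
  have eq: "arc_of (Inv T B) v x \<longleftrightarrow> arc_of T v x" if "v \<notin> M" "x \<in> M" for v x
    using assms(2)[of v x] assms(2)[of x v] that by (auto simp: Inv_def)
  have V: "pverts (Inv T B) = pverts T" by (simp add: Inv_def)
  show ?thesis unfolding V
  proof (rule rmoduleI)
    show "M \<subseteq> pverts T" using assms(1) unfolding rmodule_def by (rule conjunct1)
    fix x y v assume *: "x \<in> M" "y \<in> M" "v \<in> pverts T" "v \<notin> M" "arc_of (Inv T B) v x"
    then have "arc_of T v x" using eq by blast
    then have "arc_of T v y" using assms(1) * unfolding rmodule_def by blast
    then show "arc_of (Inv T B) v y" using eq * by blast
  qed
qed

section \<open>The decomposability index of the extremal and of all other tournaments\<close>

lemma twin_pairedE:
  assumes "twin_paired m V R"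
  obtains s t W f where "s \<noteq> t" "V = {s, t} \<union> W \<union> f ` W" "{s, t} \<inter> (W \<union> f ` W) = {}"
    "W \<inter> f ` W = {}" "inj_on f W" "card W = m"
    "\<forall>v\<in>V - {s}. R s v" "\<forall>v\<in>V - {t}. R v t"
    "\<forall>w\<in>W. R (f w) w \<and> rmodule V R {f w, w}"
  using assms unfolding twin_paired_def by (elim exE conjE) (rule that; assumption)

lemma twin_paired_lower_bound:
  assumes T: "tournament T" and P: "twin_paired (2 * n - 1) (pverts T) (arc_of T)" and n: "2 \<le> n"
    and B: "B \<subseteq> parcs T" "indecomposable (Inv T B)"
  shows "n + 1 \<le> card B"
proof -
  let ?V = "pverts T" and ?R = "arc_of T"
  interpret rel_tournament ?V ?R by (rule tournament_rel[OF T])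
  obtain s t W f where st: "s \<noteq> t" "?V = {s, t} \<union> W \<union> f ` W" "{s, t} \<inter> (W \<union> f ` W) = {}"
    and W: "W \<inter> f ` W = {}" "inj_on f W" "card W = 2 * n - 1"
    and src: "\<forall>v\<in>?V - {s}. ?R s v" and snk: "\<forall>v\<in>?V - {t}. ?R v t"
    and tw: "\<forall>w\<in>W. ?R (f w) w \<and> rmodule ?V ?R {f w, w}"
    using P by (rule twin_pairedE)
  have disjointD: "x \<noteq> y" if "x \<in> W" "y \<in> f ` W" for x y using that W(1) by (metis IntI emptyE)
  have finB: "finite B" using B(1) tournament_finite(2)[OF T] by (rule finite_subset)
  have finW: "finite W" using W(3) n by (intro card_ge_0_finite) linarith
  have W3: "3 \<le> card W" using W(3) n by linarith
  have prime: "\<not> ntmodule ?V (arc_of (Inv T B)) M" for M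
    using B(2) indecomposable_iff[of "Inv T B"] fin by (simp add: Inv_def)
  define F where "F = fst ` B \<union> snd ` B"
  have touch: "\<exists>x\<in>A. x \<in> F" if m: "rmodule ?V ?R M" and c: "2 \<le> card M" "M \<noteq> ?V" and A: "A = M \<or> A = ?V - M" for M A
  proof (rule ccontr)
    assume no: "\<not> ?thesis"
    have "x \<in> M \<longleftrightarrow> y \<in> M" if "(x, y) \<in> B" for x y
    proof -
      have "x \<in> F" "y \<in> F" using that unfolding F_def by (auto intro: rev_image_eqI)
      moreover have "x \<in> ?V" "y \<in> ?V" using that B(1) tournament_arcs[OF T] by blast+
      ultimately show ?thesis using no A by blast
    qed
    then have "rmodule ?V (arc_of (Inv T B)) M" using rmodule_Inv[OF m, of B] by (simp add: Inv_def)
    then show False using prime[of M] c unfolding ntmodule_def by blast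
  qed
  have sV: "s \<in> ?V" "t \<in> ?V" using st(2) by blast+
  have "W \<subseteq> ?V" "W \<subseteq> ?V - {s}" "W \<subseteq> ?V - {t}" using st(2,3) by blast+
  then have "card W \<le> card (?V - {s})" "card W \<le> card (?V - {t})" "card W \<le> card ?V"
    using fin by (auto intro: card_mono)
  then have cs: "2 \<le> card (?V - {s})" "2 \<le> card (?V - {t})" "3 \<le> card ?V" using W3 by linarith+
  have "s \<in> F" using touch[of "?V - {s}" "{s}"] source_compl_module[OF sV(1)] src cs sV by blast
  moreover have "t \<in> F" using touch[of "?V - {t}" "{t}"] sink_compl_module[OF sV(2)] snk cs sV by blast
  moreover have pair: "w \<in> F \<or> f w \<in> F" if w: "w \<in> W" for w
  proof -
    have "f w \<in> f ` W" using w by (rule imageI)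
    then have "f w \<noteq> w" using disjointD w by metis
    then have c2: "card {f w, w} = 2" by simp
    have ne: "{f w, w} \<noteq> ?V"
    proof
      assume "{f w, w} = ?V"
      then have "card ?V = 2" using c2 by simp
      then show False using cs(3) by linarith
    qed
    have "rmodule ?V ?R {f w, w}" using tw w by blast
    then have "\<exists>x\<in>{f w, w}. x \<in> F" using c2 ne by (intro touch[of "{f w, w}"]) auto
    then show ?thesis by blast
  qed
  define g where "g w = (if w \<in> F then w else f w)" for w
  have g: "g w \<in> F" "g w \<in> W \<union> f ` W" if "w \<in> W" for w using pair[OF that] that unfolding g_def by auto
  have "inj_on g W"
  proof (rule inj_onI)
    fix x y assume *: "x \<in> W" "y \<in> W" "g x = g y"
    have "f x \<noteq> y" "f y \<noteq> x" using disjointD[OF *(1) imageI[OF *(2), of f]]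
      disjointD[OF *(2) imageI[OF *(1), of f]] by simp_all
    then show "x = y" using * inj_onD[OF W(2), of x y] unfolding g_def by (auto split: if_splits)
  qed
  then have "card (g ` W) = 2 * n - 1" using W(3) by (simp add: card_image)
  moreover have "s \<notin> g ` W" "t \<notin> g ` W" using g(2) st(3) by blast+
  ultimately have "card (insert s (insert t (g ` W))) = 2 * n + 1" using st(1) finW n by simp
  moreover have "insert s (insert t (g ` W)) \<subseteq> F" using g(1) \<open>s \<in> F\<close> \<open>t \<in> F\<close> by blast
  moreover have "finite F" unfolding F_def using finB by simp
  ultimately have "2 * n + 1 \<le> card F" by (metis card_mono)
  also have "card F \<le> card (fst ` B) + card (snd ` B)" unfolding F_def by (rule card_Un_le)
  also have "\<dots> \<le> 2 * card B" using card_image_le[OF finB, of fst] card_image_le[OF finB, of snd] by linarith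
  finally show ?thesis by linarith
qed

lemma flip_flip: "flip A (flip B R) = flip ((A - B) \<union> (B - A)) R"
  by (auto simp: flip_def fun_eq_iff)

text \<open>Reversing the arc from the source to the sink leaves neither.\<close>

lemma twin_paired_upper_bound:
  assumes T: "rel_tournament V R" and P: "twin_paired (2 * n - 1) V R" and card: "card V = 4 * n" and n: "2 \<le> n"
  shows "prime_by_flips (n + 1) V R"
proof -
  interpret rel_tournament V R by fact
  obtain s t where st: "s \<noteq> t" "s \<in> V" "t \<in> V" and dom: "\<forall>v\<in>V - {s}. R s v" "\<forall>v\<in>V - {t}. R v t"
  proof (rule twin_pairedE[OF P])
    fix s t W f assume *: "s \<noteq> t" "V = {s, t} \<union> W \<union> f ` W" "\<forall>v\<in>V - {s}. R s v" "\<forall>v\<in>V - {t}. R v t"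
    have "s \<in> V" "t \<in> V" unfolding *(2) by simp_all
    with * show thesis by (intro that)
  qed
  have src: "\<And>v. v \<in> V \<Longrightarrow> v \<noteq> s \<Longrightarrow> R s v" and snk: "\<And>v. v \<in> V \<Longrightarrow> v \<noteq> t \<Longrightarrow> R v t"
    using dom by blast+
  let ?R = "flip {{s, t}} R"
  have T': "rel_tournament V ?R" by (rule flip_tournament) (use st in force)
  interpret F: rel_tournament V ?R by (rule T')
  have F: "?R x y \<longleftrightarrow> R x y" if "x \<notin> {s, t} \<or> y \<notin> {s, t}" for x y
    using that by (auto simp: flip_def doubleton_eq_iff)
  have "\<not> R t s" using src[OF st(3)] arc[of s t] st by blast
  then have ts: "?R t s" "\<not> ?R s t" using src[OF st(3)] st by (auto simp: flip_def insert_commute)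
  have "\<not> V \<subseteq> {s, t}"
  proof
    assume "V \<subseteq> {s, t}"
    then have "card V \<le> card {s, t}" by (intro card_mono) auto
    then show False using card n st by simp
  qed
  then obtain x where x: "x \<in> V" "x \<notin> {s, t}" by blast
  have "\<exists>v\<in>V. v \<noteq> u \<and> \<not> ?R u v" if u: "u \<in> V" for u
  proof (cases "u = s \<or> u = t")
    case True
    have "\<not> ?R t x" using snk[of x] F[of t x] arc[of x t] x st by blast
    then have "\<exists>v\<in>V. v \<noteq> t \<and> \<not> ?R t v" using x by (intro bexI[of _ x]) auto
    moreover have "\<exists>v\<in>V. v \<noteq> s \<and> \<not> ?R s v" using ts(2) st by (intro bexI[of _ t]) auto
    ultimately show ?thesis using True by (elim disjE) simp_all
  next
    case False
    then have "?R s u" using src[OF u] F[of s u] by blast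
    then have "\<not> ?R u s" using F.arc[OF st(2) u] False by metis
    then show ?thesis using False st by (intro bexI[of _ s]) auto
  qed
  note no_source = this
  have "\<not> twin_paired (2 * n - 1) V ?R"
  proof
    assume "twin_paired (2 * n - 1) V ?R"
    then show False
    proof (rule twin_pairedE)
      fix u t W f assume *: "V = {u, t} \<union> W \<union> f ` W" "\<forall>v\<in>V - {u}. ?R u v"
      have "u \<in> V" unfolding *(1) by simp
      then show False using no_source *(2) by blast
    qed
  qed
  then have "prime_by_flips n V ?R" using prime_by_flips_or_twin_paired[OF T' card n] by blast
  then obtain ES where ES: "finite ES" "card ES \<le> n" "\<And>M. \<not> ntmodule V (flip ES ?R) M"
    unfolding prime_by_flips_def by blast
  let ?ES = "(ES - {{s, t}}) \<union> ({{s, t}} - ES)"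
  have "card ?ES \<le> card (insert {s, t} ES)" using ES(1) by (intro card_mono) auto
  also have "\<dots> \<le> n + 1" using ES(1,2) by (simp add: card_insert_if)
  finally show ?thesis using ES by (intro prime_by_flipsI[of ?ES]) (auto simp: flip_flip)
qed

lemma decomp_index_cases:
  assumes T: "tournament T" and card: "card (pverts T) = 4 * n" and n: "2 \<le> n"
  shows "if twin_paired (2 * n - 1) (pverts T) (arc_of T) then decomp_index T = n + 1 else decomp_index T \<le> n"
proof -
  let ?P = "\<lambda>m. \<exists>B\<subseteq>parcs T. card B = m \<and> indecomposable (Inv T B)"
  have le: "decomp_index T \<le> m" if f: "prime_by_flips m (pverts T) (arc_of T)" for m
  proof -
    obtain B where B: "B \<subseteq> parcs T" "card B \<le> m" "indecomposable (Inv T B)"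
      using reversal_of_flips[OF T f] by blast
    then have "decomp_index T \<le> card B" unfolding decomp_index_def by (intro Least_le) blast
    then show ?thesis using B(2) by linarith
  qed
  show ?thesis
  proof (cases "twin_paired (2 * n - 1) (pverts T) (arc_of T)")
    case True
    have f: "prime_by_flips (n + 1) (pverts T) (arc_of T)"
      by (rule twin_paired_upper_bound[OF tournament_rel[OF T] True card n])
    then have "\<exists>m. ?P m" using reversal_of_flips[OF T] by blast
    then have "?P (decomp_index T)" unfolding decomp_index_def by (rule LeastI_ex)
    then obtain B where "B \<subseteq> parcs T" "card B = decomp_index T" "indecomposable (Inv T B)" by blast
    then have "n + 1 \<le> decomp_index T" using twin_paired_lower_bound[OF T True n, of B] by simp
    then show ?thesis using le[OF f] True by simp
  next
    case False
    then show ?thesis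
      using le prime_by_flips_or_twin_paired[OF tournament_rel[OF T] card n] by simp
  qed
qed

section \<open>Lexicographic sums\<close>

text \<open>When the ends of an arc are its two projections, the arc part of an isomorphism is
  forced to be \<open>map_prod h h\<close>. The inclusion expresses that \<open>G\<close> is well
  formed, which \<open>digraph_iso\<close> demands of its first argument.\<close>

lemma digraph_iso_with_proj_iff:
  "digraph_iso (with_proj G) (with_proj H) \<longleftrightarrow>
    parcs G \<subseteq> pverts G \<times> pverts G \<and>
    (\<exists>h. inj_on h (pverts G) \<and> pverts H = h ` pverts G \<and> parcs H = map_prod h h ` parcs G)"
  (is "?iso \<longleftrightarrow> ?wf \<and> ?ex")
proof
  assume ?iso
  then obtain f where f: "pre_digraph.digraph_isomorphism (with_proj G) f" "with_proj H = app_iso f (with_proj G)"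
    unfolding digraph_iso_def by blast
  have wf: "wf_digraph (with_proj G)" and inj: "inj_on (iso_verts f) (pverts G)"
    and arcs: "\<And>a. a \<in> parcs G \<Longrightarrow> iso_verts f (fst a) = iso_tail f (iso_arcs f a) \<and> iso_verts f (snd a) = iso_head f (iso_arcs f a)"
    using f(1) unfolding pre_digraph.digraph_isomorphism_def by auto
  have H: "pverts H = iso_verts f ` pverts G" "parcs H = iso_arcs f ` parcs G" "iso_tail f = fst" "iso_head f = snd"
    using f(2) unfolding with_proj_def app_iso_def by auto
  have "iso_arcs f a = map_prod (iso_verts f) (iso_verts f) a" if "a \<in> parcs G" for a
    using arcs[OF that] by (simp add: prod_eq_iff H(3,4))
  then have "parcs H = map_prod (iso_verts f) (iso_verts f) ` parcs G" using H(2) by (simp cong: image_cong)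
  moreover have ?wf using wf_digraph.wellformed[OF wf] by auto
  ultimately show "?wf \<and> ?ex" using inj H(1) by blast
next
  assume *: "?wf \<and> ?ex"
  then obtain h where h: "inj_on h (pverts G)" "pverts H = h ` pverts G" "parcs H = map_prod h h ` parcs G" by blast
  let ?f = "\<lparr>iso_verts = h, iso_arcs = map_prod h h, iso_head = snd, iso_tail = fst\<rparr>"
  have "wf_digraph (with_proj G)" using * by unfold_locales auto
  moreover have "inj_on (map_prod h h) (parcs G)"
    using map_prod_inj_on[OF h(1) h(1)] * by (rule_tac inj_on_subset) auto
  ultimately have "pre_digraph.digraph_isomorphism (with_proj G) ?f"
    unfolding pre_digraph.digraph_isomorphism_def using h(1) by auto
  moreover have "with_proj H = app_iso ?f (with_proj G)"
    using h(2,3) unfolding with_proj_def app_iso_def by simp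
  ultimately show ?iso unfolding digraph_iso_def by blast
qed

lemma tournamentI:
  assumes "rel_tournament (pverts T) (arc_of T)" "parcs T \<subseteq> pverts T \<times> pverts T"
  shows "tournament T"
proof -
  interpret rel_tournament "pverts T" "arc_of T" by fact
  show ?thesis
  proof
    show "fst e \<in> pverts T" "snd e \<in> pverts T" if "e \<in> parcs T" for e using assms(2) that by auto
    show "finite (pverts T)" by (rule fin)
    show "finite (parcs T)" by (rule finite_subset[OF assms(2)]) (simp add: fin)
    show "fst e \<noteq> snd e" if "e \<in> parcs T" for e using assms(2) irrefl that by (cases e) auto
    show "(x, y) \<in> parcs T \<longleftrightarrow> (y, x) \<notin> parcs T" if "x \<in> pverts T" "y \<in> pverts T" "x \<noteq> y" for x y
      using that by (rule arc)
  qed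
qed

lemma rel_tournament_image:
  assumes "rel_tournament V R" "inj_on h V" "\<And>x y. x \<in> V \<Longrightarrow> y \<in> V \<Longrightarrow> Q (h x) (h y) \<longleftrightarrow> R x y"
  shows "rel_tournament (h ` V) Q"
proof -
  interpret rel_tournament V R by fact
  show ?thesis
  proof
    show "finite (h ` V)" using fin by simp
    show "\<not> Q x x" if "x \<in> h ` V" for x using that assms(3) irrefl by auto
    show "Q x y \<longleftrightarrow> \<not> Q y x" if xy: "x \<in> h ` V" "y \<in> h ` V" "x \<noteq> y" for x y
    proof -
      obtain a b where ab: "a \<in> V" "b \<in> V" "x = h a" "y = h b" using xy by blast
      then show ?thesis using assms(3)[of a b] assms(3)[of b a] arc[of a b] xy(3) by metis
    qed
  qed
qed

lemma twin_paired_image: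
  assumes P: "twin_paired m V R" and h: "inj_on h V" "\<And>x y. x \<in> V \<Longrightarrow> y \<in> V \<Longrightarrow> Q (h x) (h y) \<longleftrightarrow> R x y"
  shows "twin_paired m (h ` V) Q"
  using P
proof (rule twin_pairedE)
  fix s t W f
  assume st: "s \<noteq> t" and V: "V = {s, t} \<union> W \<union> f ` W" and d: "{s, t} \<inter> (W \<union> f ` W) = {}"
    and W: "W \<inter> f ` W = {}" "inj_on f W" "card W = m"
    and src: "\<forall>v\<in>V - {s}. R s v" and snk: "\<forall>v\<in>V - {t}. R v t"
    and tw: "\<forall>w\<in>W. R (f w) w \<and> rmodule V R {f w, w}"
  \<comment> \<open>\<open>k\<close> undoes \<open>h\<close> on \<open>V\<close>, so the partner map
    on the image is \<open>h \<circ> f \<circ> k\<close>.\<close>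
  define k where "k = inv_into V h"
  have kh: "k (h x) = x" if "x \<in> V" for x using inv_into_f_f[OF h(1) that] unfolding k_def .
  have WV: "W \<subseteq> V" "f ` W \<subseteq> V" "s \<in> V" "t \<in> V" unfolding V by auto
  have im: "(h \<circ> f \<circ> k) ` h ` W = h ` f ` W"
  proof -
    have "(h \<circ> f \<circ> k) (h w) = h (f w)" if "w \<in> W" for w using kh[of w] WV(1) that by auto
    then show ?thesis by (simp add: image_image)
  qed
  have hi: "h x = h y \<longleftrightarrow> x = y" if "x \<in> V" "y \<in> V" for x y using inj_on_eq_iff[OF h(1) that] .
  have hI: "h ` A \<inter> h ` B = h ` (A \<inter> B)" if "A \<subseteq> V" "B \<subseteq> V" for A B
    using inj_on_image_Int[OF h(1) that] by simp
  show ?thesis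
    unfolding twin_paired_def
  proof (intro exI conjI)
    show "h s \<noteq> h t" using hi[OF WV(3,4)] st by simp
    show "h ` V = {h s, h t} \<union> h ` W \<union> (h \<circ> f \<circ> k) ` h ` W" unfolding im V by (simp add: image_Un)
    have "{h s, h t} \<inter> (h ` W \<union> h ` f ` W) = h ` {s, t} \<inter> h ` (W \<union> f ` W)" by (simp add: image_Un)
    also have "\<dots> = h ` ({s, t} \<inter> (W \<union> f ` W))" using WV by (intro hI) auto
    finally show "{h s, h t} \<inter> (h ` W \<union> (h \<circ> f \<circ> k) ` h ` W) = {}" unfolding im d by simp
    show "h ` W \<inter> (h \<circ> f \<circ> k) ` h ` W = {}" unfolding im hI[OF WV(1,2)] W(1) by simp
    show "inj_on (h \<circ> f \<circ> k) (h ` W)"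
    proof (rule inj_onI)
      fix x y assume "x \<in> h ` W" "y \<in> h ` W" and eq: "(h \<circ> f \<circ> k) x = (h \<circ> f \<circ> k) y"
      then obtain a b where ab: "a \<in> W" "b \<in> W" "x = h a" "y = h b" by blast
      then have "a \<in> V" "b \<in> V" "f a \<in> V" "f b \<in> V" using WV by auto
      then have "f a = f b" using eq ab hi[of "f a" "f b"] by (simp add: kh)
      then show "x = y" using inj_onD[OF W(2)] ab by blast
    qed
    show "card (h ` W) = m" using card_image[OF inj_on_subset[OF h(1) WV(1)]] W(3) by simp
    show "\<forall>v\<in>h ` V - {h s}. Q (h s) v" using src h(2) WV(3) by auto
    show "\<forall>v\<in>h ` V - {h t}. Q v (h t)" using snk h(2) WV(4) by auto
    show "\<forall>u\<in>h ` W. Q ((h \<circ> f \<circ> k) u) u \<and> rmodule (h ` V) Q {(h \<circ> f \<circ> k) u, u}"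
    proof
      fix u assume "u \<in> h ` W"
      then obtain w where w: "w \<in> W" "u = h w" by blast
      have wV: "w \<in> V" "f w \<in> V" using w WV by auto
      have eq: "(h \<circ> f \<circ> k) u = h (f w)" using w kh[OF wV(1)] by simp
      have m: "rmodule V R {f w, w}" and Rw: "R (f w) w" using tw w by blast+
      have "rmodule (h ` V) Q (h ` {f w, w})"
      proof (rule rmoduleI)
        show "h ` {f w, w} \<subseteq> h ` V" using wV by blast
        fix x y v assume xy: "x \<in> h ` {f w, w}" "y \<in> h ` {f w, w}" "v \<in> h ` V" "v \<notin> h ` {f w, w}" "Q v x"
        obtain a where a: "a \<in> {f w, w}" "x = h a" using xy(1) by blast
        obtain b where b: "b \<in> {f w, w}" "y = h b" using xy(2) by blast
        obtain c where c: "c \<in> V" "v = h c" using xy(3) by blast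
        have abV: "a \<in> V" "b \<in> V" using a b wV by blast+
        have "c \<notin> {f w, w}" using xy(4) c by blast
        then have "R c a \<longleftrightarrow> R c b" using m a(1) b(1) c(1) unfolding rmodule_def by blast
        then show "Q v y" using xy(5) a b c h(2) abV by simp
      qed
      then show "Q ((h \<circ> f \<circ> k) u) u \<and> rmodule (h ` V) Q {(h \<circ> f \<circ> k) u, u}"
        unfolding eq using Rw h(2)[OF wV(2,1)] w(2) by simp
    qed
  qed
qed

section \<open>The tournament of the theorem and its intrinsic form\<close>

definition extended_doubling :: "nat pair_pre_digraph \<Rightarrow> nat pair_pre_digraph" where
  "extended_doubling S = lex_sum (transitive_tournament 3)
    (\<lambda>i. [transitive_tournament 1, lex_product S (transitive_tournament 2), transitive_tournament 1] ! i)"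

abbreviation top_vertex :: nat where "top_vertex \<equiv> prod_encode (0, 0)"
abbreviation bottom_vertex :: nat where "bottom_vertex \<equiv> prod_encode (2, 0)"
abbreviation mid_vertex :: "nat \<Rightarrow> nat \<Rightarrow> nat" where "mid_vertex i x \<equiv> prod_encode (Suc 0, prod_encode (i, x))"

lemma pverts_extended_doubling:
  "pverts (extended_doubling S) = {top_vertex, bottom_vertex} \<union> (\<lambda>i. mid_vertex i 1) ` pverts S \<union> (\<lambda>i. mid_vertex i 0) ` pverts S"
proof -
  have 3: "{..<3} = {0, 1, 2::nat}" by auto
  have 2: "{..<2} = {0, 1::nat}" by auto
  have 1: "{..<Suc 0} = {0::nat}" by auto
  show ?thesis
    unfolding extended_doubling_def lex_product_def lex_sum_def transitive_tournament_def
    by (auto simp: 1 2 3 image_iff; force)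
qed

lemma arcs_extended_doubling:
  "(prod_encode (i, x), prod_encode (j, y)) \<in> parcs (extended_doubling S) \<longleftrightarrow>
    prod_encode (i, x) \<in> pverts (extended_doubling S) \<and> prod_encode (j, y) \<in> pverts (extended_doubling S) \<and>
    (i < j \<or> i = 1 \<and> j = 1 \<and> (x, y) \<in> parcs (lex_product S (transitive_tournament 2)))"
proof -
  have 3: "k < 3 \<longleftrightarrow> k = 0 \<or> k = 1 \<or> k = 2" for k :: nat by auto
  show ?thesis
    unfolding extended_doubling_def
    unfolding lex_sum_def[of "transitive_tournament 3"] transitive_tournament_def[of 3] transitive_tournament_def[of 1]
    by (auto simp: 3 lex_product_def lex_sum_def)
qed

lemma arcs_doubling:
  "(prod_encode (i, x), prod_encode (j, y)) \<in> parcs (lex_product S (transitive_tournament 2)) \<longleftrightarrow>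
    i \<in> pverts S \<and> j \<in> pverts S \<and> x < 2 \<and> y < 2 \<and> (i = j \<and> x < y \<or> i \<noteq> j \<and> (i, j) \<in> parcs S)"
  unfolding lex_product_def lex_sum_def transitive_tournament_def by auto

lemma arcs_extended_doubling_sub:
  "parcs (extended_doubling S) \<subseteq> pverts (extended_doubling S) \<times> pverts (extended_doubling S)"
  unfolding extended_doubling_def lex_sum_def by auto

lemma twin_paired_card:
  assumes "twin_paired m V R" "0 < m" shows "card V = 2 * m + 2"
  using assms(1)
proof (rule twin_pairedE)
  fix s t W f
  assume st: "s \<noteq> t" "V = {s, t} \<union> W \<union> f ` W" "{s, t} \<inter> (W \<union> f ` W) = {}"
    and W: "W \<inter> f ` W = {}" "inj_on f W" "card W = m"
  have finW: "finite W" using W(3) assms(2) by (intro card_ge_0_finite) simp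
  have "card (W \<union> f ` W) = m + m"
    using card_Un_disjoint[OF finW _ W(1)] finW card_image[OF W(2)] W(3) by simp
  moreover have "card ({s, t} \<union> (W \<union> f ` W)) = card {s, t} + card (W \<union> f ` W)"
    using finW st(3) by (intro card_Un_disjoint) simp_all
  ultimately show ?thesis using st(1) unfolding st(2) by (simp add: Un_assoc)
qed

lemma extended_doubling_cases:
  assumes "v \<in> pverts (extended_doubling S)"
  obtains "v = top_vertex" | "v = bottom_vertex" | i x where "i \<in> pverts S" "x < 2" "v = mid_vertex i x"
proof -
  have "v = top_vertex \<or> v = bottom_vertex \<or> (\<exists>i\<in>pverts S. v = mid_vertex i 1) \<or> (\<exists>i\<in>pverts S. v = mid_vertex i 0)"
    using assms unfolding pverts_extended_doubling by blast
  then show ?thesis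
  proof (elim disjE bexE)
    fix i assume "i \<in> pverts S" "v = mid_vertex i 1" then show ?thesis by (intro that(3)[of i 1]) simp_all
  next
    fix i assume "i \<in> pverts S" "v = mid_vertex i 0" then show ?thesis by (intro that(3)[of i 0]) simp_all
  qed (use that(1,2) in simp_all)
qed

lemma extended_doubling_verts:
  "top_vertex \<in> pverts (extended_doubling S)" "bottom_vertex \<in> pverts (extended_doubling S)"
  "i \<in> pverts S \<Longrightarrow> x < 2 \<Longrightarrow> mid_vertex i x \<in> pverts (extended_doubling S)"
  unfolding pverts_extended_doubling by (auto simp: less_2_cases_iff)

lemma extended_doubling_arcs:
  "(top_vertex, v) \<in> parcs (extended_doubling S) \<longleftrightarrow> v \<in> pverts (extended_doubling S) \<and> v \<noteq> top_vertex"
  "(v, bottom_vertex) \<in> parcs (extended_doubling S) \<longleftrightarrow> v \<in> pverts (extended_doubling S) \<and> v \<noteq> bottom_vertex"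
  "(v, top_vertex) \<notin> parcs (extended_doubling S)"
  "(bottom_vertex, v) \<notin> parcs (extended_doubling S)"
  "(mid_vertex i x, mid_vertex j y) \<in> parcs (extended_doubling S) \<longleftrightarrow>
    i \<in> pverts S \<and> j \<in> pverts S \<and> x < 2 \<and> y < 2 \<and> (i = j \<and> x < y \<or> i \<noteq> j \<and> (i, j) \<in> parcs S)"
proof -
  have v: "v \<in> pverts (extended_doubling S)" if "(u, v) \<in> parcs (extended_doubling S) \<or> (v, u) \<in> parcs (extended_doubling S)" for u
    using that arcs_extended_doubling_sub by blast
  show "(top_vertex, v) \<in> parcs (extended_doubling S) \<longleftrightarrow> v \<in> pverts (extended_doubling S) \<and> v \<noteq> top_vertex"
  proof (cases "v \<in> pverts (extended_doubling S)")
    case True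
    then show ?thesis by (cases rule: extended_doubling_cases) (simp_all add: arcs_extended_doubling extended_doubling_verts)
  qed (use v in blast)
  show "(v, bottom_vertex) \<in> parcs (extended_doubling S) \<longleftrightarrow> v \<in> pverts (extended_doubling S) \<and> v \<noteq> bottom_vertex"
  proof (cases "v \<in> pverts (extended_doubling S)")
    case True
    then show ?thesis by (cases rule: extended_doubling_cases) (simp_all add: arcs_extended_doubling extended_doubling_verts)
  qed (use v in blast)
  show "(v, top_vertex) \<notin> parcs (extended_doubling S)"
  proof (cases "v \<in> pverts (extended_doubling S)")
    case True
    then show ?thesis by (cases rule: extended_doubling_cases) (simp_all add: arcs_extended_doubling)
  qed (use v in blast)
  show "(bottom_vertex, v) \<notin> parcs (extended_doubling S)"
  proof (cases "v \<in> pverts (extended_doubling S)")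
    case True
    then show ?thesis by (cases rule: extended_doubling_cases) (simp_all add: arcs_extended_doubling)
  qed (use v in blast)
  show "(mid_vertex i x, mid_vertex j y) \<in> parcs (extended_doubling S) \<longleftrightarrow>
    i \<in> pverts S \<and> j \<in> pverts S \<and> x < 2 \<and> y < 2 \<and> (i = j \<and> x < y \<or> i \<noteq> j \<and> (i, j) \<in> parcs S)"
    using extended_doubling_verts(3)[of i S x] extended_doubling_verts(3)[of j S y]
    unfolding arcs_extended_doubling arcs_doubling by auto
qed

lemma extended_doubling_tournament:
  assumes S: "tournament S" shows "tournament (extended_doubling S)"
proof (rule tournamentI[OF _ arcs_extended_doubling_sub])
  let ?L = "extended_doubling S"
  interpret S: rel_tournament "pverts S" "arc_of S" by (rule tournament_rel[OF S])
  show "rel_tournament (pverts ?L) (arc_of ?L)"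
  proof
    show "finite (pverts ?L)" unfolding pverts_extended_doubling using S.fin by simp
    show "(x, x) \<notin> parcs ?L" if "x \<in> pverts ?L" for x
      using that by (cases rule: extended_doubling_cases) (auto simp: extended_doubling_arcs)
    show "(x, y) \<in> parcs ?L \<longleftrightarrow> (y, x) \<notin> parcs ?L" if x: "x \<in> pverts ?L" and y: "y \<in> pverts ?L" and xy: "x \<noteq> y" for x y
      using x
    proof (cases rule: extended_doubling_cases)
      case 1 then show ?thesis using y xy by (simp add: extended_doubling_arcs)
    next
      case 2 then show ?thesis using y xy by (simp add: extended_doubling_arcs)
    next
      case (3 i a)
      note x3 = 3
      show ?thesis using y
      proof (cases rule: extended_doubling_cases)
        case 1 then show ?thesis using x xy by (simp add: extended_doubling_arcs)
      next
        case 2 then show ?thesis using x xy by (simp add: extended_doubling_arcs)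
      next
        case (3 j b)
        show ?thesis
        proof (cases "i = j")
          case True
          then show ?thesis using x3 3 xy by (auto simp: extended_doubling_arcs)
        next
          case False
          then show ?thesis using x3 3 S.arc[of i j] by (simp add: extended_doubling_arcs)
        qed
      qed
    qed
  qed
qed

lemma extended_doubling_twin_paired:
  assumes S: "tournament S"
  shows "twin_paired (card (pverts S)) (pverts (extended_doubling S)) (arc_of (extended_doubling S))"
proof -
  let ?L = "extended_doubling S"
  \<comment> \<open>Within each copy of the two-vertex transitive tournament, vertex
    \<open>1\<close> is the sink.\<close>
  define W where "W = (\<lambda>i. mid_vertex i 1) ` pverts S"
  define f where "f v = mid_vertex (fst (prod_decode (snd (prod_decode v)))) 0" for v
  have f: "f (mid_vertex i x) = mid_vertex i 0" for i x by (simp add: f_def)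
  have fW: "f ` W = (\<lambda>i. mid_vertex i 0) ` pverts S" unfolding W_def by (simp add: image_image f)
  show ?thesis
    unfolding twin_paired_def
  proof (intro exI conjI)
    show "top_vertex \<noteq> bottom_vertex" by simp
    show "pverts ?L = {top_vertex, bottom_vertex} \<union> W \<union> f ` W"
      unfolding fW by (simp add: pverts_extended_doubling W_def)
    show "{top_vertex, bottom_vertex} \<inter> (W \<union> f ` W) = {}" unfolding fW W_def by (auto simp: f)
    show "W \<inter> f ` W = {}" unfolding fW W_def by (auto simp: f)
    show "inj_on f W" unfolding W_def by (rule inj_onI) (auto simp: f)
    show "card W = card (pverts S)" unfolding W_def by (intro card_image inj_onI) simp
    show "\<forall>v\<in>pverts ?L - {top_vertex}. (top_vertex, v) \<in> parcs ?L" by (simp add: extended_doubling_arcs)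
    show "\<forall>v\<in>pverts ?L - {bottom_vertex}. (v, bottom_vertex) \<in> parcs ?L" by (simp add: extended_doubling_arcs)
    show "\<forall>w\<in>W. (f w, w) \<in> parcs ?L \<and> rmodule (pverts ?L) (arc_of ?L) {f w, w}"
    proof
      fix w assume "w \<in> W"
      then obtain i where i: "i \<in> pverts S" "w = mid_vertex i 1" unfolding W_def by blast
      have eq: "{f w, w} = {mid_vertex i 0, mid_vertex i 1}" using i f by simp
      have "rmodule (pverts ?L) (arc_of ?L) {f w, w}"
        unfolding eq
      proof (rule rmoduleI)
        show "{mid_vertex i 0, mid_vertex i 1} \<subseteq> pverts ?L" using i extended_doubling_verts(3) by simp
        fix x y v assume xy: "x \<in> {mid_vertex i 0, mid_vertex i 1}" "y \<in> {mid_vertex i 0, mid_vertex i 1}"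
          and v: "v \<in> pverts ?L" "v \<notin> {mid_vertex i 0, mid_vertex i 1}" and vx: "(v, x) \<in> parcs ?L"
        obtain a b where ab: "x = mid_vertex i a" "y = mid_vertex i b" "a < 2" "b < 2"
          using xy by force
        show "(v, y) \<in> parcs ?L" using v(1)
        proof (cases rule: extended_doubling_cases)
          case 1 then show ?thesis using ab i extended_doubling_verts(3) by (simp add: extended_doubling_arcs)
        next
          case 2 then show ?thesis using vx by (simp add: extended_doubling_arcs)
        next
          case (3 j c)
          then have "j \<noteq> i" using v(2) by (auto simp: less_2_cases_iff)
          then show ?thesis using 3 vx ab by (simp add: extended_doubling_arcs)
        qed
      qed
      moreover have "(f w, w) \<in> parcs ?L" using i f by (simp add: extended_doubling_arcs)
      ultimately show "(f w, w) \<in> parcs ?L \<and> rmodule (pverts ?L) (arc_of ?L) {f w, w}" by blast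
    qed
  qed
qed

text \<open>\<open>S\<close> is the tournament induced on \<open>W\<close>, relabelled by natural
  numbers. Because each \<open>{f w, w}\<close> is a module, all arcs between two pairs point in the
  same direction as the arc between their sinks, so nothing else is left to choose.\<close>

lemma twin_paired_iso:
  assumes T: "tournament T" and P: "twin_paired m (pverts T) (arc_of T)" and m: "0 < m"
  shows "\<exists>S. tournament S \<and> card (pverts S) = m \<and> digraph_iso (with_proj T) (with_proj (extended_doubling S))"
  using P
proof (rule twin_pairedE)
  fix s t W f
  let ?V = "pverts T"
  assume st: "s \<noteq> t" and V: "?V = {s, t} \<union> W \<union> f ` W" and d: "{s, t} \<inter> (W \<union> f ` W) = {}"
    and W: "W \<inter> f ` W = {}" "inj_on f W" "card W = m"
    and src: "\<forall>v\<in>?V - {s}. arc_of T s v" and snk: "\<forall>v\<in>?V - {t}. arc_of T v t"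
    and tw: "\<forall>w\<in>W. arc_of T (f w) w \<and> rmodule ?V (arc_of T) {f w, w}"
  interpret rel_tournament ?V "arc_of T" by (rule tournament_rel[OF T])
  have finW: "finite W" using W(3) m by (intro card_ge_0_finite) simp
  have WV: "W \<subseteq> ?V" "f ` W \<subseteq> ?V" "s \<in> ?V" "t \<in> ?V" unfolding V by auto
  obtain c :: "'a \<Rightarrow> nat" where c: "inj_on c W" using finite_imp_inj_to_nat_seg[OF finW] by blast
  define S where "S = \<lparr>pverts = c ` W, parcs = {(c x, c y) | x y. x \<in> W \<and> y \<in> W \<and> (x, y) \<in> parcs T}\<rparr>"
  have Sarc: "(c x, c y) \<in> parcs S \<longleftrightarrow> (x, y) \<in> parcs T" if "x \<in> W" "y \<in> W" for x y
  proof
    assume "(c x, c y) \<in> parcs S"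
    then obtain x' y' where "x' \<in> W" "y' \<in> W" "(x', y') \<in> parcs T" "c x = c x'" "c y = c y'"
      unfolding S_def by auto
    then show "(x, y) \<in> parcs T" using inj_onD[OF c, of x x'] inj_onD[OF c, of y y'] that by simp
  qed (use that in \<open>auto simp: S_def\<close>)
  have SV: "pverts S = c ` W" by (simp add: S_def)
  have "rel_tournament W (arc_of T)" by (rule rel_tournament_subset[OF rel_tournament_axioms WV(1)])
  then have "rel_tournament (pverts S) (arc_of S)"
    unfolding SV by (rule rel_tournament_image[OF _ c]) (rule Sarc)
  moreover have "parcs S \<subseteq> pverts S \<times> pverts S" unfolding S_def by auto
  ultimately have tS: "tournament S" by (rule tournamentI)
  let ?L = "extended_doubling S"
  define g where "g = inv_into W f"
  have g: "g (f w) = w" if "w \<in> W" for w using inv_into_f_f[OF W(2) that] unfolding g_def .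
  define h where "h v = (if v = s then top_vertex else if v = t then bottom_vertex
    else if v \<in> W then mid_vertex (c v) 1 else mid_vertex (c (g v)) 0)" for v
  have ne: "w \<noteq> s" "w \<noteq> t" "f w \<noteq> s" "f w \<noteq> t" "f w \<notin> W" if "w \<in> W" for w
  proof -
    have "w \<in> W \<union> f ` W" "f w \<in> W \<union> f ` W" using that by simp_all
    then show "w \<noteq> s" "w \<noteq> t" "f w \<noteq> s" "f w \<noteq> t" using d by auto
    show "f w \<notin> W"
    proof
      assume "f w \<in> W"
      then have "f w \<in> W \<inter> f ` W" using that by simp
      then show False using W(1) by simp
    qed
  qed
  have hs: "h s = top_vertex" and ht: "h t = bottom_vertex" using st unfolding h_def by auto
  have hw: "h w = mid_vertex (c w) 1" and hf: "h (f w) = mid_vertex (c w) 0" if "w \<in> W" for w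
    using ne[OF that] that g[OF that] unfolding h_def by auto
  \<comment> \<open>\<open>r x w\<close> is the vertex that \<open>h\<close> sends to
    \<open>mid_vertex (c w) x\<close>: the source of the pair for \<open>x = 0\<close> and the sink
    for \<open>x = 1\<close>.\<close>
  define r where "r x w = (if x = (0::nat) then f w else w)" for x w
  have hr: "h (r x w) = mid_vertex (c w) x" if "w \<in> W" "x < 2" for x w
    using hw[OF that(1)] hf[OF that(1)] that(2) unfolding r_def by (auto simp: less_2_cases_iff)
  have rV: "r x w \<in> ?V" "r x w \<noteq> s" "r x w \<noteq> t" if "w \<in> W" for x w
    using WV ne[OF that] that unfolding r_def by auto
  have Vcases: "v = s \<or> v = t \<or> (\<exists>w\<in>W. \<exists>x<2. v = r x w)" if "v \<in> ?V" for v
  proof -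
    have "v = s \<or> v = t \<or> v \<in> W \<or> v \<in> f ` W" using that unfolding V by blast
    moreover have "\<exists>w\<in>W. \<exists>x<2. v = r x w" if "v \<in> W"
      using that by (intro bexI[of _ v] exI[of _ 1]) (simp_all add: r_def)
    moreover have "\<exists>w\<in>W. \<exists>x<2. v = r x w" if fv: "v \<in> f ` W"
    proof -
      obtain w where "w \<in> W" "v = f w" using fv by blast
      then show ?thesis by (intro bexI[of _ w] exI[of _ 0]) (simp_all add: r_def)
    qed
    ultimately show ?thesis by blast
  qed
  have cW: "c w \<in> pverts S" if "w \<in> W" for w using that SV by simp
  have rarc: "(r x w, r y w') \<in> parcs T \<longleftrightarrow> (w = w' \<and> x < y \<or> w \<noteq> w' \<and> (w, w') \<in> parcs T)"
    if w: "w \<in> W" "w' \<in> W" and xy: "x < 2" "y < 2" for w w' x y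
  proof (cases "w = w'")
    case True
    have a: "(f w, w) \<in> parcs T" using tw w by blast
    then have "(w, f w) \<notin> parcs T" using tournament_asym[OF T] by blast
    moreover have "(v, v) \<notin> parcs T" for v using tournament_asym[OF T] by blast
    ultimately show ?thesis using True a xy by (auto simp: r_def less_2_cases_iff)
  next
    case False
    have fne: "f w \<noteq> f w'" using inj_onD[OF W(2)] w False by blast
    have nfw: "f w \<noteq> w'" "f w' \<noteq> w" using ne(5) w by blast+
    have rin: "r x w \<in> {f w, w}" "r y w' \<in> {f w', w'}" unfolding r_def by simp_all
    have m: "rmodule ?V (arc_of T) {f w, w}" "rmodule ?V (arc_of T) {f w', w'}" using tw w by blast+
    have "r x w \<notin> {f w', w'}" using fne nfw False unfolding r_def by auto
    then have 1: "(r x w, r y w') \<in> parcs T \<longleftrightarrow> (r x w, w') \<in> parcs T"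
      using rmodule_in[OF m(2) rin(2), of w' "r x w"] rV(1)[OF w(1)] by simp
    have "w' \<notin> {f w, w}" using nfw False by auto
    then have 2: "(r x w, w') \<in> parcs T \<longleftrightarrow> (w, w') \<in> parcs T"
      using rmodule_out[OF m(1) rin(1), of w w'] WV w by auto
    show ?thesis using 1 2 False by simp
  qed
  have inj: "inj_on h ?V"
  proof (rule inj_onI)
    fix u v assume uv: "u \<in> ?V" "v \<in> ?V" "h u = h v"
    show "u = v" using Vcases[OF uv(1)] Vcases[OF uv(2)]
    proof (elim disjE bexE exE conjE)
      fix w x w' y assume "w \<in> W" "x < 2" "u = r x w" "w' \<in> W" "y < 2" "v = r y w'"
      then show ?thesis using uv(3) inj_onD[OF c, of w w'] by (simp add: hr)
    qed (use uv(3) hs ht in \<open>simp_all add: hr\<close>)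
  qed
  have verts: "pverts ?L = h ` ?V"
  proof -
    have "h ` W = (\<lambda>i. mid_vertex i 1) ` pverts S" "h ` f ` W = (\<lambda>i. mid_vertex i 0) ` pverts S"
      unfolding SV by (simp_all add: image_image hw hf cong: image_cong)
    then show ?thesis unfolding pverts_extended_doubling V by (simp add: image_Un hs ht)
  qed
  have arcs: "(h u, h v) \<in> parcs ?L \<longleftrightarrow> (u, v) \<in> parcs T" if uv: "u \<in> ?V" "v \<in> ?V" for u v
  proof -
    have nsrc: "(v, s) \<notin> parcs T" for v
      using src tournament_asym[OF T, of v s] tournament_arcs[OF T] by blast
    have nsnk: "(t, v) \<notin> parcs T" for v
      using snk tournament_asym[OF T, of t v] tournament_arcs[OF T] by blast
    have hV: "h u \<in> pverts ?L" "h v \<in> pverts ?L" using uv verts by auto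
    consider "u = s" | "u = t" | "v = s" | "v = t"
      | w x w' y where "w \<in> W" "x < 2" "u = r x w" "w' \<in> W" "y < 2" "v = r y w'"
      using Vcases[OF uv(1)] Vcases[OF uv(2)] by blast
    then show ?thesis
    proof cases
      case 1
      have "h v \<noteq> h s \<longleftrightarrow> v \<noteq> s" using inj_on_eq_iff[OF inj uv(2) WV(3)] by simp
      moreover have "(s, v) \<in> parcs T \<longleftrightarrow> v \<noteq> s" using src uv(2) nsrc by blast
      ultimately show ?thesis using 1 hV by (simp add: hs extended_doubling_arcs)
    next
      case 2 then show ?thesis using nsnk by (simp add: ht extended_doubling_arcs)
    next
      case 3 then show ?thesis using nsrc by (simp add: hs extended_doubling_arcs)
    next
      case 4
      have "h u \<noteq> h t \<longleftrightarrow> u \<noteq> t" using inj_on_eq_iff[OF inj uv(1) WV(4)] by simp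
      moreover have "(u, t) \<in> parcs T \<longleftrightarrow> u \<noteq> t" using snk uv(1) nsnk by blast
      ultimately show ?thesis using 4 hV by (simp add: ht extended_doubling_arcs)
    next
      case 5
      have "c w = c w' \<longleftrightarrow> w = w'" using inj_on_eq_iff[OF c 5(1,4)] .
      then show ?thesis using 5 cW by (simp add: hr extended_doubling_arcs rarc Sarc)
    qed
  qed
  have "parcs ?L = map_prod h h ` parcs T"
  proof (rule set_eqI, clarify)
    fix p q
    show "(p, q) \<in> parcs ?L \<longleftrightarrow> (p, q) \<in> map_prod h h ` parcs T"
    proof
      assume pq: "(p, q) \<in> parcs ?L"
      then have "p \<in> h ` ?V" "q \<in> h ` ?V" using arcs_extended_doubling_sub verts by blast+
      then obtain u v where "u \<in> ?V" "v \<in> ?V" "p = h u" "q = h v" by blast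
      then show "(p, q) \<in> map_prod h h ` parcs T" using arcs pq by (intro image_eqI[of _ _ "(u, v)"]) simp_all
    next
      assume "(p, q) \<in> map_prod h h ` parcs T"
      then show "(p, q) \<in> parcs ?L" using arcs tournament_arcs[OF T] by auto
    qed
  qed
  then have "digraph_iso (with_proj T) (with_proj ?L)"
    unfolding digraph_iso_with_proj_iff using tournament_arcs[OF T] inj verts by blast
  moreover have "card (pverts S) = m" unfolding SV using card_image[OF c] W(3) by simp
  ultimately show ?thesis using tS by blast
qed

text \<open>\<open>T\<close> is not known to be a tournament beforehand; this property and the twin
  pairs are both pulled back along the inverse of the isomorphism.\<close>

lemma iso_extended_doubling:
  assumes S: "tournament S" and iso: "digraph_iso (with_proj T) (with_proj (extended_doubling S))"
  shows "tournament T \<and> twin_paired (card (pverts S)) (pverts T) (arc_of T)"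
proof -
  let ?L = "extended_doubling S"
  obtain h where sub: "parcs T \<subseteq> pverts T \<times> pverts T" and h: "inj_on h (pverts T)" "pverts ?L = h ` pverts T"
      "parcs ?L = map_prod h h ` parcs T"
    using iso unfolding digraph_iso_with_proj_iff by blast
  define k where "k = inv_into (pverts T) h"
  have kh: "k (h x) = x" if "x \<in> pverts T" for x using inv_into_f_f[OF h(1) that] unfolding k_def .
  have k: "inj_on k (pverts ?L)" unfolding h(2) k_def by (rule inj_on_inv_into) simp
  have V: "k ` pverts ?L = pverts T" unfolding h(2) by (simp add: image_image kh)
  have arcs: "(k x, k y) \<in> parcs T \<longleftrightarrow> (x, y) \<in> parcs ?L" if xy: "x \<in> pverts ?L" "y \<in> pverts ?L" for x y
  proof -
    obtain u v where uv: "u \<in> pverts T" "v \<in> pverts T" "x = h u" "y = h v" using xy h(2) by auto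
    have "(h u, h v) \<in> map_prod h h ` parcs T \<longleftrightarrow> (u, v) \<in> parcs T"
    proof
      assume "(h u, h v) \<in> map_prod h h ` parcs T"
      then obtain a b where ab: "(a, b) \<in> parcs T" "h u = h a" "h v = h b" by auto
      then have "a \<in> pverts T" "b \<in> pverts T" using sub by auto
      then show "(u, v) \<in> parcs T" using ab inj_onD[OF h(1), of u a] inj_onD[OF h(1), of v b] uv by simp
    qed (auto intro: image_eqI[of _ _ "(u, v)"])
    then show ?thesis using uv h(3) by (simp add: kh)
  qed
  have tL: "rel_tournament (pverts ?L) (arc_of ?L)"
    by (rule tournament_rel[OF extended_doubling_tournament[OF S]])
  have "rel_tournament (k ` pverts ?L) (arc_of T)"
    by (rule rel_tournament_image[OF tL k]) (rule arcs)
  then have "tournament T" unfolding V using sub by (rule tournamentI)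
  moreover have "twin_paired (card (pverts S)) (k ` pverts ?L) (arc_of T)"
    by (rule twin_paired_image[OF extended_doubling_twin_paired[OF S] k]) (rule arcs)
  ultimately show ?thesis unfolding V by blast
qed

section \<open>The value of the maximum and the characterization\<close>

lemma transitive_tournament: "tournament (transitive_tournament k)"
  by (rule tournamentI; (unfold_locales)?) (auto simp: transitive_tournament_def)

lemma max_decomp_index_4n:
  assumes n: "2 \<le> n" shows "max_decomp_index (4 * n) = n + 1"
  unfolding max_decomp_index_def
proof (rule Max_eqI)
  let ?A = "{decomp_index T |T :: nat pair_pre_digraph. tournament T \<and> card (pverts T) = 4 * n}"
  have le: "y \<le> n + 1" if "y \<in> ?A" for y
  proof -
    obtain T :: "nat pair_pre_digraph" where T: "tournament T" "card (pverts T) = 4 * n" "y = decomp_index T"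
      using \<open>y \<in> ?A\<close> by blast
    show ?thesis using decomp_index_cases[OF T(1,2) n] T(3) by (simp split: if_splits)
  qed
  then have "?A \<subseteq> {..n + 1}" by blast
  then show "finite ?A" by (rule finite_subset) simp
  show "y \<le> n + 1" if "y \<in> ?A" for y using le[OF that] .
  \<comment> \<open>Every tournament with \<open>2 * n - 1\<close> vertices gives one that attains
    the maximum; the transitive one is merely a concrete example.\<close>
  define L where "L = extended_doubling (transitive_tournament (2 * n - 1))"
  have tL: "tournament L"
    unfolding L_def by (rule extended_doubling_tournament[OF transitive_tournament])
  have c: "card (pverts (transitive_tournament (2 * n - 1))) = 2 * n - 1" by (simp add: transitive_tournament_def)
  have P: "twin_paired (2 * n - 1) (pverts L) (arc_of L)"
    using extended_doubling_twin_paired[OF transitive_tournament, of "2 * n - 1"] unfolding L_def c .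
  have card: "card (pverts L) = 4 * n" using twin_paired_card[OF P] n by simp
  then have "decomp_index L = n + 1" using decomp_index_cases[OF tL card n] P by simp
  then show "n + 1 \<in> ?A" using tL card by (intro CollectI exI[of _ L]) simp
qed

theorem theorem6p1:
  fixes n :: nat and T :: "'a pair_pre_digraph"
  assumes "n \<ge> 2"
  shows "T \<in> max_decomp_class (4 * n) \<longleftrightarrow>
    (\<exists>S :: nat pair_pre_digraph. tournament S \<and> card (pverts S) = 2 * n - 1 \<and>
       digraph_iso (with_proj T)
         (with_proj (lex_sum (transitive_tournament 3)
           (\<lambda>i. [transitive_tournament 1,
                 lex_product S (transitive_tournament 2),
                 transitive_tournament 1] ! i))))"
  unfolding extended_doubling_def[symmetric]
proof
  assume "T \<in> max_decomp_class (4 * n)"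
  then have T: "tournament T" "card (pverts T) = 4 * n" "decomp_index T = n + 1"
    unfolding max_decomp_class_def max_decomp_index_4n[OF assms] by blast+
  then have "twin_paired (2 * n - 1) (pverts T) (arc_of T)"
    using decomp_index_cases[OF T(1,2) assms] by (simp split: if_splits)
  then show "\<exists>S. tournament S \<and> card (pverts S) = 2 * n - 1 \<and> digraph_iso (with_proj T) (with_proj (extended_doubling S))"
    using twin_paired_iso[OF T(1)] assms by simp
next
  assume "\<exists>S. tournament S \<and> card (pverts S) = 2 * n - 1 \<and> digraph_iso (with_proj T) (with_proj (extended_doubling S))"
  then obtain S where S: "tournament S" "card (pverts S) = 2 * n - 1"
    "digraph_iso (with_proj T) (with_proj (extended_doubling S))" by blast
  then have T: "tournament T" and P: "twin_paired (2 * n - 1) (pverts T) (arc_of T)"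
    using iso_extended_doubling[OF S(1,3)] by simp_all
  have card: "card (pverts T) = 4 * n" using twin_paired_card[OF P] assms by simp
  then have "decomp_index T = n + 1" using decomp_index_cases[OF T card assms] P by simp
  then show "T \<in> max_decomp_class (4 * n)"
    unfolding max_decomp_class_def max_decomp_index_4n[OF assms] using T card by blast
qed

end
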